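(* Let $m=0$, $\mu,\kappa>0$, $a=\sqrt{\kappa/\mu}$. Let $F\in C^1(\mathbb{R})$ satisfy $F(y)\to-\infty$ as $y\to+\infty$ and $F(y)\to+\infty$ as $y\to-\infty$, and let $(u_0,u_1)\in\mathcal{H}^\omega$ for some $\omega>0$. Then for every solution $u(x,t)\in\mathcal{E}$ of the Cauchy problem consisting of the string equation $$\mu\,\ddot u(x,t)=\kappa u''(x,t)+\delta(x)F(u(x,t)),\qquad t\in\mathbb{R},\ x\in\mathbb{R},$$ with initial data $u|_{t=0}=u_0$, $\dot u|_{t=0}=u_1$, there exists a solution $u_p(x,t)\in\mathcal{E}$ of the same string equation such that $$u_p(x,t+\omega/a)=u_p(x,t)\quad\text{for all }(x,t)\in\mathbb{R}^2\text{ with }|t|>|x|/a,$$ and for every $R>0$, $$\int_{|x|<R}\left(|\dot u(x,t)-\dot u_p(x,t)|^2+|u'(x,t)-u_p'(x,t)|^2\right)dx+\max_{|x|<R}|u(x,t)-u_p(x,t)|\to0\quad\text{as }t\to\infty.$$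
   Context: Notation: $\dot u=\partial u/\partial t$, $u'=\partial u/\partial x$; $\delta$ is the Dirac delta. Class $\mathcal{E}$: $u\in\mathcal{E}$ iff $u\in C(\mathbb{R}^2)$ and $\dot u,u'\in L^2_{\rm loc}(\mathbb{R}^2)$ (distributional derivatives). Meaning of the equation (with $m=0$): by definition it is equivalent to the system $\mu\ddot u=\kappa u''$ for $t\in\mathbb{R}$, $x\in\mathbb{R}\setminus\{0\}$, together with $0=F(y(t))+\kappa[u'(0+,t)-u'(0-,t)]$ for $t\in\mathbb{R}$, where $y(t)=u(0,t)$. The first equation is understood in the sense of distributions in $\{x\neq0\}$; it is equivalent to the d'Alembert decomposition $u(x,t)=f_\pm(x-at)+g_\pm(x+at)$ for $\pm x>0$, $t\in\mathbb{R}$, with $f_\pm,g_\pm\in C(\mathbb{R})$ (and $f_\pm',g_\pm'\in L^2_{\rm loc}(\mathbb{R})$ when $u\in\mathcal{E}$). In the second equation, $u'(0\pm,t):=f_\pm'(-at)+g_\pm'(at)$, as an element of $L^2_{\rm loc}(\mathbb{R})$. The initial conditions are understood through the d'Alembert decomposition: $f_\pm(x)+g_\pm(x)=u_0(x)$ and $-a f_\pm'(x)+a g_\pm'(x)=u_1(x)$ for $\pm x>0$. Class $P^\omega$: a function $w$ on $\mathbb{R}$ is in $P^\omega$ iff $w(x+\omega)=w(x)$ for $x>0$ and $w(x-\omega)=w(x)$ for $x<0$. Class $\mathcal{H}$: $(u_0,u_1)\in\mathcal{H}$ iff $u_0\in C(\mathbb{R})$ and $u_0',u_1\in L^2_{\rm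 loc}(\mathbb{R})$. Class $\mathcal{H}^\omega$: $(u_0,u_1)\in\mathcal{H}^\omega$ iff $u_0\in C^1(\mathbb{R})$, $u_1\in C(\mathbb{R})$ and $u_0,u_0',u_1\in P^\omega$. *)

theory Defs
  imports "HOL-Analysis.Analysis"
begin

definition partial :: "'a \<Rightarrow> ('a::euclidean_space \<Rightarrow> real) \<Rightarrow> 'a \<Rightarrow> real" where
  "partial b f z = frechet_derivative f (at z) b"

primrec C_k :: "nat \<Rightarrow> ('a::euclidean_space \<Rightarrow> real) \<Rightarrow> bool" where
  "C_k 0 f \<longleftrightarrow> continuous_on UNIV f"
| "C_k (Suc k) f \<longleftrightarrow> f differentiable_on UNIV \<and> (\<forall>b\<in>Basis. C_k k (partial b f))"

definition test_function :: "'a set \<Rightarrow> ('a::euclidean_space \<Rightarrow> real) \<Rightarrow> bool" where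
  "test_function S \<phi> \<longleftrightarrow> (\<forall>k. C_k k \<phi>) \<and>
     compact (closure {z. \<phi> z \<noteq> 0}) \<and> closure {z. \<phi> z \<noteq> 0} \<subseteq> S"

text \<open>Elements of $L^2_{loc}$ are represented by Borel functions; identities between them are
  stated almost everywhere.\<close>

definition L2_loc :: "('a::euclidean_space \<Rightarrow> real) \<Rightarrow> bool" where
  "L2_loc f \<longleftrightarrow> f \<in> borel_measurable borel \<and>
     (\<forall>K. compact K \<longrightarrow> set_integrable lborel K (\<lambda>z. (f z)\<^sup>2))"

text \<open>\<open>v\<close> is the distributional derivative of \<open>u\<close> in the direction \<open>b\<close>; both are meant to be
  locally integrable. On the real line, \<open>b = 1\<close>.\<close>

definition weak_partial ::
    "'a \<Rightarrow> ('a::euclidean_space \<Rightarrow> real) \<Rightarrow> ('a \<Rightarrow> real) \<Rightarrow> bool" where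
  "weak_partial b u v \<longleftrightarrow> (\<forall>\<phi>. test_function UNIV \<phi> \<longrightarrow>
     (\<integral>z. u z * partial b \<phi> z \<partial>lborel) = - (\<integral>z. v z * \<phi> z \<partial>lborel))"

text \<open>Functions on the plane take the argument \<open>(x, t)\<close>: position first, time second.\<close>

definition class_E :: "(real \<times> real \<Rightarrow> real) set" where
  "class_E = {u. continuous_on UNIV u \<and>
     (\<exists>u_t. L2_loc u_t \<and> weak_partial (0, 1) u u_t) \<and>
     (\<exists>u_x. L2_loc u_x \<and> weak_partial (1, 0) u u_x)}"

definition wave_eq_off_0 :: "real \<Rightarrow> real \<Rightarrow> (real \<times> real \<Rightarrow> real) \<Rightarrow> bool" where
  "wave_eq_off_0 \<mu> \<kappa> u \<longleftrightarrow> (\<forall>\<phi>. test_function {z. fst z \<noteq> 0} \<phi> \<longrightarrow>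
     (\<integral>z. u z * (\<mu> * partial (0, 1) (partial (0, 1) \<phi>) z) \<partial>lborel) =
     (\<integral>z. u z * (\<kappa> * partial (1, 0) (partial (1, 0) \<phi>) z) \<partial>lborel))"

text \<open>The d'Alembert decomposition on the two half-planes. The first argument of
  \<open>f\<close>, \<open>g\<close>, \<open>f'\<close>, \<open>g'\<close> is the side: \<open>1\<close> for $f_+, g_+$ and \<open>- 1\<close> for $f_-, g_-$;
  other values are irrelevant. \<open>f' s\<close>, \<open>g' s\<close> are the $L^2_{loc}$ derivatives, so the
  functions \<open>f s\<close>, \<open>g s\<close> are determined by \<open>u\<close> up to a constant
  and \<open>f' s\<close>, \<open>g' s\<close> up to null sets.\<close>

definition dalembert :: "real \<Rightarrow> (real \<times> real \<Rightarrow> real) \<Rightarrow>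
    (real \<Rightarrow> real \<Rightarrow> real) \<Rightarrow> (real \<Rightarrow> real \<Rightarrow> real) \<Rightarrow>
    (real \<Rightarrow> real \<Rightarrow> real) \<Rightarrow> (real \<Rightarrow> real \<Rightarrow> real) \<Rightarrow> bool" where
  "dalembert a u f g f' g' \<longleftrightarrow>
     (\<forall>s\<in>{1, - 1}.
        continuous_on UNIV (f s) \<and> L2_loc (f' s) \<and> weak_partial 1 (f s) (f' s) \<and>
        continuous_on UNIV (g s) \<and> L2_loc (g' s) \<and> weak_partial 1 (g s) (g' s)) \<and>
     (\<forall>x t. x \<noteq> 0 \<longrightarrow> u (x, t) = f (sgn x) (x - a * t) + g (sgn x) (x + a * t))"

text \<open>The string equation with $m = 0$. The jump $u'(0+,t) - u'(0-,t)$ is the element of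
  $L^2_{loc}$ given by the d'Alembert decomposition.\<close>

definition string_solution ::
    "real \<Rightarrow> real \<Rightarrow> (real \<Rightarrow> real) \<Rightarrow> (real \<times> real \<Rightarrow> real) \<Rightarrow> bool" where
  "string_solution \<mu> \<kappa> F u \<longleftrightarrow> wave_eq_off_0 \<mu> \<kappa> u \<and>
     (let a = sqrt (\<kappa> / \<mu>) in
      \<exists>f g f' g'. dalembert a u f g f' g' \<and>
        (AE t in lborel. 0 = F (u (0, t)) +
           \<kappa> * ((f' 1 (- a * t) + g' 1 (a * t)) - (f' (- 1) (- a * t) + g' (- 1) (a * t)))))"

definition initial_data ::
    "real \<Rightarrow> (real \<Rightarrow> real) \<Rightarrow> (real \<Rightarrow> real) \<Rightarrow> (real \<times> real \<Rightarrow> real) \<Rightarrow> bool" where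
  "initial_data a u0 u1 u \<longleftrightarrow>
     (\<exists>f g f' g'. dalembert a u f g f' g' \<and>
        (\<forall>x. x \<noteq> 0 \<longrightarrow> f (sgn x) x + g (sgn x) x = u0 x) \<and>
        (AE x in lborel. x \<noteq> 0 \<longrightarrow> - a * f' (sgn x) x + a * g' (sgn x) x = u1 x))"

text \<open>A derivative in \<open>L2_loc\<close> of the plane has no restriction to a single time \<open>t\<close>.
  For solutions, $\dot u(\cdot,t)$ and $u'(\cdot,t)$ are defined for every \<open>t\<close>, as elements of
  $L^2_{loc}$ of the line, by the d'Alembert decomposition.\<close>

definition time_slice_derivs :: "real \<Rightarrow> (real \<times> real \<Rightarrow> real) \<Rightarrow>
    (real \<times> real \<Rightarrow> real) \<Rightarrow> (real \<times> real \<Rightarrow> real) \<Rightarrow> bool" where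
  "time_slice_derivs a u u_t u_x \<longleftrightarrow>
     (\<exists>f g f' g'. dalembert a u f g f' g' \<and>
        (\<forall>x t. x \<noteq> 0 \<longrightarrow>
           u_t (x, t) = - a * f' (sgn x) (x - a * t) + a * g' (sgn x) (x + a * t) \<and>
           u_x (x, t) = f' (sgn x) (x - a * t) + g' (sgn x) (x + a * t)))"

definition class_P :: "real \<Rightarrow> (real \<Rightarrow> real) set" where
  "class_P \<omega> = {w. (\<forall>x>0. w (x + \<omega>) = w x) \<and> (\<forall>x<0. w (x - \<omega>) = w x)}"

definition class_H_per :: "real \<Rightarrow> ((real \<Rightarrow> real) \<times> (real \<Rightarrow> real)) set" where
  "class_H_per \<omega> = {(u0, u1). u0 C1_differentiable_on UNIV \<and> continuous_on UNIV u1 \<and>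
     u0 \<in> class_P \<omega> \<and> deriv u0 \<in> class_P \<omega> \<and> u1 \<in> class_P \<omega>}"

end

theory Submission
  imports Defs
begin

text \<open>On each half-line \<open>u\<close> is a sum of two travelling waves, \<open>f s (x - a t) + g s (x + a t)\<close>. For
\<open>t > 0\<close> the waves running towards the origin are \<open>g 1\<close> at positive and \<open>f (- 1)\<close> at negative
arguments; the initial data determine them, and their derivatives \<open>(u0' + u1 / a) / 2\<close> and
\<open>(u0' - u1 / a) / 2\<close> inherit the period \<open>\<omega>\<close> on those half-lines. The outgoing waves are determined
by the incoming ones and by \<open>y t = u (0, t)\<close>. Eliminating the outgoing waves from the jump condition
leaves a scalar equation \<open>y' = c F(y) + p(t)\<close> for \<open>t > 0\<close>, with \<open>c = a / (2 \<kappa>)\<close> and a continuous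
forcing \<open>p\<close> of period \<open>T = \<omega> / a\<close> (\<open>boundary_ode\<close>, \<open>initial_data_derivatives\<close>).

The signs of \<open>F\<close> at infinity keep \<open>y\<close> bounded. Since \<open>F\<close> is locally Lipschitz, solutions do not
cross, so \<open>y\<close> and its translate by \<open>T\<close> stay ordered and the sequence \<open>y (t + n T)\<close> is monotone in
\<open>n\<close>. Its limit \<open>z t\<close> is a \<open>T\<close>-periodic solution on the whole line, and \<open>y - z\<close> tends to \<open>0\<close>
(\<open>dissipative_ode_periodic_attractor\<close>).

To obtain a solution of the string equation from \<open>z\<close>, the derivatives of the two incoming waves are
continued \<open>\<omega>\<close>-periodically to the whole line, and the outgoing waves are defined so that both
half-lines have the boundary value \<open>z\<close> at all times, negative ones included. The incoming waves
themselves are periodic only up to a linear drift, but an incoming wave and its reflection enter with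
opposite signs and the drifts cancel. Hence this solution is periodic in \<open>t\<close> everywhere.
For \<open>a t > \<bar>x\<bar>\<close> the two solutions have the same incoming waves at \<open>(x, t)\<close>, so they differ by
\<open>(y - z) (t - \<bar>x\<bar> / a)\<close>, and their derivatives differ by multiples of \<open>c F(y) - c F(z)\<close> at the same
time; both tend to \<open>0\<close> uniformly for \<open>x\<close> in a bounded set (\<open>local_convergence\<close>).

Two bridges connect weak with classical derivatives. A weak derivative on the line satisfies the
fundamental theorem of calculus (\<open>weak_partial_imp_ftc\<close>), so almost everywhere identities become
identities between increments, where continuity can be used. Conversely, waves with
\<open>C\<^sup>1\<close> profiles glued continuously along the axis lie in \<open>class_E\<close> and solve the wave equation in
the sense of distributions (\<open>glued_waves\<close>).\<close>

section \<open>Smooth functions of one variable\<close>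

lemma partial_real_eq: "(f has_real_derivative D) (at x) \<Longrightarrow> partial 1 f x = D"
  unfolding partial_def has_field_derivative_def
  by (drule frechet_derivative_at) (metis mult.right_neutral)

lemma C_k_SucI_real:
  assumes "\<And>x. (f has_real_derivative f' x) (at x)" and "C_k k f'"
  shows "C_k (Suc k) f"
proof -
  have "partial 1 f = f'" using partial_real_eq[OF assms(1)] by (auto simp: fun_eq_iff)
  moreover have "f differentiable_on UNIV"
    unfolding differentiable_on_def using assms(1)
    by (meson has_field_derivative_imp_has_derivative differentiable_def)
  ultimately show ?thesis using assms(2) by simp
qed

lemma C_k_SucE_real:
  fixes f :: "real \<Rightarrow> real"
  assumes "C_k (Suc k) f"
  shows "(f has_real_derivative partial 1 f x) (at x)" "C_k k (partial 1 f)"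
proof -
  have "f differentiable (at x)" using assms by (auto simp: differentiable_on_def)
  then obtain D where D: "(f has_real_derivative D) (at x)"
    using real_differentiable_def by blast
  then show "(f has_real_derivative partial 1 f x) (at x)" using partial_real_eq by metis
  show "C_k k (partial 1 f)" using assms by simp
qed

lemma C_k_SucD: "C_k (Suc k) f \<Longrightarrow> C_k k f"
proof (induction k arbitrary: f)
  case 0
  then show ?case by (simp add: differentiable_imp_continuous_on)
next
  case (Suc k)
  then show ?case by (metis C_k.simps(2))
qed

lemma C_k_const: "C_k k (\<lambda>x::real. c)"
proof (induction k arbitrary: c)
  case (Suc k)
  show ?case by (rule C_k_SucI_real[where f' = "\<lambda>_. 0"]) (auto intro: Suc)
qed simp

lemma C_k_add:
  fixes f g :: "real \<Rightarrow> real"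
  shows "C_k k f \<Longrightarrow> C_k k g \<Longrightarrow> C_k k (\<lambda>x. f x + g x)"
proof (induction k arbitrary: f g)
  case 0
  then show ?case by (auto intro: continuous_intros)
next
  case (Suc k)
  note d = C_k_SucE_real[OF Suc.prems(1)] C_k_SucE_real[OF Suc.prems(2)]
  show ?case
    by (rule C_k_SucI_real[where f' = "\<lambda>x. partial 1 f x + partial 1 g x"])
       (intro DERIV_add d Suc.IH)+
qed

lemma C_k_mult:
  fixes f g :: "real \<Rightarrow> real"
  shows "C_k k f \<Longrightarrow> C_k k g \<Longrightarrow> C_k k (\<lambda>x. f x * g x)"
proof (induction k arbitrary: f g)
  case 0
  then show ?case by (auto intro: continuous_intros)
next
  case (Suc k)
  note d = C_k_SucE_real[OF Suc.prems(1)] C_k_SucE_real[OF Suc.prems(2)]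
  show ?case
    by (rule C_k_SucI_real[where f' = "\<lambda>x. partial 1 f x * g x + partial 1 g x * f x"])
       (intro DERIV_mult d C_k_add Suc.IH C_k_SucD[OF Suc.prems(1)] C_k_SucD[OF Suc.prems(2)])+
qed

lemma C_k_affine:
  fixes f :: "real \<Rightarrow> real"
  shows "C_k k f \<Longrightarrow> C_k k (\<lambda>x. f (m * x + b))"
proof (induction k arbitrary: f)
  case 0
  then show ?case by (auto intro!: continuous_intros continuous_on_compose2[of UNIV f])
next
  case (Suc k)
  note d = C_k_SucE_real[OF Suc.prems(1)]
  have "((\<lambda>x. f (m * x + b)) has_real_derivative partial 1 f (m * x + b) * m) (at x)" for x
    by (rule DERIV_chain2[where f = f, OF d(1)]) (auto intro!: derivative_eq_intros)
  then show ?case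
    by (rule C_k_SucI_real) (intro C_k_mult C_k_const Suc.IH d)
qed

text \<open>\<open>x\<^sup>-\<^sup>n exp (- 1 / x)\<close> for positive \<open>x\<close>. Unlike the case \<open>n = 0\<close> alone, the whole family is
closed under differentiation, up to linear combinations.\<close>

definition flat_exp :: "nat \<Rightarrow> real \<Rightarrow> real" where
  "flat_exp n x = (if x > 0 then (1 / x) ^ n / exp (1 / x) else 0)"

lemma flat_exp_tendsto_0: "(flat_exp n \<longlongrightarrow> 0) (at 0)"
proof (rule filterlim_split_at)
  show "(flat_exp n \<longlongrightarrow> 0) (at_left 0)"
    by (rule tendsto_eventually) (auto simp: flat_exp_def eventually_at_filter)
  have "((\<lambda>x. (inverse x) ^ n / exp (inverse x)) \<longlongrightarrow> 0) (at_right (0::real))"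
    by (rule filterlim_compose[OF tendsto_power_div_exp_0 filterlim_inverse_at_top_right])
  then show "(flat_exp n \<longlongrightarrow> 0) (at_right 0)"
    by (rule Lim_transform_eventually) (auto simp: flat_exp_def eventually_at_filter inverse_eq_divide)
qed

lemma flat_exp_deriv:
  "(flat_exp n has_real_derivative - real n * flat_exp (Suc n) x + flat_exp (Suc (Suc n)) x) (at x)"
proof -
  consider "x > 0" | "x < 0" | "x = 0" by linarith
  then show ?thesis
  proof cases
    case 1
    have "((\<lambda>x. (1 / x) ^ n / exp (1 / x)) has_real_derivative
        - real n * flat_exp (Suc n) x + flat_exp (Suc (Suc n)) x) (at x)"
    proof -
      define w where "w = 1 / x"
      have outer: "((\<lambda>z. z ^ n / exp z) has_real_derivative (real n * w ^ (n - 1) - w ^ n) / exp w) (at w)"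
        by (auto intro!: derivative_eq_intros simp: power2_eq_square field_simps)
      have inner: "((\<lambda>x. 1 / x) has_real_derivative - (w\<^sup>2)) (at x)"
        using 1 by (auto intro!: derivative_eq_intros simp: w_def power2_eq_square)
      have "(real n * w ^ (n - 1) - w ^ n) / exp w * - (w\<^sup>2)
          = - real n * flat_exp (Suc n) x + flat_exp (Suc (Suc n)) x"
        using 1 by (cases n) (simp_all add: flat_exp_def flip: w_def, simp_all add: power2_eq_square field_simps)
      then show ?thesis using DERIV_chain2[OF outer[unfolded w_def] inner] by (simp add: w_def)
    qed
    then show ?thesis
      by (rule has_field_derivative_transform_within_open[where S = "{0<..}"])
         (use 1 in \<open>auto simp: flat_exp_def\<close>)
  next
    case 2
    have "((\<lambda>x. 0) has_real_derivative 0) (at x)" by simp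
    then have "(flat_exp n has_real_derivative 0) (at x)"
      by (rule has_field_derivative_transform_within_open[where S = "{..<0}"])
         (use 2 in \<open>auto simp: flat_exp_def\<close>)
    then show ?thesis using 2 by (simp add: flat_exp_def)
  next
    case 3
    have "((\<lambda>h. flat_exp n h / h) \<longlongrightarrow> 0) (at 0)"
      by (rule Lim_transform_eventually[OF flat_exp_tendsto_0[of "Suc n"]])
         (auto simp: flat_exp_def eventually_at_filter)
    then show ?thesis unfolding DERIV_def using 3 by (simp add: flat_exp_def)
  qed
qed

text \<open>Each derivative is a combination of two members of the family, so the induction has to run over
all \<open>n\<close> simultaneously.\<close>

lemma C_k_flat_exp: "C_k k (flat_exp n)"
proof (induction k arbitrary: n)
  case 0
  show ?case using DERIV_isCont[OF flat_exp_deriv] by (simp add: continuous_on_eq_continuous_at)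
next
  case (Suc k)
  show ?case
    by (rule C_k_SucI_real[OF flat_exp_deriv]) (intro C_k_add C_k_mult C_k_const Suc.IH)
qed

lemma antiderivative_exists:
  fixes f :: "real \<Rightarrow> real"
  assumes "continuous_on UNIV f"
  obtains F where "\<And>x. (F has_real_derivative f x) (at x)"
proof -
  have "\<exists>F. \<forall>x::real. -\<infinity> < ereal x \<longrightarrow> ereal x < \<infinity> \<longrightarrow> (F has_vector_derivative f x) (at x)"
    by (rule einterval_antiderivative) (use assms in \<open>auto simp: continuous_on_eq_continuous_at\<close>)
  then show ?thesis using that by (auto simp: has_real_derivative_iff_has_vector_derivative)
qed

text \<open>The step is the normalised antiderivative of a bump supported in the unit interval. Differences of
rescaled translates of \<open>S\<close> are test functions that approximate the indicator of an interval, while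
their derivatives approximate point masses at its two ends.\<close>

lemma smooth_step_exists:
  obtains S S' :: "real \<Rightarrow> real" where "\<And>k. C_k k S" "\<And>x. (S has_real_derivative S' x) (at x)"
    "continuous_on UNIV S'" "\<And>x. S' x \<ge> 0"
    "\<And>x. x \<le> 0 \<or> x \<ge> 1 \<Longrightarrow> S' x = 0" "\<And>x. x \<le> 0 \<Longrightarrow> S x = 0" "\<And>x. x \<ge> 1 \<Longrightarrow> S x = 1"
    "\<And>x. 0 \<le> S x \<and> S x \<le> 1"
proof -
  define h where "h x = flat_exp 0 x * flat_exp 0 ((-1) * x + 1)" for x
  have h_smooth: "C_k k h" for k
    unfolding h_def by (intro C_k_mult C_k_flat_exp C_k_affine)
  have h_cont: "continuous_on UNIV h" using h_smooth[of 0] by simp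
  have h_nonneg: "h x \<ge> 0" for x by (auto simp: h_def flat_exp_def)
  have h_out: "h x = 0" if "x \<le> 0 \<or> x \<ge> 1" for x using that by (auto simp: h_def flat_exp_def)
  obtain H where H: "\<And>x. (H has_real_derivative h x) (at x)"
    using antiderivative_exists[OF h_cont] by blast
  have mono: "H x \<le> H y" if "x \<le> y" for x y
    using DERIV_nonneg_imp_nondecreasing[OF that] H h_nonneg by blast
  have left: "H x = H 0" if "x \<le> 0" for x
  proof (cases "x = 0")
    case False
    then show ?thesis
      using DERIV_isconst_end[of x 0 H] H that h_out DERIV_isCont
      by (smt (verit, best) DERIV_continuous_on continuous_on_subset subset_UNIV)
  qed simp
  have right: "H x = H 1" if "x \<ge> 1" for x
  proof (cases "x = 1")
    case False
    then show ?thesis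
      using DERIV_isconst_end[of 1 x H] H that h_out DERIV_isCont
      by (smt (verit, best) DERIV_continuous_on continuous_on_subset subset_UNIV)
  qed simp
  have "\<exists>z::real. z > 0 \<and> z < 1 \<and> H 1 - H 0 = (1 - 0) * h z" by (rule MVT2) (auto intro: H)
  then obtain z where z: "z > 0" "z < 1" "H 1 - H 0 = h z" by auto
  then have pos: "H 1 - H 0 > 0" unfolding z(3) by (simp add: h_def flat_exp_def)
  define S where "S x = 1 / (H 1 - H 0) * H x + (- H 0 / (H 1 - H 0))" for x
  define S' where "S' x = 1 / (H 1 - H 0) * h x" for x
  have S: "(S has_real_derivative S' x) (at x)" for x
    unfolding S_def S'_def using pos by (auto intro!: derivative_eq_intros H)
  have Seq: "S x = (H x - H 0) / (H 1 - H 0)" for x by (simp add: S_def diff_divide_distrib)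
  show thesis
  proof
    show "C_k k S" for k
    proof (rule C_k_SucD, rule C_k_SucI_real[OF S])
      show "C_k k S'" unfolding S'_def by (intro C_k_mult C_k_const h_smooth)
    qed
    show "(S has_real_derivative S' x) (at x)" for x by (rule S)
    show "continuous_on UNIV S'" unfolding S'_def by (intro continuous_intros h_cont)
    show "S' x \<ge> 0" for x using pos h_nonneg by (simp add: S'_def)
    show "S' x = 0" if "x \<le> 0 \<or> x \<ge> 1" for x using h_out[OF that] by (simp add: S'_def)
    show "S x = 0" if "x \<le> 0" for x using left[OF that] by (simp add: Seq)
    show "S x = 1" if "x \<ge> 1" for x using right[OF that] pos by (simp add: Seq del: diff_gt_0_iff_gt)
    show "0 \<le> S x \<and> S x \<le> 1" for x
      using pos mono[of 0 x] mono[of x 1] left[of x] right[of x]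
      by (cases "x \<le> 0"; cases "x \<ge> 1") (auto simp: Seq)
  qed
qed

section \<open>Locally integrable functions\<close>

lemma continuous_bounded_image:
  fixes u :: "'a::euclidean_space \<Rightarrow> real"
  assumes "continuous_on UNIV u" "compact K" shows "bounded (u ` K)"
  using assms by (meson compact_continuous_image compact_imp_bounded continuous_on_subset subset_UNIV)

lemma integrable_bounded_compact_support:
  fixes v :: "'a::euclidean_space \<Rightarrow> real"
  assumes "v \<in> borel_measurable borel" "compact K" "\<And>z. z \<in> K \<Longrightarrow> \<bar>v z\<bar> \<le> B" "\<And>z. z \<notin> K \<Longrightarrow> v z = 0"
  shows "integrable lborel v"
proof (rule integrableI_bounded_set[where A = K and B = B])
  show "K \<in> sets lborel" using assms(2) by (simp add: borel_compact)
  show "emeasure lborel K < \<infinity>" using emeasure_bounded_finite[OF compact_imp_bounded[OF assms(2)]] by simp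
qed (use assms in auto)

lemma integrable_continuous_compact_support:
  fixes v :: "'a::euclidean_space \<Rightarrow> real"
  assumes "continuous_on UNIV v" "compact K" "\<And>z. z \<notin> K \<Longrightarrow> v z = 0"
  shows "integrable lborel v"
proof -
  have "bounded (v ` K)"
    using assms by (meson compact_continuous_image compact_imp_bounded continuous_on_subset subset_UNIV)
  then obtain B where "\<And>z. z \<in> K \<Longrightarrow> \<bar>v z\<bar> \<le> B" by (force simp: bounded_iff)
  then show ?thesis
    using integrable_bounded_compact_support[OF borel_measurable_continuous_onI[OF assms(1)] assms(2)] assms(3) by blast
qed

lemma L2_locI:
  fixes v :: "'a::euclidean_space \<Rightarrow> real"
  assumes [measurable]: "v \<in> borel_measurable borel" and bdd: "\<And>K. compact K \<Longrightarrow> bounded (v ` K)"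
  shows "L2_loc v"
  unfolding L2_loc_def set_integrable_def
proof (intro conjI allI impI assms(1))
  fix K :: "'a set" assume K: "compact K"
  obtain B where B: "\<And>z. z \<in> K \<Longrightarrow> \<bar>v z\<bar> \<le> B" using bdd[OF K] by (force simp: bounded_iff)
  note [measurable] = borel_compact[OF K]
  show "integrable lborel (\<lambda>x. indicat_real K x *\<^sub>R (v x)\<^sup>2)"
  proof (rule integrable_bounded_compact_support[where K = K and B = "B\<^sup>2"])
    show "\<bar>indicat_real K z *\<^sub>R (v z)\<^sup>2\<bar> \<le> B\<^sup>2" if "z \<in> K" for z
      using B[OF that] that by (simp add: abs_le_square_iff[symmetric])
  qed (use K in auto)
qed

text \<open>A compact set has finite measure, and \<open>\<bar>v\<bar> \<le> 1 + v\<^sup>2\<close>.\<close>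

lemma L2_loc_set_integrable:
  assumes "L2_loc v" "compact K" shows "set_integrable lborel K v"
proof -
  have [measurable]: "v \<in> borel_measurable borel" using assms by (simp add: L2_loc_def)
  note [measurable] = borel_compact[OF assms(2)]
  have "integrable lborel (\<lambda>x. indicat_real K x * 1)"
    by (rule integrable_bounded_compact_support[where K = K and B = 1]) (use assms in auto)
  moreover have "integrable lborel (\<lambda>x. indicat_real K x * (v x)\<^sup>2)"
    using assms by (auto simp: L2_loc_def set_integrable_def)
  ultimately have "integrable lborel (\<lambda>x. indicat_real K x * 1 + indicat_real K x * (v x)\<^sup>2)"
    by (rule Bochner_Integration.integrable_add)
  then show ?thesis unfolding set_integrable_def
  proof (rule Bochner_Integration.integrable_bound)
    have "\<bar>v x\<bar> \<le> 1 + (v x)\<^sup>2" for x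
      using zero_le_power2[of "\<bar>v x\<bar> - 1"] by (simp add: power2_diff)
    then show "AE x in lborel. norm (indicat_real K x *\<^sub>R v x)
        \<le> norm (indicat_real K x * 1 + indicat_real K x * (v x)\<^sup>2)"
      by (auto simp: indicator_def)
  qed measurable
qed

section \<open>Weak derivatives of one variable\<close>

text \<open>The exceptional set \<open>E\<close> accommodates functions with a kink, such as restrictions to a line that
crosses the axis \<open>x = 0\<close>.\<close>

lemma integral_of_derivative:
  fixes W W' :: "real \<Rightarrow> real"
  assumes "l \<le> r" "continuous_on {l..r} W" "finite E"
    and "\<And>t. t \<in> {l<..<r} - E \<Longrightarrow> (W has_real_derivative W' t) (at t)"
    and "\<And>t. t \<notin> {l..r} \<Longrightarrow> W' t = 0" and "integrable lborel W'"
  shows "(\<integral>t. W' t \<partial>lborel) = W r - W l"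
proof -
  have "(W' has_integral W r - W l) {l..r}"
    by (rule fundamental_theorem_of_calculus_interior_strong[OF assms(3,1)])
       (use assms in \<open>auto simp: has_real_derivative_iff_has_vector_derivative\<close>)
  then have "((\<lambda>t. if t \<in> {l..r} then W' t else 0) has_integral W r - W l) UNIV"
    by (simp only: has_integral_restrict_UNIV)
  also have "(\<lambda>t. if t \<in> {l..r} then W' t else 0) = W'" using assms(5) by auto
  finally show ?thesis using has_integral_integral_lborel[OF assms(6)] has_integral_unique by blast
qed

lemma weak_partial_of_derivative:
  fixes f f' :: "real \<Rightarrow> real"
  assumes d: "\<And>x. (f has_real_derivative f' x) (at x)" and c: "continuous_on UNIV f'"
  shows "weak_partial 1 f f'"
  unfolding weak_partial_def
proof (intro allI impI)
  fix \<phi> :: "real \<Rightarrow> real" assume t: "test_function UNIV \<phi>"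
  have S: "C_k (Suc k) \<phi>" for k using t by (auto simp: test_function_def)
  note dphi = C_k_SucE_real(1)[OF S]
  have cont': "continuous_on UNIV (partial 1 \<phi>)" using C_k_SucE_real(2)[OF S[of 0]] by simp
  have cont: "continuous_on UNIV \<phi>" using C_k_SucD[OF S[of 0]] by simp
  have cf: "continuous_on UNIV f" using d DERIV_continuous_on by blast
  have "bounded {z. \<phi> z \<noteq> 0}"
    using t closure_subset by (metis bounded_subset compact_imp_bounded test_function_def)
  then obtain N where N: "N > 0" "\<And>z. \<phi> z \<noteq> 0 \<Longrightarrow> \<bar>z\<bar> \<le> N"
    by (auto simp: bounded_pos)
  have z: "\<phi> x = 0" if "x \<notin> {- N..N}" for x using N(2)[of x] that by force
  have z': "partial 1 \<phi> x = 0" if "x \<notin> {- N..N}" for x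
  proof -
    have "((\<lambda>x. 0) has_real_derivative 0) (at x)" by simp
    then have "(\<phi> has_real_derivative 0) (at x)"
      by (rule has_field_derivative_transform_within_open[where S = "- {- N..N}"])
         (use that z in \<open>auto intro: open_Compl\<close>)
    then show ?thesis by (rule partial_real_eq)
  qed
  have i1: "integrable lborel (\<lambda>x. f x * partial 1 \<phi> x)"
    by (rule integrable_continuous_compact_support[where K = "{- N..N}"])
       (use z' in \<open>auto intro!: continuous_intros cf cont'\<close>)
  have i2: "integrable lborel (\<lambda>x. f' x * \<phi> x)"
    by (rule integrable_continuous_compact_support[where K = "{- N..N}"])
       (use z in \<open>auto intro!: continuous_intros c cont\<close>)
  have out: "f x * partial 1 \<phi> x + f' x * \<phi> x = 0" if "x \<notin> {- N - 1..N + 1}" for x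
  proof -
    have "x \<notin> {- N..N}" using that by auto
    then show ?thesis using z z' by simp
  qed
  have "(\<integral>x. (f x * partial 1 \<phi> x + f' x * \<phi> x) \<partial>lborel)
      = f (N + 1) * \<phi> (N + 1) - f (- N - 1) * \<phi> (- N - 1)"
    by (rule integral_of_derivative[where E = "{}" and W = "\<lambda>x. f x * \<phi> x"])
       (use out i1 i2 N(1) in \<open>auto intro!: derivative_eq_intros d dphi continuous_intros
          continuous_on_subset[OF cf] continuous_on_subset[OF cont]\<close>)
  also have "\<dots> = 0" using z[of "N + 1"] z[of "- N - 1"] N(1) by simp
  finally show "(\<integral>z. f z * partial 1 \<phi> z \<partial>lborel) = - (\<integral>z. f' z * \<phi> z \<partial>lborel)"
    using i1 i2 by simp
qed

text \<open>Test the weak derivative with \<open>S (m (x - \<alpha>)) - S (m (x - \<beta>))\<close>, where \<open>S\<close> is a smooth step, and let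
\<open>m\<close> tend to infinity. The test functions converge boundedly to the indicator of \<open>{\<alpha><..\<beta>}\<close>, so the
side with \<open>v\<close> tends to an integral over the interval. Their derivatives concentrate at \<open>\<alpha>\<close> and
\<open>\<beta>\<close>, so by continuity the side with \<open>f\<close> tends to \<open>f \<alpha> - f \<beta>\<close>.\<close>

lemma weak_partial_imp_ftc:
  fixes f v :: "real \<Rightarrow> real"
  assumes cf: "continuous_on UNIV f" and v: "L2_loc v" and w: "weak_partial 1 f v" and le: "\<alpha> \<le> \<beta>"
  shows "(v has_integral f \<beta> - f \<alpha>) {\<alpha>..\<beta>}"
proof -
  obtain S S' where S: "\<And>k. C_k k S" "\<And>x. (S has_real_derivative S' x) (at x)"
    "continuous_on UNIV S'" "\<And>x::real. S' x \<ge> (0::real)"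
    "\<And>x. x \<le> 0 \<or> x \<ge> 1 \<Longrightarrow> S' x = 0" "\<And>x. x \<le> 0 \<Longrightarrow> S x = 0" "\<And>x. x \<ge> 1 \<Longrightarrow> S x = 1"
    "\<And>x. 0 \<le> S x \<and> S x \<le> 1"
    using smooth_step_exists by blast
  have [measurable]: "v \<in> borel_measurable borel" using v by (simp add: L2_loc_def)
  have [measurable]: "f \<in> borel_measurable borel" "S' \<in> borel_measurable borel" "S \<in> borel_measurable borel"
    using cf S(3) S(1)[of 0] by (auto intro: borel_measurable_continuous_onI)
  have iS': "integrable lborel S'"
    by (rule integrable_continuous_compact_support[where K = "{0..1}"]) (use S(3,5) in auto)
  have "S' x = 0" if "x \<notin> {0..1}" for x using that S(5) by auto
  \<comment> \<open>The derivative of the step has total mass \<open>1\<close>, all of it in the unit interval.\<close>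
  then have massS': "(\<integral>x. S' x \<partial>lborel) = 1"
    using integral_of_derivative[of 0 1 S "{}" S'] S(2,6,7) iS'
      continuous_on_subset[OF DERIV_continuous_on[OF S(2)]] by simp
  define m where "m n = real (Suc n)" for n
  have m1: "m n \<ge> 1" for n by (simp add: m_def)
  have mlim: "filterlim m at_top sequentially"
    unfolding m_def by (rule filterlim_compose[OF filterlim_real_sequentially filterlim_Suc])
  have sc: "continuous_on UNIV (\<lambda>x. S' (m n * (x - c)))" for n c
    by (intro continuous_on_compose2[OF S(3)] continuous_intros) auto
  have int_conc: "integrable lborel (\<lambda>x. f x * (m n * S' (m n * (x - c))))" for n c
  proof (rule integrable_continuous_compact_support[where K = "{c..c+1}"])
    show "f z * (m n * S' (m n * (z - c))) = 0" if "z \<notin> {c..c+1}" for z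
    proof -
      have "m n * (z - c) \<le> 0 \<or> m n * (z - c) \<ge> 1"
        using that m1[of n] mult_mono[of 1 "m n" 1 "z - c"] by (cases "z < c") (auto simp: mult_le_0_iff)
      then show ?thesis using S(5) by simp
    qed
  qed (auto intro!: continuous_intros cf sc)
  have conc: "(\<lambda>n. \<integral>x. f x * (m n * S' (m n * (x - c))) \<partial>lborel) \<longlonglongrightarrow> f c" for c
  proof -
    have "bounded (f ` {c..c+1})"
      by (rule continuous_bounded_image[OF cf compact_Icc])
    then obtain B where B: "\<And>x. x \<in> {c..c+1} \<Longrightarrow> \<bar>f x\<bar> \<le> B" by (force simp: bounded_iff)
    \<comment> \<open>Substituting \<open>x = c + y / m\<close> makes the kernel independent of \<open>n\<close>.\<close>
    have "(\<integral>x. f x * (m n * S' (m n * (x - c))) \<partial>lborel) = (\<integral>y. f (c + 1 / m n * y) * S' y \<partial>lborel)" for n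
    proof -
      have "m n > 0" using m1[of n] by linarith
      then show ?thesis
        by (subst lborel_integral_real_affine[where c = "1 / m n" and t = c])
           (auto simp: mult.left_commute[of _ "m n"])
    qed
    moreover have "(\<lambda>n. \<integral>y. f (c + 1 / m n * y) * S' y \<partial>lborel) \<longlonglongrightarrow> (\<integral>y. f c * S' y \<partial>lborel)"
    proof (rule integral_dominated_convergence[where w = "\<lambda>y. B * S' y"])
      show "AE y in lborel. (\<lambda>n. f (c + 1 / m n * y) * S' y) \<longlonglongrightarrow> f c * S' y"
      proof (intro AE_I2 tendsto_mult tendsto_const)
        fix y
        have "(\<lambda>n. 1 / m n) \<longlonglongrightarrow> 0" unfolding m_def by (rule LIMSEQ_Suc[OF lim_1_over_n])
        then have "(\<lambda>n. c + 1 / m n * y) \<longlonglongrightarrow> c + 0 * y" by (intro tendsto_intros)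
        then show "(\<lambda>n. f (c + 1 / m n * y)) \<longlonglongrightarrow> f c"
          using cf isCont_tendsto_compose[of c f] by (auto simp: continuous_on_eq_continuous_at)
      qed
      show "AE y in lborel. norm (f (c + 1 / m n * y) * S' y) \<le> B * S' y" for n
      proof (intro AE_I2)
        fix y
        show "norm (f (c + 1 / m n * y) * S' y) \<le> B * S' y"
        proof (cases "y \<le> 0 \<or> y \<ge> 1")
          case True
          then show ?thesis using S(5) by simp
        next
          case False
          then have y: "0 \<le> y" "y \<le> 1" by auto
          have m: "0 \<le> 1 / m n" "1 / m n \<le> 1" using m1[of n] by (auto simp: divide_le_eq_1)
          have "1 / m n * y \<le> 1 * 1" "1 / m n * y \<ge> 0"
            using mult_mono[OF m(2) y(2)] mult_nonneg_nonneg[OF m(1) y(1)] y by auto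
          then show ?thesis using S(4)[of y] B[of "c + 1 / m n * y"]
            by (auto simp: abs_mult intro!: mult_right_mono)
        qed
      qed
    qed (use iS' in auto)
    ultimately show ?thesis using massS' by simp
  qed
  define \<phi> where "\<phi> n x = S (m n * x + - m n * \<alpha>) + (- 1) * S (m n * x + - m n * \<beta>)" for n x
  have dS: "((\<lambda>x. S (m n * x + - m n * c)) has_real_derivative S' (m n * x + - m n * c) * m n) (at x)" for n c x
    by (rule DERIV_chain2[OF S(2)]) (auto intro!: derivative_eq_intros)
  have d\<phi>: "partial 1 (\<phi> n) x = m n * S' (m n * (x - \<alpha>)) - m n * S' (m n * (x - \<beta>))" for n x
    unfolding \<phi>_def
    by (rule partial_real_eq, rule DERIV_cong, rule DERIV_add[OF dS DERIV_cmult[OF dS]])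
       (simp add: algebra_simps)
  have Sval: "S (m n * x + - m n * c) = (if x > c then 1 else 0)" if far: "x \<le> c \<or> x \<ge> c + 1 / m n" for n x c
  proof -
    have p: "m n > 0" using m1[of n] by linarith
    consider "x \<le> c" | "x \<ge> c + 1 / m n" using far by blast
    then show ?thesis
    proof cases
      case 1
      then have "m n * (x - c) \<le> 0" using p by (simp add: mult_le_0_iff)
      then show ?thesis using S(6)[of "m n * (x - c)"] 1 by (simp add: algebra_simps)
    next
      case 2
      then have "x > c" using p by (smt (verit) divide_pos_pos)
      have "1 \<le> m n * (x - c)" using 2 p by (simp add: field_simps)
      then show ?thesis using S(7)[of "m n * (x - c)"] \<open>x > c\<close> by (simp add: algebra_simps)
    qed
  qed
  have m1': "1 / m n \<le> 1" for n using m1[of n] by simp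
  have \<phi>0: "\<phi> n x = 0" if "x \<notin> {\<alpha>..\<beta>+1}" for n x
    using that Sval[of x \<alpha> n] Sval[of x \<beta> n] le m1'[of n] unfolding \<phi>_def by auto
  have \<phi>b: "\<bar>\<phi> n x\<bar> \<le> 1" for n x
    using S(8)[of "m n * x + - m n * \<alpha>"] S(8)[of "m n * x + - m n * \<beta>"] unfolding \<phi>_def by (auto simp: abs_le_iff)
  have test: "test_function UNIV (\<phi> n)" for n
  proof -
    have "{x. \<phi> n x \<noteq> 0} \<subseteq> {\<alpha>..\<beta>+1}" using \<phi>0 by blast
    then have "closure {x. \<phi> n x \<noteq> 0} \<subseteq> {\<alpha>..\<beta>+1}" by (simp add: closure_minimal)
    then have "compact (closure {x. \<phi> n x \<noteq> 0})"
      by (meson bounded_closed_interval bounded_subset closed_closure compact_eq_bounded_closed)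
    moreover have "C_k k (\<phi> n)" for k
      unfolding \<phi>_def by (intro C_k_add C_k_mult C_k_const C_k_affine S)
    ultimately show ?thesis by (simp add: test_function_def)
  qed
  have "(\<lambda>n. \<integral>x. f x * partial 1 (\<phi> n) x \<partial>lborel) \<longlonglongrightarrow> f \<alpha> - f \<beta>"
    using tendsto_diff[OF conc[of \<alpha>] conc[of \<beta>]] int_conc
    by (simp add: d\<phi> right_diff_distrib)
  then have lim1: "(\<lambda>n. \<integral>x. v x * \<phi> n x \<partial>lborel) \<longlonglongrightarrow> f \<beta> - f \<alpha>"
  proof -
    assume *: "(\<lambda>n. \<integral>x. f x * partial 1 (\<phi> n) x \<partial>lborel) \<longlonglongrightarrow> f \<alpha> - f \<beta>"
    have "(\<integral>x. v x * \<phi> n x \<partial>lborel) = - (\<integral>x. f x * partial 1 (\<phi> n) x \<partial>lborel)" for n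
      using w test[of n] unfolding weak_partial_def by simp
    then show ?thesis using tendsto_minus[OF *] by simp
  qed
  have iv: "integrable lborel (\<lambda>x. indicat_real {\<alpha>..\<beta>+1} x * v x)"
    using L2_loc_set_integrable[OF v, of "{\<alpha>..\<beta>+1}"] by (simp add: set_integrable_def)
  have lim2: "(\<lambda>n. \<integral>x. v x * \<phi> n x \<partial>lborel) \<longlonglongrightarrow> (\<integral>x. v x * indicat_real {\<alpha><..\<beta>} x \<partial>lborel)"
  proof (rule integral_dominated_convergence[where w = "\<lambda>x. \<bar>indicat_real {\<alpha>..\<beta>+1} x * v x\<bar>"])
    show "(\<lambda>x. v x * \<phi> n x) \<in> borel_measurable lborel" for n unfolding \<phi>_def by measurable
    show "AE x in lborel. (\<lambda>n. v x * \<phi> n x) \<longlonglongrightarrow> v x * indicat_real {\<alpha><..\<beta>} x"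
    proof (intro AE_I2 tendsto_mult tendsto_const tendsto_eventually)
      fix x
      have ev: "eventually (\<lambda>n. x \<le> c \<or> x \<ge> c + 1 / m n) sequentially" for c
      proof (cases "x \<le> c")
        case False
        have "eventually (\<lambda>n. m n \<ge> 1 / (x - c)) sequentially" using mlim by (simp add: filterlim_at_top)
        then show ?thesis
        proof eventually_elim
          case (elim n)
          then show ?case using False m1[of n] by (auto simp: field_simps)
        qed
      qed auto
      show "eventually (\<lambda>n. \<phi> n x = indicat_real {\<alpha><..\<beta>} x) sequentially"
        using ev[of \<alpha>] ev[of \<beta>]
      proof eventually_elim
        case (elim n)
        show ?case using Sval[OF elim(1)] Sval[OF elim(2)] le
          unfolding \<phi>_def by (auto simp: indicator_def)
      qed
    qed
    show "AE x in lborel. norm (v x * \<phi> n x) \<le> \<bar>indicat_real {\<alpha>..\<beta>+1} x * v x\<bar>" for n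
    proof (intro AE_I2)
      fix x
      show "norm (v x * \<phi> n x) \<le> \<bar>indicat_real {\<alpha>..\<beta>+1} x * v x\<bar>"
        using \<phi>0[of x n] \<phi>b[of n x] by (cases "x \<in> {\<alpha>..\<beta>+1}") (auto simp: abs_mult mult_left_le)
    qed
  qed (use iv in auto)
  have eq: "(\<integral>x. v x * indicat_real {\<alpha><..\<beta>} x \<partial>lborel) = f \<beta> - f \<alpha>"
    using LIMSEQ_unique[OF lim2 lim1] .
  have "integrable lborel (\<lambda>x. v x * indicat_real {\<alpha><..\<beta>} x)"
    by (rule Bochner_Integration.integrable_bound[OF iv]) (auto simp: indicator_def)
  then have "((\<lambda>x. v x * indicat_real {\<alpha><..\<beta>} x) has_integral f \<beta> - f \<alpha>) UNIV"
    using has_integral_integral_lborel eq by metis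
  moreover have "(\<lambda>x. v x * indicat_real {\<alpha><..\<beta>} x) = (\<lambda>x. if x \<in> {\<alpha><..\<beta>} then v x else 0)"
    by (auto simp: indicator_def)
  ultimately have "(v has_integral f \<beta> - f \<alpha>) {\<alpha><..\<beta>}" by (simp only: has_integral_restrict_UNIV)
  then show ?thesis
    by (rule has_integral_spike_set_eq[THEN iffD1, rotated 2])
       (auto intro: negligible_subset[of "{\<alpha>}"])
qed

lemma AE_lborel_imp_negligible:
  assumes "AE x in lborel. P x" shows "negligible {x. \<not> P x}"
  using AE_completion[OF assms] negligible_subset unfolding eventually_ae_filter_negligible by blast

lemma has_integral_AE_cong:
  fixes f g :: "'a::euclidean_space \<Rightarrow> real"
  assumes "(f has_integral i) S" "AE x in lborel. f x = g x"
  shows "(g has_integral i) S"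
  by (rule has_integral_spike[OF AE_lborel_imp_negligible[OF assms(2)] _ assms(1)]) auto

lemma weak_partial_imp_ftc_scaled:
  fixes f v :: "real \<Rightarrow> real"
  assumes "continuous_on UNIV f" "L2_loc v" "weak_partial 1 f v" and m: "m \<noteq> 0" and le: "\<alpha> \<le> \<beta>"
  shows "((\<lambda>\<tau>. v (m * \<tau>)) has_integral (f (m * \<beta>) - f (m * \<alpha>)) / m) {\<alpha>..\<beta>}"
proof (cases "m > 0")
  case True
  have img: "(\<lambda>x. x / m) ` {m * \<alpha>..m * \<beta>} = {\<alpha>..\<beta>}"
  proof (intro equalityI subsetI)
    fix x assume "x \<in> {\<alpha>..\<beta>}"
    then show "x \<in> (\<lambda>x. x / m) ` {m * \<alpha>..m * \<beta>}"
      using True by (intro image_eqI[where x = "m * x"]) auto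
  qed (use True in \<open>auto simp: field_simps\<close>)
  have "(v has_integral f (m * \<beta>) - f (m * \<alpha>)) {m * \<alpha>..m * \<beta>}"
    using True le by (intro weak_partial_imp_ftc[OF assms(1-3)]) auto
  from has_integral_stretch_real[OF this m] show ?thesis using True by (simp add: img)
next
  case False
  then have neg: "m < 0" using m by simp
  have img: "(\<lambda>x. x / m) ` {m * \<beta>..m * \<alpha>} = {\<alpha>..\<beta>}"
  proof (intro equalityI subsetI)
    fix x assume "x \<in> {\<alpha>..\<beta>}"
    then show "x \<in> (\<lambda>x. x / m) ` {m * \<beta>..m * \<alpha>}"
      using neg by (intro image_eqI[where x = "m * x"]) auto
  qed (use neg in \<open>auto simp: field_simps\<close>)
  have "(v has_integral f (m * \<alpha>) - f (m * \<beta>)) {m * \<beta>..m * \<alpha>}"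
    using neg le by (intro weak_partial_imp_ftc[OF assms(1-3)]) auto
  from has_integral_stretch_real[OF this m] have "((\<lambda>x. v (m * x)) has_integral
      (1 / \<bar>m\<bar>) *\<^sub>R (f (m * \<alpha>) - f (m * \<beta>))) {\<alpha>..\<beta>}" unfolding img .
  moreover have "(1 / \<bar>m\<bar>) *\<^sub>R (f (m * \<alpha>) - f (m * \<beta>)) = (f (m * \<beta>) - f (m * \<alpha>)) / m"
    using neg by (simp add: field_simps)
  ultimately show ?thesis by simp
qed

text \<open>The positive and the negative part of \<open>h\<close>, cut off to the interval, are densities of two finite
measures. They agree on all half-lines, hence coincide, and so do their densities.\<close>

lemma AE_zero_if_interval_integrals_zero:
  fixes h :: "real \<Rightarrow> real"
  assumes int: "set_integrable lborel {l..r} h"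
    and zero: "\<And>\<alpha> \<beta>. l \<le> \<alpha> \<Longrightarrow> \<alpha> \<le> \<beta> \<Longrightarrow> \<beta> \<le> r \<Longrightarrow> (h has_integral 0) {\<alpha>..\<beta>}"
  shows "AE x in lborel. x \<in> {l..r} \<longrightarrow> h x = 0"
proof -
  define k where "k x = indicat_real {l..r} x * h x" for x
  have ik: "integrable lborel k" using int by (simp add: set_integrable_def k_def[abs_def])
  then have [measurable]: "k \<in> borel_measurable borel" by auto
  have tail: "(\<integral>x. k x * indicat_real {b<..} x \<partial>lborel) = 0" for b
  proof -
    have ikb: "integrable lborel (\<lambda>x. k x * indicat_real {b<..} x)"
      by (rule Bochner_Integration.integrable_bound[OF ik]) (auto simp: indicator_def)
    have "((\<lambda>x. if x \<in> {max l b..r} then h x else 0) has_integral 0) UNIV"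
      unfolding has_integral_restrict_UNIV
      by (cases "max l b \<le> r") (use zero[of "max l b" r] in auto)
    then have "((\<lambda>x. k x * indicat_real {b<..} x) has_integral 0) UNIV"
      by (rule has_integral_spike[rotated 2, where S = "{b}"]) (auto simp: k_def indicator_def)
    then show ?thesis using has_integral_integral_lborel[OF ikb] has_integral_unique by blast
  qed
  \<comment> \<open>\<open>P 1\<close> is the positive and \<open>P (- 1)\<close> the negative part of \<open>k\<close>.\<close>
  define P where "P s x = max 0 (s * k x)" for s x
  have iP: "integrable lborel (P s)" for s
    unfolding P_def by (intro Bochner_Integration.integrable_max Bochner_Integration.integrable_mult_right ik) auto
  have iPb: "integrable lborel (\<lambda>x. P s x * indicat_real {b<..} x)" for s b
    by (rule Bochner_Integration.integrable_bound[OF iP[of s]]) (auto simp: indicator_def P_def)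
  have em: "emeasure (density lborel (\<lambda>x. ennreal (P s x))) {b<..}
      = ennreal (\<integral>x. P s x * indicat_real {b<..} x \<partial>lborel)" for s b
  proof -
    have "emeasure (density lborel (\<lambda>x. ennreal (P s x))) {b<..}
      = (\<integral>\<^sup>+x. ennreal (P s x) * indicator {b<..} x \<partial>lborel)"
      by (subst emeasure_density) (auto simp: P_def[abs_def])
    also have "\<dots> = (\<integral>\<^sup>+x. ennreal (P s x * indicat_real {b<..} x) \<partial>lborel)"
      by (intro nn_integral_cong) (auto simp: indicator_def)
    also have "\<dots> = ennreal (\<integral>x. P s x * indicat_real {b<..} x \<partial>lborel)"
      by (rule nn_integral_eq_integral[OF iPb]) (auto simp: P_def)
    finally show ?thesis .
  qed
  have diff: "P 1 x - P (- 1) x = k x" for x by (auto simp: P_def max_def)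
  have pdiff: "(\<integral>x. P 1 x * indicat_real {b<..} x \<partial>lborel) - (\<integral>x. P (- 1) x * indicat_real {b<..} x \<partial>lborel)
      = (\<integral>x. k x * indicat_real {b<..} x \<partial>lborel)" for b
    using iPb by (simp flip: Bochner_Integration.integral_diff add: left_diff_distrib[symmetric] diff)
  have eq: "(\<integral>x. P 1 x * indicat_real {b<..} x \<partial>lborel) = (\<integral>x. P (- 1) x * indicat_real {b<..} x \<partial>lborel)" for b
    using tail[of b] pdiff[of b] by simp
  have "density lborel (\<lambda>x. ennreal (P 1 x)) = density lborel (\<lambda>x. ennreal (P (- 1) x))"
    by (rule measure_eqI_lessThan) (auto simp: em eq)
  then have "AE x in lborel. ennreal (P 1 x) = ennreal (P (- 1) x)"
    by (subst (asm) sigma_finite_measure.density_unique_iff[OF sigma_finite_lborel]) (auto simp: P_def[abs_def])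
  then show ?thesis
  proof eventually_elim
    case (elim x)
    then have "P 1 x = P (- 1) x" by (subst (asm) ennreal_inj) (auto simp: P_def)
    then show ?case using diff[of x] by (auto simp: k_def)
  qed
qed

text \<open>Uniqueness of weak derivatives on an interval, in the form used to compare two waves: both sides have
the same integrals over all subintervals.\<close>

lemma weak_derivative_AE_eq:
  fixes f1 f2 v1 v2 e :: "real \<Rightarrow> real"
  assumes 1: "continuous_on UNIV f1" "L2_loc v1" "weak_partial 1 f1 v1"
    and 2: "continuous_on UNIV f2" "L2_loc v2" "weak_partial 1 f2 v2"
    and e: "continuous_on UNIV e"
    and int: "\<And>\<alpha> \<beta>. l \<le> \<alpha> \<Longrightarrow> \<alpha> \<le> \<beta> \<Longrightarrow> \<beta> \<le> r \<Longrightarrow>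
      (e has_integral (f1 \<beta> - f2 \<beta>) - (f1 \<alpha> - f2 \<alpha>)) {\<alpha>..\<beta>}"
  shows "AE x in lborel. x \<in> {l..r} \<longrightarrow> v1 x - v2 x = e x"
proof -
  have "AE x in lborel. x \<in> {l..r} \<longrightarrow> v1 x - v2 x - e x = 0"
  proof (rule AE_zero_if_interval_integrals_zero)
    have "L2_loc e" by (rule L2_locI) (use e in \<open>auto intro: borel_measurable_continuous_onI continuous_bounded_image\<close>)
    then show "set_integrable lborel {l..r} (\<lambda>x. v1 x - v2 x - e x)"
      by (intro set_integral_diff L2_loc_set_integrable 1 2 compact_Icc)
    show "((\<lambda>x. v1 x - v2 x - e x) has_integral 0) {\<alpha>..\<beta>}" if "l \<le> \<alpha>" "\<alpha> \<le> \<beta>" "\<beta> \<le> r" for \<alpha> \<beta>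
      using has_integral_diff[OF has_integral_diff[OF weak_partial_imp_ftc[OF 1 that(2)]
            weak_partial_imp_ftc[OF 2 that(2)]] int[OF that]] by simp
  qed
  then show ?thesis by eventually_elim simp
qed

section \<open>Test functions and weak derivatives in the plane\<close>

lemma C_k_partial_continuous:
  assumes "C_k (Suc k) \<phi>" "b \<in> Basis" shows "continuous_on UNIV (partial b \<phi>)"
proof -
  have "C_k k (partial b \<phi>) \<Longrightarrow> continuous_on UNIV (partial b \<phi>)"
    by (cases k) (auto intro: differentiable_imp_continuous_on)
  then show ?thesis using assms by simp
qed

lemma partial_eq_0_off_support:
  assumes "z \<notin> closure {z. \<phi> z \<noteq> 0}" shows "partial b \<phi> z = 0"
proof -
  let ?U = "- closure {z. \<phi> z \<noteq> 0}"
  have zero: "0 = \<phi> w" if "w \<in> ?U" for w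
  proof -
    have "w \<notin> {z. \<phi> z \<noteq> 0}" using that closure_subset[of "{z. \<phi> z \<noteq> 0}"] by blast
    then show ?thesis by simp
  qed
  have "((\<lambda>_. 0) has_derivative (\<lambda>_. 0)) (at z)" by (rule has_derivative_const)
  then have "(\<phi> has_derivative (\<lambda>_. 0)) (at z)"
  proof (rule has_derivative_transform_within_open[where s = ?U])
    show "open ?U" by (intro open_Compl closed_closure)
    show "z \<in> ?U" using assms by simp
  qed (rule zero)
  then have "frechet_derivative \<phi> (at z) = (\<lambda>_. 0)" by (rule frechet_derivative_at[symmetric])
  then show ?thesis by (simp add: partial_def)
qed

lemma test_function_partial:
  assumes "test_function S \<phi>" "b \<in> Basis" shows "test_function S (partial b \<phi>)"
proof -
  let ?K = "closure {z. \<phi> z \<noteq> 0}"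
  have "{z. partial b \<phi> z \<noteq> 0} \<subseteq> ?K" using partial_eq_0_off_support by blast
  then have sub: "closure {z. partial b \<phi> z \<noteq> 0} \<subseteq> ?K" by (simp add: closure_minimal)
  have "C_k (Suc k) \<phi>" for k using assms by (auto simp: test_function_def)
  then have "C_k k (partial b \<phi>)" for k using assms(2) by simp
  moreover have "compact (closure {z. partial b \<phi> z \<noteq> 0})"
    using sub assms(1) unfolding test_function_def compact_eq_bounded_closed by (auto intro: bounded_subset)
  ultimately show ?thesis using sub assms unfolding test_function_def by blast
qed

lemma test_function_mono: "test_function S \<phi> \<Longrightarrow> S \<subseteq> T \<Longrightarrow> test_function T \<phi>"
  unfolding test_function_def by blast

lemma Basis_plane: "(1, 0) \<in> (Basis :: (real \<times> real) set)" "(0, 1) \<in> (Basis :: (real \<times> real) set)"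
  by (auto simp: Basis_prod_def)

lemma has_derivative_along_curve:
  fixes \<phi> :: "real \<times> real \<Rightarrow> real"
  assumes "\<phi> differentiable (at (p t, q t))"
    and p: "(p has_real_derivative p') (at t)" and q: "(q has_real_derivative q') (at t)"
  shows "((\<lambda>t. \<phi> (p t, q t)) has_real_derivative
    p' * partial (1, 0) \<phi> (p t, q t) + q' * partial (0, 1) \<phi> (p t, q t)) (at t)"
proof -
  let ?D = "frechet_derivative \<phi> (at (p t, q t))"
  have D: "(\<phi> has_derivative ?D) (at (p t, q t))"
    using assms(1) by (simp add: frechet_derivative_works)
  have lin: "linear ?D" using D by (simp add: has_derivative_linear)
  have "((\<lambda>t. (p t, q t)) has_derivative (\<lambda>h. (p' * h, q' * h))) (at t)"
    using p q by (auto simp: has_field_derivative_def intro: has_derivative_Pair)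
  from has_derivative_compose[OF this D]
  have "((\<lambda>t. \<phi> (p t, q t)) has_derivative (\<lambda>h. ?D (p' * h, q' * h))) (at t)" .
  moreover have "?D (p' * h, q' * h) = (p' * ?D (1, 0) + q' * ?D (0, 1)) * h" for h
  proof -
    have "(p' * h, q' * h) = (p' * h) *\<^sub>R (1, 0) + (q' * h) *\<^sub>R (0, 1)" by simp
    then show ?thesis by (simp only: linear_add[OF lin] linear_scale[OF lin]) (simp add: algebra_simps)
  qed
  ultimately show ?thesis by (simp add: has_field_derivative_def partial_def)
qed

lemma test_function_plane:
  fixes \<phi> :: "real \<times> real \<Rightarrow> real"
  assumes "test_function S \<phi>"
  obtains N where "N > 0" "\<And>x t. \<bar>x\<bar> > N \<or> \<bar>t\<bar> > N \<Longrightarrow> \<phi> (x, t) = 0"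
    "\<And>b x t. \<bar>x\<bar> > N \<or> \<bar>t\<bar> > N \<Longrightarrow> partial b \<phi> (x, t) = 0"
proof -
  let ?K = "closure {z. \<phi> z \<noteq> 0}"
  have "bounded ?K" using assms by (simp add: test_function_def compact_imp_bounded)
  then obtain N where N: "N > 0" "\<And>z. z \<in> ?K \<Longrightarrow> norm z \<le> N" by (auto simp: bounded_pos)
  have out: "(x, t) \<notin> ?K" if "\<bar>x\<bar> > N \<or> \<bar>t\<bar> > N" for x t
    using N(2)[of "(x, t)"] norm_fst_le[of x t] norm_snd_le[of t x] that by auto
  show thesis
  proof
    show "\<phi> (x, t) = 0" if "\<bar>x\<bar> > N \<or> \<bar>t\<bar> > N" for x t
      using out[OF that] closure_subset[of "{z. \<phi> z \<noteq> 0}"] by (metis (mono_tags, lifting) mem_Collect_eq subsetD)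
    show "partial b \<phi> (x, t) = 0" if "\<bar>x\<bar> > N \<or> \<bar>t\<bar> > N" for b x t
      using out[OF that] partial_eq_0_off_support by blast
  qed fact
qed

lemma test_function_continuous:
  assumes "test_function S \<phi>"
  shows "continuous_on UNIV \<phi>" "b \<in> Basis \<Longrightarrow> continuous_on UNIV (partial b \<phi>)" "\<phi> differentiable (at z)"
proof -
  have c: "C_k k \<phi>" for k using assms by (simp add: test_function_def)
  show "continuous_on UNIV \<phi>" using c[of 0] by simp
  show "b \<in> Basis \<Longrightarrow> continuous_on UNIV (partial b \<phi>)" using C_k_partial_continuous[OF c[of "Suc 0"]] .
  show "\<phi> differentiable (at z)" using c[of 1] by (auto simp: differentiable_on_def)
qed

lemma integrable_plane_box:
  fixes H :: "real \<times> real \<Rightarrow> real"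
  assumes "H \<in> borel_measurable borel" "\<And>z. \<bar>H z\<bar> \<le> B"
    and "\<And>x t. \<bar>x\<bar> > N \<or> \<bar>t\<bar> > N \<Longrightarrow> H (x, t) = 0"
  shows "integrable lborel H"
proof (rule integrable_bounded_compact_support[OF assms(1)])
  show "compact ({- N..N} \<times> {- N..N})" by (intro compact_Times compact_Icc)
  show "H z = 0" if "z \<notin> {- N..N} \<times> {- N..N}" for z
  proof -
    have "\<bar>fst z\<bar> > N \<or> \<bar>snd z\<bar> > N" using that by (cases z) auto
    then show ?thesis using assms(3)[of "fst z" "snd z"] by simp
  qed
qed (rule assms(2))

lemma integral_along_line_eq_0:
  fixes h W :: "real \<Rightarrow> real"
  assumes "h \<in> borel_measurable borel" "\<And>t. \<bar>h t\<bar> \<le> B" "\<And>t. \<bar>t\<bar> > N \<Longrightarrow> h t = 0"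
    and "finite E" "continuous_on UNIV W" "\<And>t. t \<notin> E \<Longrightarrow> (W has_real_derivative h t) (at t)"
    and "\<And>t. \<bar>t\<bar> > N \<Longrightarrow> W t = 0"
  shows "(\<integral>t. h t \<partial>lborel) = 0"
proof -
  have i: "integrable lborel h"
    by (rule integrable_bounded_compact_support[OF assms(1) _ assms(2), of "{- N..N}"]) (use assms(3) in auto)
  have "(\<integral>t. h t \<partial>lborel) = W (\<bar>N\<bar> + 1) - W (- \<bar>N\<bar> - 1)"
    by (rule integral_of_derivative[OF _ _ assms(4)])
       (use i assms(3,6) in \<open>auto intro: continuous_on_subset[OF assms(5)]\<close>)
  then show ?thesis using assms(7)[of "\<bar>N\<bar> + 1"] assms(7)[of "- \<bar>N\<bar> - 1"] by auto
qed

text \<open>By Fubini it suffices that every line integral vanishes, and along each line \<open>H\<close> is the derivative of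
a continuous function of bounded support.\<close>

lemma integral_plane_eq_0_snd:
  fixes H :: "real \<times> real \<Rightarrow> real"
  assumes [measurable]: "H \<in> borel_measurable borel" and "\<And>z. \<bar>H z\<bar> \<le> B"
    and "\<And>x t. \<bar>x\<bar> > N \<or> \<bar>t\<bar> > N \<Longrightarrow> H (x, t) = 0"
    and "\<And>x. finite (E x)" "\<And>x. continuous_on UNIV (W x)"
    and "\<And>x t. t \<notin> E x \<Longrightarrow> (W x has_real_derivative H (x, t)) (at t)"
    and "\<And>x t. \<bar>t\<bar> > N \<Longrightarrow> W x t = 0"
  shows "(\<integral>z. H z \<partial>lborel) = 0"
proof -
  have "integrable (lborel \<Otimes>\<^sub>M lborel) H" unfolding lborel_prod by (rule integrable_plane_box[OF assms(1-3)])
  then have "(\<integral>z. H z \<partial>(lborel \<Otimes>\<^sub>M lborel)) = (\<integral>x. \<integral>t. H (x, t) \<partial>lborel \<partial>lborel)"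
    by (rule lborel_pair.integral_fst'[symmetric])
  also have "(\<lambda>x. \<integral>t. H (x, t) \<partial>lborel) = (\<lambda>x. 0)"
    by (intro ext integral_along_line_eq_0[of _ B N "E _" "W _"]) (use assms in auto)
  finally show ?thesis by (simp add: lborel_prod)
qed

lemma integral_plane_eq_0_fst:
  fixes H :: "real \<times> real \<Rightarrow> real"
  assumes [measurable]: "H \<in> borel_measurable borel" and "\<And>z. \<bar>H z\<bar> \<le> B"
    and "\<And>x t. \<bar>x\<bar> > N \<or> \<bar>t\<bar> > N \<Longrightarrow> H (x, t) = 0"
    and "\<And>t. finite (E t)" "\<And>t. continuous_on UNIV (W t)"
    and "\<And>x t. x \<notin> E t \<Longrightarrow> (W t has_real_derivative H (x, t)) (at x)"
    and "\<And>x t. \<bar>x\<bar> > N \<Longrightarrow> W t x = 0"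
  shows "(\<integral>z. H z \<partial>lborel) = 0"
proof -
  have "integrable (lborel \<Otimes>\<^sub>M lborel) H" unfolding lborel_prod by (rule integrable_plane_box[OF assms(1-3)])
  then have "(\<integral>z. H z \<partial>(lborel \<Otimes>\<^sub>M lborel)) = (\<integral>t. \<integral>x. H (x, t) \<partial>lborel \<partial>lborel)"
    using lborel_pair.integral_snd[of "\<lambda>x t. H (x, t)"] by simp
  also have "(\<lambda>t. \<integral>x. H (x, t) \<partial>lborel) = (\<lambda>x. 0)"
    by (intro ext integral_along_line_eq_0[of _ B N "E _" "W _"]) (use assms in auto)
  finally show ?thesis by (simp add: lborel_prod)
qed

text \<open>For fixed \<open>t\<close> the shear is a translation in \<open>x\<close>. It turns the characteristics of slope \<open>a\<close> into
vertical lines.\<close>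

lemma integral_plane_shear:
  fixes K :: "real \<times> real \<Rightarrow> real"
  assumes "integrable lborel K" "integrable lborel (\<lambda>z. K (fst z + a * snd z, snd z))"
  shows "(\<integral>z. K z \<partial>lborel) = (\<integral>z. K (fst z + a * snd z, snd z) \<partial>lborel)"
proof -
  have [measurable]: "K \<in> borel_measurable borel" using assms(1) by auto
  have "(\<integral>z. K z \<partial>lborel) = (\<integral>t. \<integral>x. K (x, t) \<partial>lborel \<partial>lborel)"
    using lborel_pair.integral_snd[of "\<lambda>x t. K (x, t)"] assms(1) by (simp add: lborel_prod)
  also have "\<dots> = (\<integral>t. \<integral>x. K (x + a * t, t) \<partial>lborel \<partial>lborel)"
    using lborel_integral_real_affine[of 1 "\<lambda>x. K (x, _)" "a * _"] by (simp add: add.commute)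
  also have "\<dots> = (\<integral>z. K (fst z + a * snd z, snd z) \<partial>lborel)"
    using lborel_pair.integral_snd[of "\<lambda>x t. K (x + a * t, t)"] assms(2)
    by (simp add: lborel_prod case_prod_beta')
  finally show ?thesis .
qed

lemma bounded_product_box:
  fixes v \<psi> :: "real \<times> real \<Rightarrow> real"
  assumes v: "\<And>K. compact K \<Longrightarrow> bounded (v ` K)" and \<psi>: "continuous_on UNIV \<psi>"
    and 0: "\<And>x t. \<bar>x\<bar> > N \<or> \<bar>t\<bar> > N \<Longrightarrow> \<psi> (x, t) = 0"
  obtains B where "\<And>z. \<bar>v z * \<psi> z\<bar> \<le> B"
proof -
  let ?K = "{- N..N} \<times> {- N..N}"
  have K: "compact ?K" by (intro compact_Times compact_Icc)
  obtain B where B: "B > 0" "\<And>z. z \<in> ?K \<Longrightarrow> \<bar>v z\<bar> \<le> B" using v[OF K] by (force simp: bounded_pos)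
  have "bounded (\<psi> ` ?K)"
    by (rule continuous_bounded_image[OF \<psi> K])
  then obtain C where C: "C > 0" "\<And>z. z \<in> ?K \<Longrightarrow> \<bar>\<psi> z\<bar> \<le> C" by (force simp: bounded_pos)
  show thesis
  proof
    fix z show "\<bar>v z * \<psi> z\<bar> \<le> B * C"
    proof (cases "z \<in> ?K")
      case True
      then show ?thesis unfolding abs_mult using B C by (intro mult_mono) auto
    next
      case False
      then have "\<bar>fst z\<bar> > N \<or> \<bar>snd z\<bar> > N" by (cases z) auto
      then have "\<psi> z = 0" using 0[of "fst z" "snd z"] by simp
      then show ?thesis using B C by simp
    qed
  qed
qed

lemma weak_partial_snd:
  fixes u v :: "real \<times> real \<Rightarrow> real"
  assumes u: "continuous_on UNIV u" and vm[measurable]: "v \<in> borel_measurable borel"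
    and v: "\<And>K. compact K \<Longrightarrow> bounded (v ` K)"
    and d: "\<And>x t. ((\<lambda>t. u (x, t)) has_real_derivative v (x, t)) (at t)"
  shows "weak_partial (0, 1) u v"
  unfolding weak_partial_def
proof (intro allI impI)
  fix \<phi> :: "real \<times> real \<Rightarrow> real" assume t: "test_function UNIV \<phi>"
  obtain N where N: "N > 0" "\<And>x t. \<bar>x\<bar> > N \<or> \<bar>t\<bar> > N \<Longrightarrow> \<phi> (x, t) = 0"
    "\<And>b x t. \<bar>x\<bar> > N \<or> \<bar>t\<bar> > N \<Longrightarrow> partial b \<phi> (x, t) = 0" using test_function_plane[OF t] by blast
  note c = test_function_continuous[OF t]
  have [measurable]: "u \<in> borel_measurable borel" "\<phi> \<in> borel_measurable borel"
    "partial (0, 1) \<phi> \<in> borel_measurable borel"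
    using u c(1) c(2)[OF Basis_plane(2)] by (auto intro: borel_measurable_continuous_onI)
  obtain B where B: "\<And>z. \<bar>v z * \<phi> z\<bar> \<le> B" using bounded_product_box[OF v c(1) N(2)] by blast
  obtain C where C: "\<And>z. \<bar>u z * partial (0, 1) \<phi> z\<bar> \<le> C"
    using bounded_product_box[OF continuous_bounded_image[OF u] c(2)[OF Basis_plane(2)] N(3)] by blast
  have i1: "integrable lborel (\<lambda>z. v z * \<phi> z)"
  proof (rule integrable_plane_box[OF _ B])
    show "v (x, t) * \<phi> (x, t) = 0" if "\<bar>x\<bar> > N \<or> \<bar>t\<bar> > N" for x t using N(2)[OF that] by simp
  qed measurable
  have i2: "integrable lborel (\<lambda>z. u z * partial (0, 1) \<phi> z)"
  proof (rule integrable_plane_box[OF _ C])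
    show "u (x, t) * partial (0, 1) \<phi> (x, t) = 0" if "\<bar>x\<bar> > N \<or> \<bar>t\<bar> > N" for x t
      using N(3)[OF that] by simp
  qed measurable
  have "(\<integral>z. (u z * partial (0, 1) \<phi> z + v z * \<phi> z) \<partial>lborel) = 0"
  proof (rule integral_plane_eq_0_snd[where E = "\<lambda>_. {}" and W = "\<lambda>x t. u (x, t) * \<phi> (x, t)" and B = "C + B"])
    show "u (x, t) * partial (0, 1) \<phi> (x, t) + v (x, t) * \<phi> (x, t) = 0"
      if "\<bar>x\<bar> > N \<or> \<bar>t\<bar> > N" for x t using N(2,3)[OF that] by simp
    show "u (x, t) * \<phi> (x, t) = 0" if "\<bar>t\<bar> > N" for x t using N(2)[of x t] that by simp
    show "\<bar>u z * partial (0, 1) \<phi> z + v z * \<phi> z\<bar> \<le> C + B" for z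
      using B[of z] C[of z] by linarith
    show "((\<lambda>t. u (x, t) * \<phi> (x, t)) has_real_derivative
        u (x, t) * partial (0, 1) \<phi> (x, t) + v (x, t) * \<phi> (x, t)) (at t)" for x t
      using has_derivative_along_curve[OF c(3), of "\<lambda>_. x" 0 t "\<lambda>t. t" 1]
      by (auto intro!: derivative_eq_intros d)
    show "continuous_on UNIV (\<lambda>t. u (x, t) * \<phi> (x, t))" for x
      by (intro continuous_intros continuous_on_compose2[OF u] continuous_on_compose2[OF c(1)]) auto
  qed auto
  then show "(\<integral>z. u z * partial (0, 1) \<phi> z \<partial>lborel) = - (\<integral>z. v z * \<phi> z \<partial>lborel)"
    using i1 i2 by simp
qed

text \<open>A kink across the axis \<open>x = 0\<close> is harmless: \<open>u\<close> is continuous there, and each horizontal line meets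
the axis in a single point.\<close>

lemma weak_partial_fst:
  fixes u v :: "real \<times> real \<Rightarrow> real"
  assumes u: "continuous_on UNIV u" and vm[measurable]: "v \<in> borel_measurable borel"
    and v: "\<And>K. compact K \<Longrightarrow> bounded (v ` K)"
    and d: "\<And>x t. x \<noteq> 0 \<Longrightarrow> ((\<lambda>x. u (x, t)) has_real_derivative v (x, t)) (at x)"
  shows "weak_partial (1, 0) u v"
  unfolding weak_partial_def
proof (intro allI impI)
  fix \<phi> :: "real \<times> real \<Rightarrow> real" assume t: "test_function UNIV \<phi>"
  obtain N where N: "N > 0" "\<And>x t. \<bar>x\<bar> > N \<or> \<bar>t\<bar> > N \<Longrightarrow> \<phi> (x, t) = 0"
    "\<And>b x t. \<bar>x\<bar> > N \<or> \<bar>t\<bar> > N \<Longrightarrow> partial b \<phi> (x, t) = 0" using test_function_plane[OF t] by blast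
  note c = test_function_continuous[OF t]
  have [measurable]: "u \<in> borel_measurable borel" "\<phi> \<in> borel_measurable borel"
    "partial (1, 0) \<phi> \<in> borel_measurable borel"
    using u c(1) c(2)[OF Basis_plane(1)] by (auto intro: borel_measurable_continuous_onI)
  obtain B where B: "\<And>z. \<bar>v z * \<phi> z\<bar> \<le> B" using bounded_product_box[OF v c(1) N(2)] by blast
  obtain C where C: "\<And>z. \<bar>u z * partial (1, 0) \<phi> z\<bar> \<le> C"
    using bounded_product_box[OF continuous_bounded_image[OF u] c(2)[OF Basis_plane(1)] N(3)] by blast
  have i1: "integrable lborel (\<lambda>z. v z * \<phi> z)"
  proof (rule integrable_plane_box[OF _ B])
    show "v (x, t) * \<phi> (x, t) = 0" if "\<bar>x\<bar> > N \<or> \<bar>t\<bar> > N" for x t using N(2)[OF that] by simp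
  qed measurable
  have i2: "integrable lborel (\<lambda>z. u z * partial (1, 0) \<phi> z)"
  proof (rule integrable_plane_box[OF _ C])
    show "u (x, t) * partial (1, 0) \<phi> (x, t) = 0" if "\<bar>x\<bar> > N \<or> \<bar>t\<bar> > N" for x t
      using N(3)[OF that] by simp
  qed measurable
  have "(\<integral>z. (u z * partial (1, 0) \<phi> z + v z * \<phi> z) \<partial>lborel) = 0"
  proof (rule integral_plane_eq_0_fst[where E = "\<lambda>_. {0}" and W = "\<lambda>t x. u (x, t) * \<phi> (x, t)" and B = "C + B"])
    show "u (x, t) * partial (1, 0) \<phi> (x, t) + v (x, t) * \<phi> (x, t) = 0"
      if "\<bar>x\<bar> > N \<or> \<bar>t\<bar> > N" for x t using N(2,3)[OF that] by simp
    show "u (x, t) * \<phi> (x, t) = 0" if "\<bar>x\<bar> > N" for x t using N(2)[of x t] that by simp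
    show "\<bar>u z * partial (1, 0) \<phi> z + v z * \<phi> z\<bar> \<le> C + B" for z
      using B[of z] C[of z] by linarith
    show "((\<lambda>x. u (x, t) * \<phi> (x, t)) has_real_derivative
        u (x, t) * partial (1, 0) \<phi> (x, t) + v (x, t) * \<phi> (x, t)) (at x)" if "x \<notin> {0}" for x t
      using has_derivative_along_curve[OF c(3), of "\<lambda>x. x" 1 x "\<lambda>_. t" 0] that
      by (auto intro!: derivative_eq_intros d)
    show "continuous_on UNIV (\<lambda>x. u (x, t) * \<phi> (x, t))" for t
      by (intro continuous_intros continuous_on_compose2[OF u] continuous_on_compose2[OF c(1)]) auto
  qed auto
  then show "(\<integral>z. u z * partial (1, 0) \<phi> z \<partial>lborel) = - (\<integral>z. v z * \<phi> z \<partial>lborel)"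
    using i1 i2 by simp
qed

section \<open>Free waves glued along the axis\<close>

text \<open>The sign, with value \<open>1\<close> at \<open>0\<close>: a solution defined through \<open>side\<close> takes its values on the axis from
the right half-plane.\<close>

definition side :: "real \<Rightarrow> real" where "side x = (if x \<ge> 0 then 1 else - 1)"

lemma side_family:
  fixes P :: "real \<Rightarrow> real \<Rightarrow> real"
  assumes P: "\<And>s. s \<in> {1, - 1} \<Longrightarrow> continuous_on UNIV (P s)"
  shows "(\<lambda>z. P (side (fst z)) (fst z + c * snd z)) \<in> borel_measurable borel"
    and "compact K \<Longrightarrow> bounded ((\<lambda>z. P (side (fst z)) (fst z + c * snd z)) ` K)"
proof -
  let ?p = "\<lambda>s z. P s (fst z + c * snd z)"
  have eq: "(\<lambda>z. P (side (fst z)) (fst z + c * snd z))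
      = (\<lambda>z. if fst z \<ge> 0 then ?p 1 z else ?p (- 1) z)"
    by (auto simp: side_def fun_eq_iff)
  have cont: "continuous_on UNIV (?p s)" if "s \<in> {1, - 1}" for s
    by (intro continuous_on_compose2[OF P[OF that]] continuous_intros) auto
  have [measurable]: "?p 1 \<in> borel_measurable borel" "?p (- 1) \<in> borel_measurable borel"
    using cont by (auto intro: borel_measurable_continuous_onI)
  show "(\<lambda>z. P (side (fst z)) (fst z + c * snd z)) \<in> borel_measurable borel"
    unfolding eq by (intro measurable_If) (auto simp: closed_Collect_le continuous_on_fst)
  assume K: "compact K"
  have "(\<lambda>z. P (side (fst z)) (fst z + c * snd z)) ` K \<subseteq> ?p 1 ` K \<union> ?p (- 1) ` K"
  proof (rule image_subsetI)
    fix z assume "z \<in> K"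
    then show "P (side (fst z)) (fst z + c * snd z) \<in> ?p 1 ` K \<union> ?p (- 1) ` K"
      by (cases "fst z \<ge> 0") (auto simp only: side_def if_True if_False intro: rev_image_eqI)
  qed
  moreover have "bounded (?p 1 ` K \<union> ?p (- 1) ` K)"
    using continuous_bounded_image[OF cont K] by simp
  ultimately show "bounded ((\<lambda>z. P (side (fst z)) (fst z + c * snd z)) ` K)"
    using bounded_subset by blast
qed

text \<open>In coordinates moving with speed \<open>c\<close> the first factor depends on time only through the side of the
axis, and the second factor is the time derivative of \<open>\<phi>\<close> along the characteristic. The
characteristic is cut into at most two pieces by the axis. Since \<open>\<phi>\<close> vanishes on the axis and far
away, the product has integral \<open>0\<close> along each piece.\<close>

lemma transport_integral_eq_0:
  fixes P :: "real \<Rightarrow> real \<Rightarrow> real"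
  assumes P: "\<And>s. s \<in> {1, - 1} \<Longrightarrow> continuous_on UNIV (P s)" and t: "test_function {z. fst z \<noteq> 0} \<phi>"
  shows "integrable lborel (\<lambda>z. P (side (fst z)) (fst z + (- c) * snd z) *
      (partial (0, 1) \<phi> z + c * partial (1, 0) \<phi> z))" (is "integrable lborel ?K")
    and "(\<integral>z. P (side (fst z)) (fst z + (- c) * snd z) *
      (partial (0, 1) \<phi> z + c * partial (1, 0) \<phi> z) \<partial>lborel) = 0"
proof -
  obtain N where N: "N > 0" "\<And>x t. \<bar>x\<bar> > N \<or> \<bar>t\<bar> > N \<Longrightarrow> \<phi> (x, t) = 0"
    "\<And>b x t. \<bar>x\<bar> > N \<or> \<bar>t\<bar> > N \<Longrightarrow> partial b \<phi> (x, t) = 0" using test_function_plane[OF t] by blast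
  note c = test_function_continuous[OF t]
  let ?\<psi> = "\<lambda>z. partial (0, 1) \<phi> z + c * partial (1, 0) \<phi> z"
  have \<psi>: "continuous_on UNIV ?\<psi>" by (intro continuous_intros c Basis_plane)
  have \<psi>0: "?\<psi> (x, t) = 0" if "\<bar>x\<bar> > N \<or> \<bar>t\<bar> > N" for x t using N(3)[OF that] by simp
  have sf: "(\<lambda>z. P (side (fst z)) (fst z + (- c) * snd z)) \<in> borel_measurable borel"
    "\<And>K. compact K \<Longrightarrow> bounded ((\<lambda>z. P (side (fst z)) (fst z + (- c) * snd z)) ` K)"
    using side_family[OF P, where c = "- c"] by auto
  have mK[measurable]: "?K \<in> borel_measurable borel"
    using sf(1) borel_measurable_continuous_onI[OF \<psi>] by measurable
  obtain B where B: "\<And>z. \<bar>?K z\<bar> \<le> B" using bounded_product_box[OF sf(2) \<psi> \<psi>0] by blast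
  show iK: "integrable lborel ?K" by (rule integrable_plane_box[OF mK B]) (use \<psi>0 in auto)
  \<comment> \<open>The sheared integrand \<open>?L\<close> vanishes outside the box of size \<open>?N\<close>.\<close>
  let ?N = "N + \<bar>c\<bar> * N"
  have NN: "?N \<ge> N" using N(1) by simp
  let ?L = "\<lambda>z. ?K (fst z + c * snd z, snd z)"
  have mL: "?L \<in> borel_measurable borel" 
  proof (rule measurable_compose[OF _ mK])
    show "(\<lambda>z. (fst z + c * snd z, snd z)) \<in> borel_measurable (borel :: (real \<times> real) measure)"
      by (intro borel_measurable_continuous_onI continuous_intros)
  qed
  have L0: "?L (x, t) = 0" if "\<bar>x\<bar> > ?N \<or> \<bar>t\<bar> > ?N" for x t
  proof (cases "\<bar>t\<bar> > N")
    case False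
    then have "\<bar>x\<bar> > ?N" using that NN by linarith
    moreover have "\<bar>c * t\<bar> \<le> \<bar>c\<bar> * N" using False by (simp add: abs_mult mult_left_mono)
    ultimately have "\<bar>x + c * t\<bar> > N" by linarith
    then show ?thesis using \<psi>0[of "x + c * t" t] by simp
  qed (use \<psi>0[of "x + c * t" t] in simp)
  have BL: "\<bar>?L z\<bar> \<le> B" for z by (rule B)
  have iL: "integrable lborel ?L" by (rule integrable_plane_box[OF mL BL L0])
  have "(\<integral>z. ?L z \<partial>lborel) = 0"
  proof (rule integral_plane_eq_0_snd[OF mL BL L0,
        where E = "\<lambda>x. {t. x + c * t = 0 \<and> c \<noteq> 0}" and W = "\<lambda>x t. P (side (x + c * t)) x * \<phi> (x + c * t, t)"])
    show "finite {t. x + c * t = 0 \<and> c \<noteq> 0}" for x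
      by (rule finite_subset[of _ "{- x / c}"]) (auto simp: field_simps)
    \<comment> \<open>The support of \<open>\<phi>\<close> avoids the axis; this removes the jump of \<open>P\<close> there.\<close>
    have \<phi>0: "\<phi> (0, t) = 0" for t
      using t closure_subset[of "{z. \<phi> z \<noteq> 0}"] unfolding test_function_def by auto
    show "continuous_on UNIV (\<lambda>t. P (side (x + c * t)) x * \<phi> (x + c * t, t))" for x
    proof -
      have "continuous_on ({t. x + c * t \<ge> 0} \<union> {t. x + c * t \<le> 0})
        (\<lambda>t. if x + c * t \<ge> 0 then P 1 x * \<phi> (x + c * t, t) else P (- 1) x * \<phi> (x + c * t, t))"
        by (rule continuous_on_If) (auto intro!: closed_Collect_le continuous_intros
            continuous_on_compose2[OF c(1)] simp: \<phi>0 antisym_conv)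
      moreover have "{t. x + c * t \<ge> 0} \<union> {t. x + c * t \<le> 0} = UNIV" by auto
      moreover have "(\<lambda>t. if x + c * t \<ge> 0 then P 1 x * \<phi> (x + c * t, t) else P (- 1) x * \<phi> (x + c * t, t))
         = (\<lambda>t. P (side (x + c * t)) x * \<phi> (x + c * t, t))" by (auto simp: side_def)
      ultimately show ?thesis by (simp only:)
    qed
    show "((\<lambda>t. P (side (x + c * t)) x * \<phi> (x + c * t, t)) has_real_derivative ?L (x, t)) (at t)"
      if nz: "t \<notin> {t. x + c * t = 0 \<and> c \<noteq> 0}" for x t
    proof -
      have along: "((\<lambda>t. \<phi> (x + c * t, t)) has_real_derivative ?\<psi> (x + c * t, t)) (at t)"
      proof -
        have "((\<lambda>t. x + c * t) has_real_derivative c) (at t)" by (auto intro!: derivative_eq_intros)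
        then show ?thesis
          using has_derivative_along_curve[OF c(3), of "\<lambda>t. x + c * t" c t "\<lambda>t. t" 1] DERIV_ident
          by (simp add: add.commute)
      qed
      have d: "((\<lambda>\<tau>. P (side (x + c * t)) x * \<phi> (x + c * \<tau>, \<tau>)) has_real_derivative ?L (x, t)) (at t)"
        using DERIV_cmult[OF along] by simp
      consider "c = 0" | "x + c * t > 0" | "x + c * t < 0" using nz by fastforce
      then show ?thesis
      proof cases
        case 1
        then show ?thesis using d by simp
      next
        case 2
        show ?thesis
          by (rule has_field_derivative_transform_within_open[OF d, where S = "{\<tau>. x + c * \<tau> > 0}"])
             (use 2 in \<open>auto intro!: open_Collect_less continuous_intros simp: side_def\<close>)
      next
        case 3
        show ?thesis
          by (rule has_field_derivative_transform_within_open[OF d, where S = "{\<tau>. x + c * \<tau> < 0}"])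
             (use 3 in \<open>auto intro!: open_Collect_less continuous_intros simp: side_def\<close>)
      qed
    qed
    show "P (side (x + c * t)) x * \<phi> (x + c * t, t) = 0" if "\<bar>t\<bar> > ?N" for x t
      using N(2)[of "x + c * t" t] that NN by simp
  qed
  then show "(\<integral>z. ?K z \<partial>lborel) = 0" using integral_plane_shear[OF iK iL] by simp
qed

text \<open>Continuity across the axis is the matching condition, and the weak derivatives of \<open>u\<close> are its
classical derivatives off the axis. In the wave equation only one derivative is moved back from the
test function \<open>\<phi>\<close> to \<open>u\<close>. What remains is a combination of transport terms
\<open>f' (\<phi>\<^sub>t + a \<phi>\<^sub>x)\<close> and \<open>g' (\<phi>\<^sub>t - a \<phi>\<^sub>x)\<close>, each of integral \<open>0\<close>. In this way \<open>C\<^sup>1\<close> profiles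
suffice, and mixed second derivatives of \<open>\<phi>\<close> never occur.\<close>

lemma glued_waves:
  fixes f g f' g' :: "real \<Rightarrow> real \<Rightarrow> real" and a \<mu> \<kappa> :: real
  assumes a: "a > 0" "\<mu> * a\<^sup>2 = \<kappa>"
    and df: "\<And>s x. s \<in> {1, - 1} \<Longrightarrow> (f s has_real_derivative f' s x) (at x)"
    and dg: "\<And>s x. s \<in> {1, - 1} \<Longrightarrow> (g s has_real_derivative g' s x) (at x)"
    and cf': "\<And>s. s \<in> {1, - 1} \<Longrightarrow> continuous_on UNIV (f' s)"
    and cg': "\<And>s. s \<in> {1, - 1} \<Longrightarrow> continuous_on UNIV (g' s)"
    and match: "\<And>t. f 1 (- a * t) + g 1 (a * t) = f (- 1) (- a * t) + g (- 1) (a * t)"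
  defines "u \<equiv> \<lambda>z. f (side (fst z)) (fst z + - a * snd z) + g (side (fst z)) (fst z + a * snd z)"
  shows "u \<in> class_E" and "dalembert a u f g f' g'" and "wave_eq_off_0 \<mu> \<kappa> u"
proof -
  have cf: "continuous_on UNIV (f s)" if "s \<in> {1, - 1}" for s
    using df[OF that] DERIV_continuous_on by blast
  have cg: "continuous_on UNIV (g s)" if "s \<in> {1, - 1}" for s
    using dg[OF that] DERIV_continuous_on by blast
  have cu: "continuous_on UNIV u"
  proof -
    let ?v = "\<lambda>s z. f s (fst z + - a * snd z) + g s (fst z + a * snd z)"
    have cv: "continuous_on A (?v s)" if "s \<in> {1, - 1}" for A s
      by (intro continuous_intros continuous_on_compose2[OF cf[OF that]]
          continuous_on_compose2[OF cg[OF that]]) auto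
    have "continuous_on ({z. fst z \<ge> 0} \<union> {z. fst z \<le> 0}) (\<lambda>z. if fst z \<ge> 0 then ?v 1 z else ?v (- 1) z)"
    proof (rule continuous_on_If)
      show "closed {z::real \<times> real. fst z \<ge> 0}" "closed {z::real \<times> real. fst z \<le> 0}"
        by (auto intro!: closed_Collect_le continuous_intros)
      show "?v 1 z = ?v (- 1) z" if "z \<in> {z. fst z \<le> 0}" "0 \<le> fst z" for z
      proof -
        have "fst z = 0" using that by simp
        then show ?thesis using match[of "snd z"] by simp
      qed
      show "continuous_on {z. fst z \<ge> 0} (?v 1)" "continuous_on {z. fst z \<le> 0} (?v (- 1))"
        by (rule cv; simp)+
    qed simp
    moreover have "{z::real \<times> real. fst z \<ge> 0} \<union> {z. fst z \<le> 0} = UNIV" by (rule set_eqI) (simp add: linear)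
    moreover have "(\<lambda>z. if fst z \<ge> 0 then ?v 1 z else ?v (- 1) z) = u"
      unfolding u_def side_def by (rule ext) simp
    ultimately show ?thesis by (simp only:)
  qed
  define p where "p z = f' (side (fst z)) (fst z + - a * snd z)" for z :: "real \<times> real"
  define q where "q z = g' (side (fst z)) (fst z + a * snd z)" for z :: "real \<times> real"
  have s01: "side x \<in> {1, - 1}" for x by (simp add: side_def)
  have pm[measurable]: "p \<in> borel_measurable borel" and qm[measurable]: "q \<in> borel_measurable borel"
    using side_family(1)[OF cf', where c = "- a"] side_family(1)[OF cg', where c = a]
    by (simp_all add: p_def[abs_def] q_def[abs_def])
  have pb: "bounded (p ` K)" and qb: "bounded (q ` K)" if "compact K" for K
    using side_family(2)[OF cf' that, where c = "- a"] side_family(2)[OF cg' that, where c = a]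
    by (simp_all add: p_def[abs_def] q_def[abs_def])
  have comb_b: "bounded ((\<lambda>z. c * p z + d * q z) ` K)" if K: "compact K" for c d K
  proof -
    obtain B C where BC: "\<And>z. z \<in> K \<Longrightarrow> \<bar>p z\<bar> \<le> B" "\<And>z. z \<in> K \<Longrightarrow> \<bar>q z\<bar> \<le> C"
      using pb[OF K] qb[OF K] unfolding bounded_iff real_norm_def by blast
    have "\<bar>c * p z + d * q z\<bar> \<le> \<bar>c\<bar> * B + \<bar>d\<bar> * C" if "z \<in> K" for z
      using mult_left_mono[OF BC(1)[OF that], of "\<bar>c\<bar>"] mult_left_mono[OF BC(2)[OF that], of "\<bar>d\<bar>"]
        abs_triangle_ineq[of "c * p z" "d * q z"] by (simp add: abs_mult)
    then show ?thesis by (intro boundedI[where B = "\<bar>c\<bar> * B + \<bar>d\<bar> * C"]) auto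
  qed
  define ut where "ut z = - a * p z + a * q z" for z
  define ux where "ux z = 1 * p z + 1 * q z" for z
  have mt: "ut \<in> borel_measurable borel" "ux \<in> borel_measurable borel"
    unfolding ut_def ux_def by measurable
  have bt: "bounded (ut ` K)" "bounded (ux ` K)" if "compact K" for K
    unfolding ut_def ux_def by (intro comb_b that)+
  have wt: "weak_partial (0, 1) u ut"
  proof (rule weak_partial_snd[OF cu mt(1) bt(1)])
    show "((\<lambda>t. u (x, t)) has_real_derivative ut (x, t)) (at t)" for x t
      unfolding u_def ut_def p_def q_def fst_conv snd_conv
      by (rule DERIV_cong, rule DERIV_add[OF DERIV_chain2[OF df[OF s01]] DERIV_chain2[OF dg[OF s01]]])
         (auto intro!: derivative_eq_intros)
  qed
  have wx: "weak_partial (1, 0) u ux"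
  proof (rule weak_partial_fst[OF cu mt(2) bt(2)])
    fix x t :: real assume "x \<noteq> 0"
    have d: "((\<lambda>x'. f (side x) (x' + - a * t) + g (side x) (x' + a * t)) has_real_derivative ux (x, t)) (at x)"
      unfolding ux_def p_def q_def fst_conv snd_conv
      by (rule DERIV_cong, rule DERIV_add[OF DERIV_chain2[OF df[OF s01]] DERIV_chain2[OF dg[OF s01]]])
         (auto intro!: derivative_eq_intros)
    have "eventually (\<lambda>x'. side x' = side x) (nhds x)"
    proof (cases "x > 0")
      case True
      then have "eventually (\<lambda>x'. x' > 0) (nhds x)" by (intro eventually_nhds_in_open[of "{0<..}", simplified]) auto
      then show ?thesis by eventually_elim (use True in \<open>simp add: side_def\<close>)
    next
      case False
      then have "eventually (\<lambda>x'. x' < 0) (nhds x)"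
        using \<open>x \<noteq> 0\<close> by (intro eventually_nhds_in_open[of "{..<0}", simplified]) auto
      then show ?thesis by eventually_elim (use False \<open>x \<noteq> 0\<close> in \<open>simp add: side_def\<close>)
    qed
    then have ev: "eventually (\<lambda>x'. f (side x) (x' + - a * t) + g (side x) (x' + a * t) = u (x', t)) (nhds x)"
      by eventually_elim (simp add: u_def)
    show "((\<lambda>x. u (x, t)) has_real_derivative ux (x, t)) (at x)"
      by (rule DERIV_cong_ev[OF refl ev refl, THEN iffD1, OF d])
  qed
  show "u \<in> class_E"
    unfolding class_E_def using cu wt wx L2_locI[OF mt(1) bt(1)] L2_locI[OF mt(2) bt(2)] by blast
  show "dalembert a u f g f' g'"
    unfolding dalembert_def
  proof (intro conjI ballI allI impI)
    fix s :: real assume s: "s \<in> {1, - 1}"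
    have L2: "L2_loc h" if "continuous_on UNIV h" for h :: "real \<Rightarrow> real"
      by (rule L2_locI) (use that in \<open>auto intro: borel_measurable_continuous_onI continuous_bounded_image\<close>)
    show "continuous_on UNIV (f s)" "continuous_on UNIV (g s)" using cf[OF s] cg[OF s] .
    show "L2_loc (f' s)" "L2_loc (g' s)" using L2 cf'[OF s] cg'[OF s] by auto
    show "weak_partial 1 (f s) (f' s)" "weak_partial 1 (g s) (g' s)"
      using weak_partial_of_derivative[OF df[OF s] cf'[OF s]] weak_partial_of_derivative[OF dg[OF s] cg'[OF s]] .
  next
    fix x t :: real assume "x \<noteq> 0"
    then have "side x = sgn x" by (simp add: side_def sgn_if)
    then show "u (x, t) = f (sgn x) (x - a * t) + g (sgn x) (x + a * t)" by (simp add: u_def)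
  qed
  show "wave_eq_off_0 \<mu> \<kappa> u"
    unfolding wave_eq_off_0_def
  proof (intro allI impI)
    fix \<phi> :: "real \<times> real \<Rightarrow> real" assume t: "test_function {z. fst z \<noteq> 0} \<phi>"
    let ?t = "partial (0, 1) \<phi>" and ?x = "partial (1, 0) \<phi>"
    have "test_function UNIV ?t" "test_function UNIV ?x"
      using test_function_mono[OF test_function_partial[OF t]] Basis_plane by blast+
    then have ibp: "(\<integral>z. u z * partial (0, 1) ?t z \<partial>lborel) = - (\<integral>z. ut z * ?t z \<partial>lborel)"
        "(\<integral>z. u z * partial (1, 0) ?x z \<partial>lborel) = - (\<integral>z. ux z * ?x z \<partial>lborel)"
      using wt wx by (simp_all add: weak_partial_def)
    obtain N where "N > 0" "\<And>x t. \<bar>x\<bar> > N \<or> \<bar>t\<bar> > N \<Longrightarrow> \<phi> (x, t) = 0"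
      and N: "\<And>b x t. \<bar>x\<bar> > N \<or> \<bar>t\<bar> > N \<Longrightarrow> partial b \<phi> (x, t) = 0"
      using test_function_plane[OF t] by blast
    have int: "integrable lborel (\<lambda>z. v z * partial b \<phi> z)"
      if v: "v \<in> borel_measurable borel" "\<And>K. compact K \<Longrightarrow> bounded (v ` K)" and b: "b \<in> Basis" for v b
    proof -
      note c = test_function_continuous(2)[OF t b]
      obtain B where B: "\<And>z. \<bar>v z * partial b \<phi> z\<bar> \<le> B" using bounded_product_box[OF v(2) c N] by blast
      have [measurable]: "partial b \<phi> \<in> borel_measurable borel" by (rule borel_measurable_continuous_onI[OF c])
      show ?thesis
      proof (rule integrable_plane_box[OF _ B])
        show "v (x, t) * partial b \<phi> (x, t) = 0" if "\<bar>x\<bar> > N \<or> \<bar>t\<bar> > N" for x t using N[OF that] by simp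
      qed (use v(1) in measurable)
    qed
    note i = int[OF mt(1) bt(1) Basis_plane(2)] int[OF mt(2) bt(2) Basis_plane(1)]
    have right: "integrable lborel (\<lambda>z. p z * (?t z + a * ?x z))" "(\<integral>z. p z * (?t z + a * ?x z) \<partial>lborel) = 0"
      using transport_integral_eq_0[OF cf' t, where c = a] by (simp_all add: p_def)
    have left: "integrable lborel (\<lambda>z. q z * (?t z + - a * ?x z))" "(\<integral>z. q z * (?t z + - a * ?x z) \<partial>lborel) = 0"
      using transport_integral_eq_0[OF cg' t, where c = "- a"] by (simp_all add: q_def)
    have "(\<integral>z. ut z * ?t z \<partial>lborel) - a\<^sup>2 * (\<integral>z. ux z * ?x z \<partial>lborel)
        = (\<integral>z. (ut z * ?t z - a\<^sup>2 * (ux z * ?x z)) \<partial>lborel)"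
      using i by simp
    also have "\<dots> = (\<integral>z. (a * (q z * (?t z + - a * ?x z)) - a * (p z * (?t z + a * ?x z))) \<partial>lborel)"
      by (intro Bochner_Integration.integral_cong refl) (simp add: ut_def ux_def algebra_simps power2_eq_square)
    also have "\<dots> = a * (\<integral>z. q z * (?t z + - a * ?x z) \<partial>lborel) - a * (\<integral>z. p z * (?t z + a * ?x z) \<partial>lborel)"
      by (subst Bochner_Integration.integral_diff) (use left(1) right(1) in auto)
    also have "\<dots> = 0" using left(2) right(2) by simp
    finally have "(\<integral>z. ut z * ?t z \<partial>lborel) = a\<^sup>2 * (\<integral>z. ux z * ?x z \<partial>lborel)" by simp
    moreover have pull: "(\<integral>z. u z * (c * h z) \<partial>lborel) = c * (\<integral>z. u z * h z \<partial>lborel)" for c h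
      by (simp add: mult.left_commute)
    ultimately show "(\<integral>z. u z * (\<mu> * partial (0, 1) ?t z) \<partial>lborel) = (\<integral>z. u z * (\<kappa> * partial (1, 0) ?x z) \<partial>lborel)"
      unfolding pull ibp using a(2) by (simp add: mult.assoc[symmetric])
  qed
qed

section \<open>Periodically forced dissipative scalar equations\<close>

text \<open>After the last time at which \<open>z \<le> M\<close> the function could only decrease.\<close>

lemma sup_barrier:
  fixes z :: "real \<Rightarrow> real"
  assumes "s \<le> t" and c: "continuous_on {s..t} z" and "z s \<le> M"
    and d: "\<And>r. s < r \<Longrightarrow> r < t \<Longrightarrow> z r > M \<Longrightarrow> \<exists>D. (z has_real_derivative D) (at r) \<and> D \<le> 0"
  shows "z t \<le> M"
proof (rule ccontr)
  assume neg: "\<not> z t \<le> M"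
  let ?S = "{r \<in> {s..t}. z r \<le> M}"
  have ne: "?S \<noteq> {}" using assms by auto
  have cl: "closed ?S" 
    using continuous_closed_preimage[OF c closed_atLeastAtMost closed_atMost[of M]]
    by (simp add: vimage_def Int_def)
  have bd: "bdd_above ?S" by (auto intro!: bdd_aboveI)
  define r where "r = Sup ?S"
  have r: "r \<in> ?S" unfolding r_def by (rule closed_contains_Sup[OF ne bd cl])
  have above: "z x > M" if "r < x" "x \<le> t" for x
  proof (rule ccontr)
    assume "\<not> z x > M"
    then have "x \<in> ?S" using that r by auto
    then have "x \<le> r" unfolding r_def using bd by (rule cSup_upper)
    then show False using that by simp
  qed
  have "z t \<le> z r"
  proof (rule DERIV_nonpos_imp_decreasing_open[where f = z and a = r and b = t])
    show "r \<le> t" using r by auto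
    show "\<exists>y. (z has_real_derivative y) (at x) \<and> y \<le> 0" if "r < x" "x < t" for x
      using d[of x] above[of x] that r by auto
    show "continuous_on {r..t} z" by (rule continuous_on_subset[OF c]) (use r in auto)
  qed
  then show False using r neg by auto
qed

lemma has_integral_imp_DERIV:
  fixes h z :: "real \<Rightarrow> real"
  assumes "a < x" "x < b" and c: "continuous_on {a..b} h"
    and i: "\<And>t. a \<le> t \<Longrightarrow> t \<le> b \<Longrightarrow> (h has_integral z t - z a) {a..t}"
  shows "(z has_real_derivative h x) (at x)"
proof -
  have "((\<lambda>u. integral {a..u} h) has_real_derivative h x) (at x within {a..b})"
    using assms by (intro integral_has_real_derivative) auto
  then have "((\<lambda>u. integral {a..u} h) has_real_derivative h x) (at x)"
    using assms by (simp add: at_within_Icc_at)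
  then have "((\<lambda>u. integral {a..u} h + z a) has_real_derivative h x) (at x)"
    by (auto intro!: derivative_eq_intros)
  then show ?thesis
    by (rule has_field_derivative_transform_within_open[where S = "{a<..<b}"])
       (use assms integral_unique[OF i] in auto)
qed

text \<open>The function \<open>d\<^sup>2 exp (- 2 L r)\<close> is nonincreasing; by the square, the sign of
\<open>d\<close> does not matter.\<close>

lemma gronwall_abs:
  fixes d d' :: "real \<Rightarrow> real"
  assumes "s \<le> t" and c: "continuous_on {s..t} d"
    and d: "\<And>r. s < r \<Longrightarrow> r < t \<Longrightarrow> (d has_real_derivative d' r) (at r)"
    and L: "\<And>r. s < r \<Longrightarrow> r < t \<Longrightarrow> \<bar>d' r\<bar> \<le> L * \<bar>d r\<bar>"
  shows "\<bar>d t\<bar> \<le> \<bar>d s\<bar> * exp (L * (t - s))"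
proof -
  define h where "h r = (d r)\<^sup>2 * exp (- 2 * L * r)" for r
  have "h t \<le> h s"
  proof (rule DERIV_nonpos_imp_decreasing_open[where f = h, OF assms(1)])
    fix r assume r: "s < r" "r < t"
    have "(h has_real_derivative (2 * d r * d' r - 2 * L * (d r)\<^sup>2) * exp (- 2 * L * r)) (at r)"
      unfolding h_def by (auto intro!: derivative_eq_intros d r simp: algebra_simps power2_eq_square)
    moreover have "d r * d' r \<le> L * (d r)\<^sup>2"
    proof -
      have "d r * d' r \<le> \<bar>d r\<bar> * \<bar>d' r\<bar>" by (metis abs_ge_self abs_mult)
      also have "\<dots> \<le> \<bar>d r\<bar> * (L * \<bar>d r\<bar>)" by (intro mult_left_mono L r) auto
      also have "\<dots> = L * (d r)\<^sup>2" by (simp add: power2_eq_square)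
      finally show ?thesis .
    qed
    ultimately show "\<exists>y. (h has_real_derivative y) (at r) \<and> y \<le> 0"
      by (intro exI[of _ "(2 * d r * d' r - 2 * L * (d r)\<^sup>2) * exp (- 2 * L * r)"])
         (simp add: mult_le_0_iff)
  next
    show "continuous_on {s..t} h" unfolding h_def by (intro continuous_intros c)
  qed
  then have le: "(d t)\<^sup>2 * exp (- 2 * L * t) \<le> (d s)\<^sup>2 * exp (- 2 * L * s)" by (simp only: h_def)
  have "(d t)\<^sup>2 = (d t)\<^sup>2 * exp (- 2 * L * t) * exp (2 * L * t)"
    by (simp add: mult.assoc flip: exp_add)
  also have "\<dots> \<le> (d s)\<^sup>2 * exp (- 2 * L * s) * exp (2 * L * t)"
    by (rule mult_right_mono[OF le]) simp
  also have "\<dots> = (d s * exp (L * (t - s)))\<^sup>2"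
    unfolding power_mult_distrib power2_eq_square[of "exp _"] mult.assoc
    by (simp add: algebra_simps flip: exp_add)
  finally have "(d t)\<^sup>2 \<le> (d s * exp (L * (t - s)))\<^sup>2" .
  then have "\<bar>d t\<bar> \<le> \<bar>d s * exp (L * (t - s))\<bar>" by (simp add: abs_le_square_iff)
  then show ?thesis by (simp add: abs_mult)
qed

text \<open>The barrier \<open>0\<close> for \<open>(y - z) exp (- L r)\<close>: where this is positive, its derivative has the sign of
\<open>G y - G z - L (y - z) \<le> 0\<close>.\<close>

lemma ode_comparison:
  fixes y z :: "real \<Rightarrow> real"
  assumes "s \<le> t" and cy: "continuous_on {s..t} y" and cz: "continuous_on {s..t} z"
    and dy: "\<And>r. s < r \<Longrightarrow> r < t \<Longrightarrow> (y has_real_derivative G (y r) + p r) (at r)"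
    and dz: "\<And>r. s < r \<Longrightarrow> r < t \<Longrightarrow> (z has_real_derivative G (z r) + p r) (at r)"
    and L: "\<And>r. s < r \<Longrightarrow> r < t \<Longrightarrow> \<bar>G (y r) - G (z r)\<bar> \<le> L * \<bar>y r - z r\<bar>"
    and "y s \<le> z s"
  shows "y t \<le> z t"
proof -
  define w where "w r = (y r - z r) * exp (- L * r)" for r
  have "w t \<le> 0"
  proof (rule sup_barrier[OF assms(1)])
    show "continuous_on {s..t} w" unfolding w_def by (intro continuous_intros cy cz)
    show "w s \<le> 0" using assms(7) by (simp add: w_def mult_le_0_iff)
    fix r assume r: "s < r" "r < t" "w r > 0"
    have "(w has_real_derivative (G (y r) - G (z r) - L * (y r - z r)) * exp (- L * r)) (at r)"
      unfolding w_def by (auto intro!: derivative_eq_intros dy dz r simp: algebra_simps)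
    moreover have "y r > z r" using r(3) by (simp add: w_def zero_less_mult_iff)
    ultimately show "\<exists>D. (w has_real_derivative D) (at r) \<and> D \<le> 0"
      using L[OF r(1,2)]
      by (intro exI[of _ "(G (y r) - G (z r) - L * (y r - z r)) * exp (- L * r)"]) (auto simp: mult_le_0_iff)
  qed
  then show ?thesis by (simp add: w_def mult_le_0_iff)
qed

text \<open>Every argument can be moved into \<open>{0..T}\<close>, where compactness applies.\<close>

lemma continuous_periodic_bounded:
  fixes p :: "real \<Rightarrow> real"
  assumes c: "continuous_on UNIV p" and per: "\<And>t. p (t + T) = p t" and T: "T > 0"
  obtains P where "\<And>t. \<bar>p t\<bar> \<le> P"
proof -
  interpret periodic_fun_simple p T by unfold_locales (rule per)
  have "bounded (p ` {0..T})"
    by (rule continuous_bounded_image[OF c compact_Icc])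
  then obtain P where P: "\<And>t. t \<in> {0..T} \<Longrightarrow> \<bar>p t\<bar> \<le> P" by (force simp: bounded_iff)
  have "\<bar>p t\<bar> \<le> P" for t
  proof -
    have "p t = p (t - of_int \<lfloor>t / T\<rfloor> * T)" by (rule minus_of_int[symmetric])
    moreover have "t - of_int \<lfloor>t / T\<rfloor> * T \<in> {0..T}"
      using T floor_divide_lower[of T t] floor_divide_upper[of T t] by (auto simp: algebra_simps)
    ultimately show ?thesis using P by simp
  qed
  then show thesis using that by blast
qed

lemma C1_lipschitz_on_interval:
  fixes G G' :: "real \<Rightarrow> real"
  assumes d: "\<And>x. (G has_real_derivative G' x) (at x)" and c: "continuous_on UNIV G'"
  obtains L where "L \<ge> 0" "\<And>x y. \<bar>x\<bar> \<le> M \<Longrightarrow> \<bar>y\<bar> \<le> M \<Longrightarrow> \<bar>G x - G y\<bar> \<le> L * \<bar>x - y\<bar>"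
proof -
  have "bounded (G' ` {- M..M})"
    by (rule continuous_bounded_image[OF c compact_Icc])
  then obtain L where L: "L > 0" "\<And>t. t \<in> {- M..M} \<Longrightarrow> \<bar>G' t\<bar> \<le> L" by (force simp: bounded_pos)
  show thesis
  proof
    show "\<bar>G x - G y\<bar> \<le> L * \<bar>x - y\<bar>" if "\<bar>x\<bar> \<le> M" "\<bar>y\<bar> \<le> M" for x y
    proof -
      have "norm (G x - G y) \<le> L * norm (x - y)"
        by (rule field_differentiable_bound[where S = "{- M..M}" and f' = G'])
           (use that L in \<open>auto intro: has_field_derivative_at_within d\<close>)
      then show ?thesis by simp
    qed
  qed (use L in auto)
qed

text \<open>Far out, the restoring force \<open>G\<close> dominates the bounded forcing \<open>p\<close> and points inwards, so large
values of \<open>y\<close> of either sign are barriers.\<close>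

lemma dissipative_ode_bounded:
  fixes G p y :: "real \<Rightarrow> real"
  assumes G: "filterlim G at_bot at_top" "filterlim G at_top at_bot"
    and p: "\<And>t. \<bar>p t\<bar> \<le> P"
    and y: "continuous_on {0..} y" "\<And>t. t > 0 \<Longrightarrow> (y has_real_derivative G (y t) + p t) (at t)"
  obtains M where "\<And>t. t \<ge> 0 \<Longrightarrow> \<bar>y t\<bar> \<le> M"
proof -
  obtain M1 where M1: "\<And>x. x \<ge> M1 \<Longrightarrow> G x \<le> - P"
    using G(1) unfolding filterlim_at_bot eventually_at_top_linorder by blast
  obtain M2 where M2: "\<And>x. x \<le> M2 \<Longrightarrow> G x \<ge> P"
    using G(2) unfolding filterlim_at_top eventually_at_bot_linorder by blast
  define M where "M = Max {\<bar>M1\<bar>, \<bar>M2\<bar>, \<bar>y 0\<bar>}"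
  have M: "\<bar>M1\<bar> \<le> M" "\<bar>M2\<bar> \<le> M" "\<bar>y 0\<bar> \<le> M" by (auto simp: M_def)
  have "\<bar>y t\<bar> \<le> M" if "t \<ge> 0" for t
  proof -
    have c: "continuous_on {0..t} y" by (rule continuous_on_subset[OF y(1)]) auto
    have "y t \<le> M"
    proof (rule sup_barrier[OF that c])
      fix r assume "0 < r" "y r > M"
      then have "y r \<ge> M1" using M by linarith
      then have "G (y r) + p r \<le> 0" using M1[of "y r"] p[of r] by linarith
      then show "\<exists>D. (y has_real_derivative D) (at r) \<and> D \<le> 0" using y(2)[OF \<open>0 < r\<close>] by blast
    qed (use M in auto)
    moreover have "- y t \<le> M"
    proof (rule sup_barrier[OF that])
      show "continuous_on {0..t} (\<lambda>t. - y t)" by (intro continuous_intros c)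
      fix r assume "0 < r" "- y r > M"
      then have "y r \<le> M2" using M by linarith
      then have "- (G (y r) + p r) \<le> 0" using M2[of "y r"] p[of r] by linarith
      then show "\<exists>D. ((\<lambda>t. - y t) has_real_derivative D) (at r) \<and> D \<le> 0"
        using DERIV_minus[OF y(2)[OF \<open>0 < r\<close>]] by blast
    qed (use M in auto)
    ultimately show ?thesis by (simp add: abs_le_iff)
  qed
  then show thesis using that by blast
qed

text \<open>By periodicity of \<open>p\<close>, the translates of \<open>y\<close> by multiples of \<open>T\<close> solve the same equation, and by
comparison the sequence \<open>y (t + n T)\<close> is monotone in \<open>n\<close>, in the direction given by the order of
\<open>y 0\<close> and \<open>y T\<close>. Being bounded, it converges to some \<open>z t\<close>, for every real \<open>t\<close>; dominated
convergence in the integrated equation shows that \<open>z\<close> is a solution on the whole line. As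
\<open>y (n T) - z (n T)\<close> tends to \<open>0\<close>, and the difference of two solutions grows at most by the factor
\<open>exp (L T)\<close> within one period, \<open>y - z\<close> tends to \<open>0\<close>.\<close>

lemma dissipative_ode_periodic_attractor:
  fixes G G' p y :: "real \<Rightarrow> real"
  assumes G: "filterlim G at_bot at_top" "filterlim G at_top at_bot"
    and dG: "\<And>x. (G has_real_derivative G' x) (at x)" and cG': "continuous_on UNIV G'"
    and p: "continuous_on UNIV p" "\<And>t. p (t + T) = p t" and T: "T > 0"
    and y: "continuous_on {0..} y" "\<And>t. t > 0 \<Longrightarrow> (y has_real_derivative G (y t) + p t) (at t)"
  obtains z where "\<And>t. (z has_real_derivative G (z t) + p t) (at t)" "\<And>t. z (t + T) = z t"
    "((\<lambda>t. y t - z t) \<longlongrightarrow> 0) at_top" "((\<lambda>t. G (y t) - G (z t)) \<longlongrightarrow> 0) at_top"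
proof -
  obtain P where P: "\<And>t. \<bar>p t\<bar> \<le> P" using continuous_periodic_bounded[OF p T] by blast
  interpret p: periodic_fun_simple p T by unfold_locales (rule p(2))
  obtain M where M: "\<And>t. t \<ge> 0 \<Longrightarrow> \<bar>y t\<bar> \<le> M" using dissipative_ode_bounded[OF G P y] by blast
  obtain L where L: "L \<ge> 0" "\<And>a b. \<bar>a\<bar> \<le> M \<Longrightarrow> \<bar>b\<bar> \<le> M \<Longrightarrow> \<bar>G a - G b\<bar> \<le> L * \<bar>a - b\<bar>"
    using C1_lipschitz_on_interval[OF dG cG'] by blast
  have cG: "continuous_on UNIV G" using dG DERIV_continuous_on by blast
  have cy: "continuous_on {s..t} y" if "s \<ge> 0" for s t
    by (rule continuous_on_subset[OF y(1)]) (use that in auto)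
  have shift: "((\<lambda>t. y (t + real n * T)) has_real_derivative G (y (t + real n * T)) + p t) (at t)"
    if "t + real n * T > 0" for n t
    using DERIV_shift[THEN iffD1, OF y(2)[OF that]] p.plus_of_nat[of t n] by simp
  have order: "y (t + real 1 * T) \<le> y t" if "y T \<le> y 0" "t \<ge> 0" for t
  proof (rule ode_comparison[where s = 0 and G = G and p = p and L = L and z = y])
    show "continuous_on {0..t} (\<lambda>t. y (t + real 1 * T))"
      by (intro continuous_on_compose2[OF y(1)] continuous_intros) (use T in auto)
  qed (use that T shift[of _ 1] y cy M L in auto)
  have order': "y t \<le> y (t + real 1 * T)" if "y 0 \<le> y T" "t \<ge> 0" for t
  proof (rule ode_comparison[where s = 0 and G = G and p = p and L = L and y = y])
    show "continuous_on {0..t} (\<lambda>t. y (t + real 1 * T))"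
      by (intro continuous_on_compose2[OF y(1)] continuous_intros) (use T in auto)
  qed (use that T shift[of _ 1] y cy M L in auto)
  have conv: "convergent (\<lambda>n. y (t + real n * T))" if "t \<ge> 0" for t
  proof (rule Bseq_monoseq_convergent)
    show "Bseq (\<lambda>n. y (t + real n * T))"
      using M T that by (intro BseqI'[where K = M]) auto
    have pos: "t + real n * T \<ge> 0" for n using that T by simp
    have eq: "t + real n * T + real 1 * T = t + real (Suc n) * T" for n by (simp add: algebra_simps)
    show "monoseq (\<lambda>n. y (t + real n * T))"
      using order[OF _ pos] order'[OF _ pos] unfolding eq monoseq_Suc by (meson linear)
  qed
  \<comment> \<open>From some period on, the translate is in the domain of the equation, also for negative \<open>t\<close>.\<close>
  have late: "\<exists>N. t + real N * T > 0" for t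
    using T by (metis add.commute add_0 diff_gt_0_iff_gt diff_minus_eq_add ex_less_of_nat_mult minus_add_cancel)
  define z where "z t = lim (\<lambda>n. y (t + real n * T))" for t
  have zlim: "(\<lambda>n. y (t + real n * T)) \<longlonglongrightarrow> z t" for t
  proof -
    obtain N where N: "t + real N * T > 0" using late by blast
    have "convergent (\<lambda>n. y (t + real (n + N) * T))"
      using conv[of "t + real N * T"] N by (simp add: algebra_simps)
    then have "convergent (\<lambda>n. y (t + real n * T))"
      using convergent_ignore_initial_segment[of "\<lambda>n. y (t + real n * T)" N] by simp
    then show ?thesis unfolding z_def by (simp add: convergent_LIMSEQ_iff)
  qed
  have zper: "z (t + T) = z t" for t
  proof (rule LIMSEQ_unique[OF zlim])
    show "(\<lambda>n. y (t + T + real n * T)) \<longlonglongrightarrow> z t"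
      using LIMSEQ_Suc[OF zlim[of t]] by (simp add: algebra_simps)
  qed
  have zM: "\<bar>z t\<bar> \<le> M" for t
  proof -
    obtain N where N: "t + real N * T > 0" using late by blast
    have "\<bar>y (t + real n * T)\<bar> \<le> M" if "n \<ge> N" for n
      using that N T by (intro M) (smt (verit) mult_right_mono of_nat_mono)
    then show ?thesis
      by (intro LIMSEQ_le_const2[OF tendsto_rabs[OF zlim]]) blast
  qed
  have zint: "((\<lambda>r. G (z r) + p r) has_integral z t - z s) {s..t}" if "s \<le> t" for s t
  proof -
    obtain N where N: "s + real N * T > 0" using late by blast
    let ?t = "\<lambda>n r. r + real (n + N) * T"
    have pos: "?t n r > 0" if "r \<ge> s" for n r
      using that N T by (smt (verit) mult_right_mono of_nat_mono le_add2)
    have int: "((\<lambda>r. G (y (?t n r)) + p r) has_integral y (?t n t) - y (?t n s)) {s..t}" for n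
    proof (rule fundamental_theorem_of_calculus_interior[OF that])
      show "continuous_on {s..t} (\<lambda>r. y (?t n r))"
        by (intro continuous_on_compose2[OF y(1)] continuous_intros) (use pos[of _ n] in \<open>force intro: less_imp_le\<close>)
      show "((\<lambda>r. y (?t n r)) has_vector_derivative G (y (?t n r)) + p r) (at r)" if "r \<in> {s<..<t}" for r
        using shift[of r "n + N"] pos[of r n] that
        by (simp add: has_real_derivative_iff_has_vector_derivative)
    qed
    have cG0: "bounded (G ` {- M..M})"
      by (rule continuous_bounded_image[OF cG compact_Icc])
    then obtain B where B: "\<And>a. a \<in> {- M..M} \<Longrightarrow> \<bar>G a\<bar> \<le> B" by (force simp: bounded_iff)
    have zlimN: "(\<lambda>n. y (?t n r)) \<longlonglongrightarrow> z r" for r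
      using LIMSEQ_ignore_initial_segment[OF zlim[of r], of N] .
    have dom: "norm (G (y (?t n r)) + p r) \<le> B + P" if "r \<in> {s..t}" for n r
    proof -
      have "\<bar>G (y (?t n r))\<bar> \<le> B" using B[of "y (?t n r)"] M[of "?t n r"] pos[of r n] that by (auto simp: abs_le_iff)
      then show ?thesis using P[of r] by simp
    qed
    have lim: "(\<lambda>n. G (y (?t n r)) + p r) \<longlonglongrightarrow> G (z r) + p r" for r
      by (intro tendsto_intros isCont_tendsto_compose[of _ G] zlimN)
         (use cG in \<open>simp add: continuous_on_eq_continuous_at\<close>)
    have "(\<lambda>r. G (z r) + p r) integrable_on {s..t}"
      "(\<lambda>n. integral {s..t} (\<lambda>r. G (y (?t n r)) + p r)) \<longlonglongrightarrow> integral {s..t} (\<lambda>r. G (z r) + p r)"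
      using dominated_convergence[OF has_integral_integrable[OF int] integrable_const_ivl dom lim] by auto
    moreover have "(\<lambda>n. y (?t n t) - y (?t n s)) \<longlonglongrightarrow> z t - z s"
      by (intro tendsto_intros zlimN)
    ultimately show ?thesis
      using integral_unique[OF int] LIMSEQ_unique by (simp add: has_integral_integrable_integral) blast
  qed
  have cz: "continuous_on UNIV z"
  proof -
    have "isCont z x" for x
    proof -
      have "continuous_on {x - 1..x + 1} (\<lambda>t. integral {x - 1..t} (\<lambda>r. G (z r) + p r))"
        by (rule indefinite_integral_continuous_1) (use zint[of "x - 1" "x + 1"] in auto)
      then have "continuous_on {x - 1..x + 1} (\<lambda>t. integral {x - 1..t} (\<lambda>r. G (z r) + p r) + z (x - 1))"
        by (intro continuous_intros)
      then have "continuous_on {x - 1..x + 1} z"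
        by (rule continuous_on_eq) (use integral_unique[OF zint] in auto)
      then show ?thesis using continuous_on_interior[of "{x - 1..x + 1}" z x] by simp
    qed
    then show ?thesis by (simp add: continuous_on_eq_continuous_at)
  qed
  have dz: "(z has_real_derivative G (z t) + p t) (at t)" for t
  proof (rule has_integral_imp_DERIV[where a = "t - 1" and b = "t + 1"])
    show "continuous_on {t - 1..t + 1} (\<lambda>r. G (z r) + p r)"
      by (intro continuous_intros continuous_on_compose2[OF cG] continuous_on_subset[OF cz]
          continuous_on_subset[OF p(1)]) auto
  qed (use zint in auto)
  \<comment> \<open>The number of complete periods before time \<open>t\<close>.\<close>
  define n where "n t = nat \<lfloor>t / T\<rfloor>" for t
  have nlim: "filterlim n sequentially at_top"
    unfolding n_def
    by (rule filterlim_compose[OF filterlim_nat_sequentially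
          filterlim_compose[OF filterlim_floor_sequentially
            filterlim_tendsto_pos_mult_at_top[OF tendsto_const[of "1 / T"], of "\<lambda>t. t", simplified]]])
       (use T in \<open>auto simp: filterlim_ident\<close>)
  have est: "\<bar>y t - z t\<bar> \<le> \<bar>y (0 + real (n t) * T) - z 0\<bar> * exp (L * T)" if "t \<ge> 0" for t
  proof -
    have nt: "real (n t) * T \<le> t" "t - real (n t) * T \<le> T"
      using that T floor_divide_lower[of T t] floor_divide_upper[of T t]
      by (auto simp: n_def algebra_simps)
    have n0: "real (n t) * T \<ge> 0" using T by simp
    have "\<bar>y t - z t\<bar> \<le> \<bar>y (real (n t) * T) - z (real (n t) * T)\<bar> * exp (L * (t - real (n t) * T))"
    proof (rule gronwall_abs[OF nt(1), where d' = "\<lambda>r. G (y r) - G (z r)"])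
      show "continuous_on {real (n t) * T..t} (\<lambda>t. y t - z t)"
        by (intro continuous_intros cy n0 continuous_on_subset[OF cz]) auto
      fix r assume r: "real (n t) * T < r"
      then have "r > 0" using n0 by linarith
      then show "((\<lambda>t. y t - z t) has_real_derivative G (y r) - G (z r)) (at r)"
        using DERIV_diff[OF y(2) dz, of r] by simp
      show "\<bar>G (y r) - G (z r)\<bar> \<le> L * \<bar>y r - z r\<bar>" using \<open>r > 0\<close> by (intro L M zM) auto
    qed
    also have "\<dots> \<le> \<bar>y (real (n t) * T) - z (real (n t) * T)\<bar> * exp (L * T)"
      using L(1) nt by (intro mult_left_mono) (auto intro: mult_left_mono)
    also have "z (real (n t) * T) = z 0"
    proof -
      interpret z: periodic_fun_simple z T by unfold_locales (rule zper)
      show ?thesis using z.plus_of_nat[of 0 "n t"] by simp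
    qed
    finally show ?thesis by simp
  qed
  have lim: "((\<lambda>t. y t - z t) \<longlongrightarrow> 0) at_top"
  proof (rule tendsto_rabs_zero_cancel, rule tendsto_sandwich[OF _ _ tendsto_const])
    show "\<forall>\<^sub>F t in at_top. \<bar>y t - z t\<bar> \<le> \<bar>y (0 + real (n t) * T) - z 0\<bar> * exp (L * T)"
      using eventually_ge_at_top[of 0] by eventually_elim (rule est)
    have "((\<lambda>t. \<bar>y (0 + real (n t) * T) - z 0\<bar> * exp (L * T)) \<longlongrightarrow> \<bar>z 0 - z 0\<bar> * exp (L * T)) at_top"
      by (intro tendsto_intros filterlim_compose[OF zlim nlim])
    then show "((\<lambda>t. \<bar>y (0 + real (n t) * T) - z 0\<bar> * exp (L * T)) \<longlongrightarrow> 0) at_top" by simp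
  qed simp
  have "((\<lambda>t. G (y t) - G (z t)) \<longlongrightarrow> 0) at_top"
  proof (rule tendsto_rabs_zero_cancel, rule tendsto_sandwich[OF _ _ tendsto_const])
    show "\<forall>\<^sub>F t in at_top. \<bar>G (y t) - G (z t)\<bar> \<le> L * \<bar>y t - z t\<bar>"
      using eventually_ge_at_top[of 0] by eventually_elim (intro L M zM)
    show "((\<lambda>t. L * \<bar>y t - z t\<bar>) \<longlongrightarrow> 0) at_top"
      using tendsto_mult_left[OF tendsto_rabs[OF lim], of L] by simp
  qed simp
  then show thesis using that[OF dz zper lim] by blast
qed

section \<open>Periodic extensions and their antiderivatives\<close>

lemma continuous_eq_on_closure_half_line:
  fixes p q :: "real \<Rightarrow> real"
  assumes "continuous_on UNIV p" "continuous_on UNIV q" "\<And>x. x > 0 \<Longrightarrow> p x = q x" "x \<ge> 0"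
  shows "p x = q x"
proof -
  have "closed {x. p x = q x}" using assms by (intro closed_Collect_eq) auto
  then have "closure {0<..} \<subseteq> {x. p x = q x}" using assms(3) by (intro closure_minimal) auto
  then show ?thesis using assms(4) by auto
qed

text \<open>Define \<open>Q x\<close> by shifting \<open>x\<close> into the half-line by any sufficiently large number of periods. Near a
given point one common number of periods works, so that \<open>Q\<close> is locally a translate of \<open>q\<close> and
hence continuous.\<close>

lemma periodic_extension:
  fixes q :: "real \<Rightarrow> real"
  assumes c: "continuous_on UNIV q" and w: "\<omega> > 0" and per: "\<And>x. x > 0 \<Longrightarrow> q (x + \<omega>) = q x"
  obtains Q where "continuous_on UNIV Q" "\<And>x. Q (x + \<omega>) = Q x" "\<And>x. x \<ge> 0 \<Longrightarrow> Q x = q x"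
proof -
  have per0: "q (x + \<omega>) = q x" if "x \<ge> 0" for x
    by (rule continuous_eq_on_closure_half_line[of "\<lambda>x. q (x + \<omega>)" q])
       (use that per in \<open>auto intro!: continuous_on_compose2[OF c] continuous_intros c\<close>)
  have pern: "q (x + real n * \<omega>) = q x" if "x \<ge> 0" for x n
  proof (induction n)
    case (Suc n)
    have "q (x + real n * \<omega> + \<omega>) = q (x + real n * \<omega>)" using that w by (intro per0) simp
    then show ?case using Suc by (simp add: algebra_simps)
  qed simp
  \<comment> \<open>A number of periods that suffices at \<open>x\<close>; by \<open>Q\<close> below, any other sufficient number gives the same value.\<close>
  define N where "N x = nat \<lceil>\<bar>x\<bar> / \<omega>\<rceil>" for x
  define Q where "Q x = q (x + real (N x) * \<omega>)" for x
  have Npos: "x + real (N x) * \<omega> \<ge> 0" for x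
  proof -
    have "\<bar>x\<bar> / \<omega> \<le> real (N x)" unfolding N_def by linarith
    then have "\<bar>x\<bar> \<le> real (N x) * \<omega>" using w by (simp add: field_simps)
    then show ?thesis by linarith
  qed
  have Q: "Q x = q (x + real n * \<omega>)" if n: "x + real n * \<omega> \<ge> 0" for x n
  proof (cases "n \<le> N x")
    case True
    then have eq: "x + real (N x) * \<omega> = x + real n * \<omega> + real (N x - n) * \<omega>"
      by (simp add: of_nat_diff algebra_simps)
    show ?thesis unfolding Q_def eq by (rule pern[OF n])
  next
    case False
    then have eq: "x + real n * \<omega> = x + real (N x) * \<omega> + real (n - N x) * \<omega>"
      by (simp add: of_nat_diff algebra_simps)
    show ?thesis unfolding Q_def eq by (rule pern[OF Npos, symmetric])
  qed
  show thesis
  proof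
    have "isCont Q x" for x
    proof -
      define n where "n = N (x - 1)"
      have pos: "x' + real n * \<omega> \<ge> 0" if "x' > x - 1" for x' using Npos[of "x - 1"] that by (simp add: n_def)
      have "continuous_on {x - 1<..} (\<lambda>x'. q (x' + real n * \<omega>))"
        by (intro continuous_on_compose2[OF c] continuous_intros) auto
      then have "continuous_on {x - 1<..} Q" by (rule continuous_on_eq) (metis Q pos greaterThan_iff)
      then show ?thesis by (simp add: continuous_on_eq_continuous_at)
    qed
    then show "continuous_on UNIV Q" by (simp add: continuous_on_eq_continuous_at)
    show "Q (x + \<omega>) = Q x" for x
    proof -
      have "x + \<omega> + real (N x) * \<omega> \<ge> 0" "x + real (Suc (N x)) * \<omega> \<ge> 0"
        using Npos[of x] w by (auto simp: algebra_simps)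
      from Q[OF this(1)] Q[OF this(2)] show ?thesis by (simp add: algebra_simps)
    qed
    show "Q x = q x" if "x \<ge> 0" for x using Q[of x 0] that by simp
  qed
qed

text \<open>For continuing an incoming wave beyond the half-line on which the data determine it, without changing
it there.\<close>

lemma half_line_antiderivative:
  fixes g G :: "real \<Rightarrow> real"
  assumes g: "continuous_on UNIV g" and G: "continuous_on UNIV G"
    and d: "\<And>x. x > 0 \<Longrightarrow> (g has_real_derivative G x) (at x)"
  obtains \<Gamma> where "\<And>x. (\<Gamma> has_real_derivative G x) (at x)" "\<And>x. x \<ge> 0 \<Longrightarrow> \<Gamma> x = g x"
proof -
  obtain H where H: "\<And>x. (H has_real_derivative G x) (at x)" using antiderivative_exists[OF G] by blast
  define \<Gamma> where "\<Gamma> x = H x + (g 0 - H 0)" for x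
  have \<Gamma>: "(\<Gamma> has_real_derivative G x) (at x)" for x
    unfolding \<Gamma>_def by (auto intro!: derivative_eq_intros H)
  have "\<Gamma> x = g x" if "x \<ge> 0" for x
  proof (cases "x = 0")
    case False
    have "\<Gamma> x - g x = \<Gamma> 0 - g 0"
    proof (rule DERIV_isconst_end[of 0 x "\<lambda>x. \<Gamma> x - g x"])
      show "continuous_on {0..x} (\<lambda>x. \<Gamma> x - g x)"
        by (intro continuous_intros continuous_on_subset[OF g] continuous_on_subset[OF DERIV_continuous_on[OF \<Gamma>]]) auto
      show "((\<lambda>x. \<Gamma> x - g x) has_real_derivative 0) (at y)" if "0 < y" for y
        using DERIV_diff[OF \<Gamma> d[OF that]] by simp
    qed (use that False in auto)
    then show ?thesis by (simp add: \<Gamma>_def)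
  qed (simp add: \<Gamma>_def)
  then show thesis using that \<Gamma> by blast
qed

text \<open>The increment over one period is the same everywhere. It need not be \<open>0\<close>: this is the drift that
cancels between an incoming wave and its reflection.\<close>

lemma antiderivative_of_periodic:
  fixes \<Gamma> G :: "real \<Rightarrow> real"
  assumes d: "\<And>x. (\<Gamma> has_real_derivative G x) (at x)" and per: "\<And>x. G (x + \<omega>) = G x"
  shows "\<Gamma> (x + \<omega>) - \<Gamma> x = \<Gamma> (y + \<omega>) - \<Gamma> y"
proof -
  have "((\<lambda>x. \<Gamma> (x + \<omega>) - \<Gamma> x) has_real_derivative 0) (at x)" for x
    using DERIV_diff[OF d[of "x + \<omega>", THEN DERIV_shift[THEN iffD1]] d[of x]] per[of x] by simp
  then show ?thesis using DERIV_isconst_all[of "\<lambda>x. \<Gamma> (x + \<omega>) - \<Gamma> x"] by blast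
qed

section \<open>Consequences of the d'Alembert decomposition\<close>

text \<open>On the half-plane of side \<open>s\<close> the arguments \<open>\<xi> = x - a t\<close> and \<open>\<eta> = x + a t\<close> vary independently
subject to \<open>s (\<xi> + \<eta>) > 0\<close>, and any two values of \<open>\<xi>\<close> admit a common \<open>\<eta>\<close>. So the wave profiles
are determined on the whole line up to one constant.\<close>

lemma dalembert_unique:
  assumes a: "a > 0" and 1: "dalembert a u f g f' g'" and 2: "dalembert a u h k h' k'" and s: "s \<in> {1, - 1}"
  obtains C where "\<And>\<xi>. f s \<xi> = h s \<xi> + C" "\<And>\<eta>. g s \<eta> = k s \<eta> - C"
proof -
  have sum: "f s \<xi> + g s \<eta> = h s \<xi> + k s \<eta>" if "s * (\<xi> + \<eta>) > 0" for \<xi> \<eta>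
  proof -
    define x where "x = (\<xi> + \<eta>) / 2"
    define t where "t = (\<eta> - \<xi>) / (2 * a)"
    have x: "x \<noteq> 0" "sgn x = s" using that s by (auto simp: x_def sgn_if zero_less_mult_iff)
    have "x - a * t = \<xi>" "x + a * t = \<eta>" using a by (auto simp: x_def t_def field_simps)
    then show ?thesis using 1 2 x unfolding dalembert_def by metis
  qed
  define C where "C = f s 0 - h s 0"
  have F: "f s \<xi> = h s \<xi> + C" for \<xi>
  proof -
    \<comment> \<open>The argument \<open>\<eta> = s (\<bar>\<xi>\<bar> + 1)\<close> is admissible both with \<open>\<xi>\<close> and with \<open>0\<close>.\<close>
    have "s * (\<xi> + s * (\<bar>\<xi>\<bar> + 1)) > 0" "s * (0 + s * (\<bar>\<xi>\<bar> + 1)) > 0" using s by auto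
    from sum[OF this(1)] sum[OF this(2)] show ?thesis by (simp add: C_def)
  qed
  have "g s \<eta> = k s \<eta> - C" for \<eta>
  proof -
    have "s * (s * (\<bar>\<eta>\<bar> + 1) + \<eta>) > 0" using s by auto
    from sum[OF this] show ?thesis using F[of "s * (\<bar>\<eta>\<bar> + 1)"] by simp
  qed
  then show thesis using that F by blast
qed

lemma dalembert_boundary_value:
  assumes 1: "dalembert a u f g f' g'" and u: "continuous_on UNIV u" and s: "s \<in> {1, - 1}"
  shows "u (0, t) = f s (- a * t) + g s (a * t)"
proof -
  \<comment> \<open>Approach the axis from the side \<open>s\<close>.\<close>
  define x where "x n = s / real (Suc n)" for n
  have x: "x n \<noteq> 0" "sgn (x n) = s" for n using s by (auto simp: x_def sgn_if divide_simps)
  have lim: "x \<longlonglongrightarrow> 0"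
    using tendsto_mult_left[OF LIMSEQ_Suc[OF lim_1_over_n], of s] by (simp add: x_def[abs_def])
  have c: "isCont (f s) \<xi>" "isCont (g s) \<xi>" for \<xi>
    using 1 s unfolding dalembert_def by (auto simp: continuous_on_eq_continuous_at)
  have cu: "isCont u z" for z using u continuous_on_eq_continuous_at open_UNIV by blast
  have "(\<lambda>n. (x n, t)) \<longlonglongrightarrow> (0, t)" by (intro tendsto_intros lim)
  then have "(\<lambda>n. u (x n, t)) \<longlonglongrightarrow> u (0, t)" by (rule isCont_tendsto_compose[OF cu])
  moreover have "(\<lambda>n. f s (x n - a * t) + g s (x n + a * t)) \<longlonglongrightarrow> f s (0 - a * t) + g s (0 + a * t)"
    by (intro tendsto_intros isCont_tendsto_compose[OF c(1)] isCont_tendsto_compose[OF c(2)] lim)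
  moreover have "u (x n, t) = f s (x n - a * t) + g s (x n + a * t)" for n
    using 1 x[of n] unfolding dalembert_def by metis
  ultimately show ?thesis using LIMSEQ_unique by fastforce
qed

text \<open>On the open set \<open>S\<close> the data give \<open>f + g\<close> and, after integration, \<open>g - f\<close> up to a constant. Both
are continuously differentiable, although \<open>f'\<close> and \<open>g'\<close> are only weak derivatives.\<close>

lemma initial_data_derivatives:
  fixes f g f' g' u0 u0' u1 :: "real \<Rightarrow> real"
  assumes a: "a > 0"
    and f: "continuous_on UNIV f" "L2_loc f'" "weak_partial 1 f f'"
    and g: "continuous_on UNIV g" "L2_loc g'" "weak_partial 1 g g'"
    and u0: "\<And>x. (u0 has_real_derivative u0' x) (at x)" "continuous_on UNIV u0'" and u1: "continuous_on UNIV u1"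
    and S: "open S" and sum: "\<And>x. x \<in> S \<Longrightarrow> f x + g x = u0 x"
    and vel: "AE x in lborel. x \<in> S \<longrightarrow> - a * f' x + a * g' x = u1 x"
    and x: "x \<in> S"
  shows "(g has_real_derivative (u0' x + u1 x / a) / 2) (at x)"
    and "(f has_real_derivative (u0' x - u1 x / a) / 2) (at x)"
proof -
  obtain e where e: "e > 0" "cball x e \<subseteq> S" using S x open_contains_cball by blast
  let ?l = "x - e" and ?r = "x + e"
  have sub: "{?l..?r} \<subseteq> S" using e by (simp add: cball_eq_atLeastAtMost)
  have i0: "(u0' has_integral (f t + g t) - (f ?l + g ?l)) {?l..t}" if "?l \<le> t" "t \<le> ?r" for t
  proof -
    have "(u0' has_integral u0 t - u0 ?l) {?l..t}"
      using that(1) by (intro fundamental_theorem_of_calculus)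
        (auto simp flip: has_real_derivative_iff_has_vector_derivative intro: has_field_derivative_at_within u0)
    moreover have "t \<in> S" "?l \<in> S" using that e(1) by (auto intro!: subsetD[OF sub])
    then have "u0 t = f t + g t" "u0 ?l = f ?l + g ?l" using sum by auto
    ultimately show ?thesis by simp
  qed
  have i1: "(u1 has_integral - a * (f t - f ?l) + a * (g t - g ?l)) {?l..t}" if "?l \<le> t" "t \<le> ?r" for t
  proof (rule has_integral_spike[OF AE_lborel_imp_negligible[OF vel]])
    show "((\<lambda>x. - a * f' x + a * g' x) has_integral - a * (f t - f ?l) + a * (g t - g ?l)) {?l..t}"
      by (intro has_integral_add has_integral_mult_right weak_partial_imp_ftc f g that(1))
    fix y assume y: "y \<in> {?l..t} - {x. \<not> (x \<in> S \<longrightarrow> - a * f' x + a * g' x = u1 x)}"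
    then have "y \<in> S" using that(2) by (intro subsetD[OF sub]) auto
    then show "u1 y = - a * f' y + a * g' y" using y by auto
  qed
  have ig: "((\<lambda>x. (u0' x + u1 x / a) / 2) has_integral g t - g ?l) {?l..t}" if "?l \<le> t" "t \<le> ?r" for t
    by (rule has_integral_eq_rhs[OF has_integral_divide[OF has_integral_add[OF i0[OF that] has_integral_divide[OF i1[OF that]]]]])
       (use a in \<open>simp add: field_simps\<close>)
  have if': "((\<lambda>x. (u0' x - u1 x / a) / 2) has_integral f t - f ?l) {?l..t}" if "?l \<le> t" "t \<le> ?r" for t
    by (rule has_integral_eq_rhs[OF has_integral_divide[OF has_integral_diff[OF i0[OF that] has_integral_divide[OF i1[OF that]]]]])
       (use a in \<open>simp add: field_simps\<close>)
  show "(g has_real_derivative (u0' x + u1 x / a) / 2) (at x)"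
    by (rule has_integral_imp_DERIV[OF _ _ _ ig])
       (use e a in \<open>auto intro!: continuous_intros continuous_on_subset[OF u0(2)] continuous_on_subset[OF u1]\<close>)
  show "(f has_real_derivative (u0' x - u1 x / a) / 2) (at x)"
    by (rule has_integral_imp_DERIV[OF _ _ _ if'])
       (use e a in \<open>auto intro!: continuous_intros continuous_on_subset[OF u0(2)] continuous_on_subset[OF u1]\<close>)
qed

text \<open>The boundary value \<open>y\<close> equals \<open>f s (- a t) + g s (a t)\<close> from either side \<open>s\<close>. In the jump
\<open>f' 1 + g' 1 - f' (- 1) - g' (- 1)\<close>, the outgoing terms \<open>f' 1\<close> and \<open>g' (- 1)\<close> can therefore be
expressed by \<open>y'\<close> and the incoming terms, which turns the jump into \<open>- 2 / a\<close> times the derivative of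
\<open>y t - g 1 (a t) - f (- 1) (- a t)\<close>. That this derivative exists in the classical sense follows
because the integrated identity has a continuous right-hand side.\<close>

lemma boundary_ode:
  assumes a: "a > 0" and \<kappa>: "\<kappa> > 0" and D: "dalembert a u f g f' g'" and u: "continuous_on UNIV u"
    and F: "continuous_on UNIV F"
    and jump: "AE t in lborel. 0 = F (u (0, t)) +
      \<kappa> * ((f' 1 (- a * t) + g' 1 (a * t)) - (f' (- 1) (- a * t) + g' (- 1) (a * t)))"
  shows "((\<lambda>t. u (0, t) - g 1 (a * t) - f (- 1) (- a * t)) has_real_derivative a / (2 * \<kappa>) * F (u (0, t))) (at t)"
proof -
  let ?w = "\<lambda>t. u (0, t) - g 1 (a * t) - f (- 1) (- a * t)"
  let ?J = "\<lambda>t. (f' 1 (- a * t) + g' 1 (a * t)) - (f' (- 1) (- a * t) + g' (- 1) (a * t))"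
  note b1 = dalembert_boundary_value[OF D u, of 1] and b2 = dalembert_boundary_value[OF D u, of "- 1"]
  have props: "continuous_on UNIV (f s)" "L2_loc (f' s)" "weak_partial 1 (f s) (f' s)"
    "continuous_on UNIV (g s)" "L2_loc (g' s)" "weak_partial 1 (g s) (g' s)" if "s \<in> {1, - 1}" for s
    using D that unfolding dalembert_def by blast+
  have int: "((\<lambda>t. a / (2 * \<kappa>) * F (u (0, t))) has_integral ?w t - ?w s) {s..t}" if "s \<le> t" for s t
  proof -
    have "((\<lambda>t. (- a / 2) * ?J t) has_integral (- a / 2) *
      (((f 1 (- a * t) - f 1 (- a * s)) / (- a) + (g 1 (a * t) - g 1 (a * s)) / a)
       - ((f (- 1) (- a * t) - f (- 1) (- a * s)) / (- a) + (g (- 1) (a * t) - g (- 1) (a * s)) / a))) {s..t}"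
      using a that
      by (intro has_integral_mult_right has_integral_diff has_integral_add
          weak_partial_imp_ftc_scaled[OF props(1-3)] weak_partial_imp_ftc_scaled[OF props(4-6)]) auto
    moreover have "AE t in lborel. (- a / 2) * ?J t = a / (2 * \<kappa>) * F (u (0, t))"
      using jump
    proof eventually_elim
      case (elim t)
      then have "F (u (0, t)) = - \<kappa> * ?J t" by simp
      then show ?case using \<kappa> by simp
    qed
    ultimately have "((\<lambda>t. a / (2 * \<kappa>) * F (u (0, t))) has_integral (- a / 2) *
      (((f 1 (- a * t) - f 1 (- a * s)) / (- a) + (g 1 (a * t) - g 1 (a * s)) / a)
       - ((f (- 1) (- a * t) - f (- 1) (- a * s)) / (- a) + (g (- 1) (a * t) - g (- 1) (a * s)) / a))) {s..t}"
      by (rule has_integral_AE_cong)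
    moreover have "(- a / 2) *
      (((f 1 (- a * t) - f 1 (- a * s)) / (- a) + (g 1 (a * t) - g 1 (a * s)) / a)
       - ((f (- 1) (- a * t) - f (- 1) (- a * s)) / (- a) + (g (- 1) (a * t) - g (- 1) (a * s)) / a))
       = ?w t - ?w s"
    proof -
      have f1: "f 1 (- a * r) = u (0, r) - g 1 (a * r)" for r using b1[of r] by simp
      have g1: "g (- 1) (a * r) = u (0, r) - f (- 1) (- a * r)" for r using b2[of r] by simp
      show ?thesis unfolding f1 g1 using a by (simp add: field_simps)
    qed
    ultimately show ?thesis by simp
  qed
  show ?thesis
  proof (rule has_integral_imp_DERIV[where a = "t - 1" and b = "t + 1"])
    show "continuous_on {t - 1..t + 1} (\<lambda>t. a / (2 * \<kappa>) * F (u (0, t)))"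
      by (intro continuous_intros continuous_on_compose2[OF F] continuous_on_compose2[OF u]) auto
  qed (use int in auto)
qed

section \<open>Local convergence of two waves with converging boundary values\<close>

text \<open>If the integrand is not integrable, the left-hand side is \<open>0\<close> by convention.\<close>

lemma set_lebesgue_integral_AE_bound:
  fixes h :: "real \<Rightarrow> real"
  assumes R: "R > 0" and B: "B \<ge> 0" and h: "AE x in lborel. x \<in> {- R<..<R} \<longrightarrow> \<bar>h x\<bar> \<le> B"
  shows "\<bar>LBINT x:{- R<..<R}. h x\<bar> \<le> 2 * R * B"
proof (cases "integrable lborel (\<lambda>x. indicat_real {- R<..<R} x *\<^sub>R h x)")
  case True
  have "ennreal \<bar>LBINT x:{- R<..<R}. h x\<bar> \<le> (\<integral>\<^sup>+x. ennreal (norm (indicat_real {- R<..<R} x *\<^sub>R h x)) \<partial>lborel)"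
    using integral_norm_bound_ennreal[OF True] by (simp add: set_lebesgue_integral_def)
  also have "\<dots> \<le> (\<integral>\<^sup>+x. ennreal B * indicator {- R<..<R} x \<partial>lborel)"
    by (rule nn_integral_mono_AE) (use h in eventually_elim, auto simp: indicator_def)
  also have "\<dots> = ennreal B * ennreal (2 * R)"
    using R by (subst nn_integral_cmult_indicator) auto
  also have "\<dots> = ennreal (2 * R * B)" using R B by (simp flip: ennreal_mult' add: mult.commute)
  finally show ?thesis using R B by (simp add: ennreal_le_iff)
next
  case False
  then show ?thesis using R B by (simp add: set_lebesgue_integral_def not_integrable_integral_eq)
qed

lemma AE_shift:
  fixes P :: "real \<Rightarrow> bool"
  assumes "Measurable.pred borel P" "AE x in lborel. P x"
  shows "AE x in lborel. P (x + c)"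
  using AE_borel_affine[of 1 P c] assms by (simp add: add.commute)

text \<open>The hypotheses say that \<open>u\<close> and \<open>v\<close> have the same incoming waves, whereas their outgoing waves differ
by \<open>d\<close>, the difference of the boundary values. Once \<open>a t > R\<close>, a point \<open>x\<close> with \<open>\<bar>x\<bar> < R\<close> sees the
outgoing wave emitted at time \<open>t - \<bar>x\<bar> / a\<close>, so \<open>u - v\<close> equals \<open>d\<close> at that time. The time
derivatives in \<open>u_t\<close>, \<open>v_t\<close> and the slopes in \<open>u_x\<close>, \<open>v_x\<close> come from arbitrary decompositions and
are known only almost everywhere; uniqueness of d'Alembert decompositions and of weak derivatives
identifies their differences with \<open>d'\<close> and \<open>d' / a\<close>, up to sign.\<close>

lemma local_convergence:
  fixes f g f' g' fp gp fp' gp' :: "real \<Rightarrow> real \<Rightarrow> real" and d d' :: "real \<Rightarrow> real"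
  assumes a: "a > 0" and D: "dalembert a u f g f' g'" and Dp: "dalembert a v fp gp fp' gp'"
    and cd: "continuous_on UNIV d" and cd': "continuous_on UNIV d'"
    and dd: "\<And>r. r > 0 \<Longrightarrow> (d has_real_derivative d' r) (at r)"
    and f1: "\<And>\<xi>. \<xi> \<le> 0 \<Longrightarrow> f 1 \<xi> - fp 1 \<xi> = d (- \<xi> / a)" and g1: "\<And>\<eta>. \<eta> \<ge> 0 \<Longrightarrow> g 1 \<eta> = gp 1 \<eta>"
    and f2: "\<And>\<xi>. \<xi> \<le> 0 \<Longrightarrow> f (- 1) \<xi> = fp (- 1) \<xi>" and g2: "\<And>\<eta>. \<eta> \<ge> 0 \<Longrightarrow> g (- 1) \<eta> - gp (- 1) \<eta> = d (\<eta> / a)"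
    and origin: "\<And>t. t \<ge> 0 \<Longrightarrow> u (0, t) - v (0, t) = d t"
    and lim: "(d \<longlongrightarrow> 0) at_top" and lim': "(d' \<longlongrightarrow> 0) at_top"
    and U: "time_slice_derivs a u u_t u_x" and V: "time_slice_derivs a v v_t v_x" and R: "R > 0"
  shows "((\<lambda>t. (LBINT x:{-R<..<R}. \<bar>u_t (x, t) - v_t (x, t)\<bar>\<^sup>2 + \<bar>u_x (x, t) - v_x (x, t)\<bar>\<^sup>2) +
               (SUP x\<in>{-R<..<R}. \<bar>u (x, t) - v (x, t)\<bar>)) \<longlongrightarrow> 0) at_top"
proof -
  obtain h k h' k' where H: "dalembert a u h k h' k'"
    and u_t: "\<And>x t. x \<noteq> 0 \<Longrightarrow> u_t (x, t) = - a * h' (sgn x) (x - a * t) + a * k' (sgn x) (x + a * t)"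
    and u_x: "\<And>x t. x \<noteq> 0 \<Longrightarrow> u_x (x, t) = h' (sgn x) (x - a * t) + k' (sgn x) (x + a * t)"
    using U unfolding time_slice_derivs_def by blast
  obtain hp kp hp' kp' where Hp: "dalembert a v hp kp hp' kp'"
    and v_t: "\<And>x t. x \<noteq> 0 \<Longrightarrow> v_t (x, t) = - a * hp' (sgn x) (x - a * t) + a * kp' (sgn x) (x + a * t)"
    and v_x: "\<And>x t. x \<noteq> 0 \<Longrightarrow> v_x (x, t) = hp' (sgn x) (x - a * t) + kp' (sgn x) (x + a * t)"
    using V unfolding time_slice_derivs_def by blast
  have props: "continuous_on UNIV (h s)" "L2_loc (h' s)" "weak_partial 1 (h s) (h' s)"
    "continuous_on UNIV (k s)" "L2_loc (k' s)" "weak_partial 1 (k s) (k' s)"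
    "continuous_on UNIV (hp s)" "L2_loc (hp' s)" "weak_partial 1 (hp s) (hp' s)"
    "continuous_on UNIV (kp s)" "L2_loc (kp' s)" "weak_partial 1 (kp s) (kp' s)" if "s \<in> {1, - 1}" for s
    using H Hp that unfolding dalembert_def by blast+
  have meas: "h' s \<in> borel_measurable borel" "k' s \<in> borel_measurable borel"
    "hp' s \<in> borel_measurable borel" "kp' s \<in> borel_measurable borel" if "s \<in> {1, - 1}" for s
    using props(2,5,8,11)[OF that] by (simp_all add: L2_loc_def)
  have md': "d' \<in> borel_measurable borel" using cd' by (rule borel_measurable_continuous_onI)
  have sub_f: "(h s \<beta> - hp s \<beta>) - (h s \<alpha> - hp s \<alpha>) = (f s \<beta> - fp s \<beta>) - (f s \<alpha> - fp s \<alpha>)"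
    and sub_g: "(k s \<beta> - kp s \<beta>) - (k s \<alpha> - kp s \<alpha>) = (g s \<beta> - gp s \<beta>) - (g s \<alpha> - gp s \<alpha>)"
    if s: "s \<in> {1, - 1}" for s \<alpha> \<beta>
  proof -
    obtain C where "\<And>\<xi>. h s \<xi> = f s \<xi> + C" "\<And>\<eta>. k s \<eta> = g s \<eta> - C"
      using dalembert_unique[OF a H D s] by blast
    moreover obtain Cp where "\<And>\<xi>. hp s \<xi> = fp s \<xi> + Cp" "\<And>\<eta>. kp s \<eta> = gp s \<eta> - Cp"
      using dalembert_unique[OF a Hp Dp s] by blast
    ultimately show "(h s \<beta> - hp s \<beta>) - (h s \<alpha> - hp s \<alpha>) = (f s \<beta> - fp s \<beta>) - (f s \<alpha> - fp s \<alpha>)"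
      "(k s \<beta> - kp s \<beta>) - (k s \<alpha> - kp s \<alpha>) = (g s \<beta> - gp s \<beta>) - (g s \<alpha> - gp s \<alpha>)" by auto
  qed
  have cs: "continuous_on UNIV (\<lambda>r. c * d' (c * r))" for c
    by (intro continuous_intros continuous_on_compose2[OF cd']) auto
  have int_d: "((\<lambda>r. c * d' (c * r)) has_integral d (c * \<beta>) - d (c * \<alpha>)) {\<alpha>..\<beta>}"
    if "\<alpha> \<le> \<beta>" "\<And>r. \<alpha> < r \<Longrightarrow> r < \<beta> \<Longrightarrow> c * r > 0" for c \<alpha> \<beta>
  proof (rule fundamental_theorem_of_calculus_interior[OF that(1)])
    show "continuous_on {\<alpha>..\<beta>} (\<lambda>r. d (c * r))" by (intro continuous_on_compose2[OF cd] continuous_intros) auto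
    fix r assume "r \<in> {\<alpha><..<\<beta>}"
    then have "c * r > 0" using that(2) by auto
    then have "((\<lambda>r. d (c * r)) has_real_derivative d' (c * r) * c) (at r)"
      by (intro DERIV_chain2[OF dd]) (auto intro!: derivative_eq_intros)
    then show "((\<lambda>r. d (c * r)) has_vector_derivative c * d' (c * r)) (at r)"
      by (simp add: has_real_derivative_iff_has_vector_derivative mult.commute)
  qed
  have s1: "(1::real) \<in> {1, - 1}" "(- 1::real) \<in> {1, - 1}" by auto
  have zero: "((\<lambda>_. 0::real) has_integral p - q) {\<alpha>..\<beta>}" if "p = q" for p q \<alpha> \<beta> :: real using that by simp
  have f1': "AE \<xi> in lborel. \<xi> \<in> {l..0} \<longrightarrow> h' 1 \<xi> - hp' 1 \<xi> = (- 1 / a) * d' ((- 1 / a) * \<xi>)" for l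
  proof (rule weak_derivative_AE_eq[OF props(1-3)[OF s1(1)] props(7-9)[OF s1(1)] cs])
    fix \<alpha> \<beta> :: real assume "\<alpha> \<le> \<beta>" "\<beta> \<le> 0"
    show "((\<lambda>\<xi>. (- 1 / a) * d' ((- 1 / a) * \<xi>)) has_integral (h 1 \<beta> - hp 1 \<beta>) - (h 1 \<alpha> - hp 1 \<alpha>)) {\<alpha>..\<beta>}"
    proof -
      have "(- 1 / a) * r > 0" if "r < \<beta>" for r
        using that \<open>\<beta> \<le> 0\<close> a by (intro mult_neg_neg) auto
      then show ?thesis
        using int_d[of \<alpha> \<beta> "- 1 / a"] sub_f[OF s1(1), of \<beta> \<alpha>] f1[of \<alpha>] f1[of \<beta>]
          \<open>\<alpha> \<le> \<beta>\<close> \<open>\<beta> \<le> 0\<close> by simp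
    qed
  qed
  have g1': "AE \<eta> in lborel. \<eta> \<in> {0..r} \<longrightarrow> k' 1 \<eta> - kp' 1 \<eta> = 0" for r
    by (rule weak_derivative_AE_eq[OF props(4-6)[OF s1(1)] props(10-12)[OF s1(1)] continuous_on_const])
       (use sub_g[OF s1(1)] g1 in \<open>auto intro!: zero\<close>)
  have f2': "AE \<xi> in lborel. \<xi> \<in> {l..0} \<longrightarrow> h' (- 1) \<xi> - hp' (- 1) \<xi> = 0" for l
    by (rule weak_derivative_AE_eq[OF props(1-3)[OF s1(2)] props(7-9)[OF s1(2)] continuous_on_const])
       (use sub_f[OF s1(2)] f2 in \<open>auto intro!: zero\<close>)
  have g2': "AE \<eta> in lborel. \<eta> \<in> {0..r} \<longrightarrow> k' (- 1) \<eta> - kp' (- 1) \<eta> = (1 / a) * d' ((1 / a) * \<eta>)" for r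
  proof (rule weak_derivative_AE_eq[OF props(4-6)[OF s1(2)] props(10-12)[OF s1(2)] cs])
    fix \<alpha> \<beta> :: real assume "0 \<le> \<alpha>" "\<alpha> \<le> \<beta>"
    then show "((\<lambda>\<eta>. (1 / a) * d' ((1 / a) * \<eta>)) has_integral (k (- 1) \<beta> - kp (- 1) \<beta>) - (k (- 1) \<alpha> - kp (- 1) \<alpha>)) {\<alpha>..\<beta>}"
      using int_d[of \<alpha> \<beta> "1 / a"] sub_g[OF s1(2), of \<beta> \<alpha>] g2[of \<alpha>] g2[of \<beta>] a by simp
  qed
  have slice: "AE x in lborel. x \<in> {- R<..<R} \<longrightarrow>
      \<bar>u_t (x, t) - v_t (x, t)\<bar>\<^sup>2 + \<bar>u_x (x, t) - v_x (x, t)\<bar>\<^sup>2 = (1 + 1 / a\<^sup>2) * (d' (t - \<bar>x\<bar> / a))\<^sup>2"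
    if t: "a * t > R" for t
  proof -
    note [measurable] = meas[OF s1(1)] meas[OF s1(2)] md'
    have "AE x in lborel. x + - a * t \<in> {- a * t - R..0} \<longrightarrow>
        h' 1 (x + - a * t) - hp' 1 (x + - a * t) = (- 1 / a) * d' ((- 1 / a) * (x + - a * t))"
      by (rule AE_shift[OF _ f1']) measurable
    moreover have "AE x in lborel. x + a * t \<in> {0..a * t + R} \<longrightarrow> k' 1 (x + a * t) - kp' 1 (x + a * t) = 0"
      by (rule AE_shift[OF _ g1']) measurable
    moreover have "AE x in lborel. x + - a * t \<in> {- a * t - R..0} \<longrightarrow>
        h' (- 1) (x + - a * t) - hp' (- 1) (x + - a * t) = 0"
      by (rule AE_shift[OF _ f2']) measurable
    moreover have "AE x in lborel. x + a * t \<in> {0..a * t + R} \<longrightarrow>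
        k' (- 1) (x + a * t) - kp' (- 1) (x + a * t) = (1 / a) * d' ((1 / a) * (x + a * t))"
      by (rule AE_shift[OF _ g2']) measurable
    moreover have "AE x in lborel. x \<noteq> (0::real)" by (rule AE_lborel_singleton)
    ultimately show ?thesis
    proof eventually_elim
      case (elim x)
      show ?case
      proof
        assume x: "x \<in> {- R<..<R}"
        have rng: "x + - a * t \<in> {- a * t - R..0}" "x + a * t \<in> {0..a * t + R}" using x t by auto
        have sq: "\<bar>- a * p + a * q - (- a * p' + a * q')\<bar>\<^sup>2 + \<bar>p + q - (p' + q')\<bar>\<^sup>2
          = (a * ((q - q') - (p - p')))\<^sup>2 + ((p - p') + (q - q'))\<^sup>2" for p q p' q'
          by (simp add: algebra_simps)
        have sum: "(a * (0 - (- 1 / a) * \<delta>))\<^sup>2 + ((- 1 / a) * \<delta> + 0)\<^sup>2 = (1 + 1 / a\<^sup>2) * \<delta>\<^sup>2"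
          "(a * ((1 / a) * \<delta> - 0))\<^sup>2 + (0 + (1 / a) * \<delta>)\<^sup>2 = (1 + 1 / a\<^sup>2) * \<delta>\<^sup>2" for \<delta>
          using a by (simp_all add: field_simps power2_eq_square)
        note eqs = u_t[OF elim(5)] u_x[OF elim(5)] v_t[OF elim(5)] v_x[OF elim(5)]
        consider "x > 0" | "x < 0" using elim(5) by linarith
        then show "\<bar>u_t (x, t) - v_t (x, t)\<bar>\<^sup>2 + \<bar>u_x (x, t) - v_x (x, t)\<bar>\<^sup>2
          = (1 + 1 / a\<^sup>2) * (d' (t - \<bar>x\<bar> / a))\<^sup>2"
        proof cases
          case 1
          have arg: "(- 1 / a) * (x + - a * t) = t - \<bar>x\<bar> / a" using 1 a by (simp add: field_simps)
          have "h' 1 (x - a * t) - hp' 1 (x - a * t) = (- 1 / a) * d' (t - \<bar>x\<bar> / a)"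
            "k' 1 (x + a * t) - kp' 1 (x + a * t) = 0"
            using elim(1,2) rng unfolding arg by auto
          moreover have "sgn x = 1" using 1 by simp
          ultimately show ?thesis unfolding eqs by (simp only: sq sum(1))
        next
          case 2
          have arg: "(1 / a) * (x + a * t) = t - \<bar>x\<bar> / a" using 2 a by (simp add: field_simps)
          have "h' (- 1) (x - a * t) - hp' (- 1) (x - a * t) = 0"
            "k' (- 1) (x + a * t) - kp' (- 1) (x + a * t) = (1 / a) * d' (t - \<bar>x\<bar> / a)"
            using elim(3,4) rng unfolding arg by auto
          moreover have "sgn x = - 1" using 2 by simp
          ultimately show ?thesis unfolding eqs by (simp only: sq sum(2))
        qed
      qed
    qed
  qed
  have diff: "u (x, t) - v (x, t) = d (t - \<bar>x\<bar> / a)" if "\<bar>x\<bar> < R" "a * t > R" for x t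
  proof -
    have "\<bar>x\<bar> < a * t" using that by linarith
    consider "x > 0" | "x < 0" | "x = 0" by linarith
    then show ?thesis
    proof cases
      case 1
      then have "u (x, t) - v (x, t) = (f 1 (x - a * t) - fp 1 (x - a * t)) + (g 1 (x + a * t) - gp 1 (x + a * t))"
        using D Dp unfolding dalembert_def by (auto simp: sgn_if)
      also have "\<dots> = d (- (x - a * t) / a)" using f1[of "x - a * t"] g1[of "x + a * t"] \<open>\<bar>x\<bar> < a * t\<close> by auto
      also have "- (x - a * t) / a = t - \<bar>x\<bar> / a" using 1 a by (simp add: field_simps)
      finally show ?thesis .
    next
      case 2
      then have "u (x, t) - v (x, t) = (f (- 1) (x - a * t) - fp (- 1) (x - a * t)) + (g (- 1) (x + a * t) - gp (- 1) (x + a * t))"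
        using D Dp unfolding dalembert_def by (auto simp: sgn_if)
      also have "\<dots> = d ((x + a * t) / a)" using f2[of "x - a * t"] g2[of "x + a * t"] \<open>\<bar>x\<bar> < a * t\<close> by auto
      also have "(x + a * t) / a = t - \<bar>x\<bar> / a" using 2 a by (simp add: field_simps)
      finally show ?thesis .
    next
      case 3
      have "t \<ge> 0" using that R a by (smt (verit) mult_nonneg_nonpos)
      then show ?thesis using origin 3 by simp
    qed
  qed
  have far: "eventually (\<lambda>t. a * t > R \<and> (\<forall>x. \<bar>x\<bar> < R \<longrightarrow> P (t - \<bar>x\<bar> / a))) at_top"
    if ev: "eventually P at_top" for P :: "real \<Rightarrow> bool"
  proof -
    obtain r where r: "\<And>x. x \<ge> r \<Longrightarrow> P x" using ev unfolding eventually_at_top_linorder by blast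
    have near: "P (t - \<bar>x\<bar> / a)" if "t \<ge> r + R / a" "\<bar>x\<bar> < R" for t x
    proof (rule r)
      have "\<bar>x\<bar> / a \<le> R / a" using that(2) a by (simp add: divide_right_mono)
      then show "r \<le> t - \<bar>x\<bar> / a" using that(1) by linarith
    qed
    have "a * t > R" if "t > R / a" for t using that a by (simp add: field_simps)
    with near show ?thesis
      by (intro eventually_mono[OF eventually_conj[OF eventually_gt_at_top[of "R / a"]
            eventually_ge_at_top[of "r + R / a"]]]) blast
  qed
  have "((\<lambda>t. LBINT x:{-R<..<R}. \<bar>u_t (x, t) - v_t (x, t)\<bar>\<^sup>2 + \<bar>u_x (x, t) - v_x (x, t)\<bar>\<^sup>2) \<longlongrightarrow> 0) at_top"
  proof (rule tendstoI)
    fix e :: real assume e: "e > 0"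
    have "((\<lambda>r. (1 + 1 / a\<^sup>2) * (d' r)\<^sup>2) \<longlongrightarrow> (1 + 1 / a\<^sup>2) * 0\<^sup>2) at_top" by (intro tendsto_intros lim')
    \<comment> \<open>On an interval of length \<open>2 R\<close> this bound on the integrand leaves at most \<open>e / 2\<close>.\<close>
    then have "eventually (\<lambda>r. (1 + 1 / a\<^sup>2) * (d' r)\<^sup>2 < e / (4 * R)) at_top"
      using e R by (intro order_tendstoD(2)[where y = "(1 + 1 / a\<^sup>2) * 0\<^sup>2"]) auto
    from far[OF this] show "eventually (\<lambda>t. dist (LBINT x:{-R<..<R}.
        \<bar>u_t (x, t) - v_t (x, t)\<bar>\<^sup>2 + \<bar>u_x (x, t) - v_x (x, t)\<bar>\<^sup>2) 0 < e) at_top"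
    proof eventually_elim
      case (elim t)
      then have t: "a * t > R" and small: "\<And>x. \<bar>x\<bar> < R \<Longrightarrow> (1 + 1 / a\<^sup>2) * (d' (t - \<bar>x\<bar> / a))\<^sup>2 < e / (4 * R)" by auto
      have "\<bar>LBINT x:{-R<..<R}. \<bar>u_t (x, t) - v_t (x, t)\<bar>\<^sup>2 + \<bar>u_x (x, t) - v_x (x, t)\<bar>\<^sup>2\<bar> \<le> 2 * R * (e / (4 * R))"
      proof (rule set_lebesgue_integral_AE_bound[OF R])
        show "AE x in lborel. x \<in> {- R<..<R} \<longrightarrow>
          \<bar>\<bar>u_t (x, t) - v_t (x, t)\<bar>\<^sup>2 + \<bar>u_x (x, t) - v_x (x, t)\<bar>\<^sup>2\<bar> \<le> e / (4 * R)"
          using slice[OF t]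
        proof eventually_elim
          case (elim x)
          show ?case
          proof
            assume x: "x \<in> {- R<..<R}"
            then have "\<bar>x\<bar> < R" by auto
            moreover have "(1 + 1 / a\<^sup>2) * (d' (t - \<bar>x\<bar> / a))\<^sup>2 \<ge> 0" by (intro mult_nonneg_nonneg) auto
            ultimately show "\<bar>\<bar>u_t (x, t) - v_t (x, t)\<bar>\<^sup>2 + \<bar>u_x (x, t) - v_x (x, t)\<bar>\<^sup>2\<bar> \<le> e / (4 * R)"
              using elim x small[of x] by simp
          qed
        qed
      qed (use e R in simp)
      also have "\<dots> < e" using e R by simp
      finally show ?case by simp
    qed
  qed
  moreover have "((\<lambda>t. SUP x\<in>{-R<..<R}. \<bar>u (x, t) - v (x, t)\<bar>) \<longlongrightarrow> 0) at_top"
  proof (rule tendstoI)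
    fix e :: real assume e: "e > 0"
    have "eventually (\<lambda>r. \<bar>d r\<bar> < e / 2) at_top" using tendstoD[OF lim, of "e / 2"] e by simp
    from far[OF this] show "eventually (\<lambda>t. dist (SUP x\<in>{-R<..<R}. \<bar>u (x, t) - v (x, t)\<bar>) 0 < e) at_top"
    proof eventually_elim
      case (elim t)
      then have bound: "\<bar>u (x, t) - v (x, t)\<bar> \<le> e / 2" if "x \<in> {- R<..<R}" for x
        using diff[of x t] that by (auto intro!: less_imp_le)
      have "(SUP x\<in>{-R<..<R}. \<bar>u (x, t) - v (x, t)\<bar>) \<le> e / 2"
        by (rule cSUP_least) (use R bound in auto)
      moreover have "\<bar>u (0, t) - v (0, t)\<bar> \<le> (SUP x\<in>{-R<..<R}. \<bar>u (x, t) - v (x, t)\<bar>)"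
        by (rule cSUP_upper) (use R bound in \<open>auto intro!: bdd_aboveI[where M = "e / 2"]\<close>)
      ultimately show ?case using e unfolding dist_real_def by linarith
    qed
  qed
  ultimately show ?thesis using tendsto_add by fastforce
qed

section \<open>Attraction to a periodic solution\<close>

theorem theorem1p6:
  fixes \<mu> \<kappa> a \<omega> :: real
    and F u0 u1 :: "real \<Rightarrow> real"
    and u :: "real \<times> real \<Rightarrow> real"
  assumes "\<mu> > 0" and "\<kappa> > 0" and "a = sqrt (\<kappa> / \<mu>)"
    and "F C1_differentiable_on UNIV"
    and "filterlim F at_bot at_top" and "filterlim F at_top at_bot"
    and "\<omega> > 0" and "(u0, u1) \<in> class_H_per \<omega>"
    and "u \<in> class_E" and "string_solution \<mu> \<kappa> F u" and "initial_data a u0 u1 u"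
  shows "\<exists>u\<^sub>p \<in> class_E. string_solution \<mu> \<kappa> F u\<^sub>p \<and>
    (\<forall>x t. \<bar>t\<bar> > \<bar>x\<bar> / a \<longrightarrow> u\<^sub>p (x, t + \<omega> / a) = u\<^sub>p (x, t)) \<and>
    (\<forall>u_t u_x up_t up_x.
       time_slice_derivs a u u_t u_x \<longrightarrow> time_slice_derivs a u\<^sub>p up_t up_x \<longrightarrow>
       (\<forall>R>0.
         ((\<lambda>t. (LBINT x:{-R<..<R}.
                  \<bar>u_t (x, t) - up_t (x, t)\<bar>\<^sup>2 + \<bar>u_x (x, t) - up_x (x, t)\<bar>\<^sup>2) +
               (SUP x\<in>{-R<..<R}. \<bar>u (x, t) - u\<^sub>p (x, t)\<bar>))
          \<longlongrightarrow> 0) at_top))"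
proof -
  have a: "a > 0" using assms(1-3) by simp
  have \<kappa>: "\<mu> * a\<^sup>2 = \<kappa>" using assms(1-3) by simp
  have \<kappa>0: "\<kappa> > 0" by fact
  have \<omega>: "\<omega> > 0" by fact
  have cu: "continuous_on UNIV u" using assms(9) by (simp add: class_E_def)
  obtain F' where F': "\<And>x. (F has_real_derivative F' x) (at x)" "continuous_on UNIV F'"
    using assms(4) by (auto simp: C1_differentiable_on_def has_real_derivative_iff_has_vector_derivative)
  have cF: "continuous_on UNIV F" by (rule DERIV_continuous_on[OF F'(1)])
  obtain u0' where u0': "\<And>x. (u0 has_real_derivative u0' x) (at x)" "continuous_on UNIV u0'"
    using assms(8) by (auto simp: class_H_per_def C1_differentiable_on_def has_real_derivative_iff_has_vector_derivative)
  have "deriv u0 = u0'" using u0'(1) DERIV_imp_deriv by blast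
  then have per: "u0' \<in> class_P \<omega>" "u1 \<in> class_P \<omega>" and cu1: "continuous_on UNIV u1"
    using assms(8) by (auto simp: class_H_per_def)
  obtain f g f' g' where D: "dalembert a u f g f' g'"
    and jump: "AE t in lborel. 0 = F (u (0, t)) +
      \<kappa> * ((f' 1 (- a * t) + g' 1 (a * t)) - (f' (- 1) (- a * t) + g' (- 1) (a * t)))"
    using assms(10) unfolding string_solution_def Let_def assms(3)[symmetric] by blast
  obtain h k h' k' where H: "dalembert a u h k h' k'"
    and Hpos: "\<And>x. x \<noteq> 0 \<Longrightarrow> h (sgn x) x + k (sgn x) x = u0 x"
    and Hvel: "AE x in lborel. x \<noteq> 0 \<longrightarrow> - a * h' (sgn x) x + a * k' (sgn x) x = u1 x"
    using assms(11) unfolding initial_data_def by blast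
  have props: "continuous_on UNIV (h s)" "L2_loc (h' s)" "weak_partial 1 (h s) (h' s)"
    "continuous_on UNIV (k s)" "L2_loc (k' s)" "weak_partial 1 (k s) (k' s)"
    "continuous_on UNIV (f s)" "continuous_on UNIV (g s)" if "s \<in> {1, - 1}" for s
    using H D that unfolding dalembert_def by blast+
  have s1: "(1::real) \<in> {1, - 1}" "(- 1::real) \<in> {1, - 1}" by auto
  have dg: "(g 1 has_real_derivative (u0' x + u1 x / a) / 2) (at x)" if "x > 0" for x
  proof -
    have sum: "h 1 x + k 1 x = u0 x" if "x > 0" for x using Hpos[of x] that by simp
    have "AE x in lborel. x \<in> {0<..} \<longrightarrow> - a * h' 1 x + a * k' 1 x = u1 x"
      using Hvel by eventually_elim auto
    then have "(k 1 has_real_derivative (u0' x + u1 x / a) / 2) (at x)"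
      using that sum by (intro initial_data_derivatives(1)[OF a props(1-6)[OF s1(1)] u0' cu1, where S = "{0<..}"]) auto
    moreover obtain C where "\<And>\<xi>. f 1 \<xi> = h 1 \<xi> + C" "\<And>\<eta>. g 1 \<eta> = k 1 \<eta> - C"
      using dalembert_unique[OF a D H s1(1)] by blast
    then have "g 1 = (\<lambda>\<eta>. k 1 \<eta> - C)" by auto
    ultimately show ?thesis by (auto intro!: derivative_eq_intros)
  qed
  have df: "(f (- 1) has_real_derivative (u0' x - u1 x / a) / 2) (at x)" if "x < 0" for x
  proof -
    have sum: "h (- 1) x + k (- 1) x = u0 x" if "x < 0" for x using Hpos[of x] that by simp
    have "AE x in lborel. x \<in> {..<0} \<longrightarrow> - a * h' (- 1) x + a * k' (- 1) x = u1 x"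
      using Hvel by eventually_elim auto
    then have "(h (- 1) has_real_derivative (u0' x - u1 x / a) / 2) (at x)"
      using that sum by (intro initial_data_derivatives(2)[OF a props(1-6)[OF s1(2)] u0' cu1, where S = "{..<0}"]) auto
    moreover obtain C where "\<And>\<xi>. f (- 1) \<xi> = h (- 1) \<xi> + C" "\<And>\<eta>. g (- 1) \<eta> = k (- 1) \<eta> - C"
      using dalembert_unique[OF a D H s1(2)] by blast
    then have "f (- 1) = (\<lambda>\<xi>. h (- 1) \<xi> + C)" by auto
    ultimately show ?thesis by (auto intro!: derivative_eq_intros)
  qed
  obtain Gp where Gp: "continuous_on UNIV Gp" "\<And>x. Gp (x + \<omega>) = Gp x"
    "\<And>x. x \<ge> 0 \<Longrightarrow> Gp x = (u0' x + u1 x / a) / 2"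
    by (rule periodic_extension[where q = "\<lambda>x. (u0' x + u1 x / a) / 2" and \<omega> = \<omega>])
       (use per a \<omega> u0'(2) cu1 in \<open>auto simp: class_P_def intro!: continuous_intros\<close>)
  obtain Fm where Fm: "continuous_on UNIV Fm" "\<And>x. Fm (x + \<omega>) = Fm x"
    "\<And>x. x \<ge> 0 \<Longrightarrow> Fm x = (u0' (- x) - u1 (- x) / a) / 2"
  proof (rule periodic_extension[where q = "\<lambda>x. (u0' (- x) - u1 (- x) / a) / 2" and \<omega> = \<omega>])
    show "continuous_on UNIV (\<lambda>x. (u0' (- x) - u1 (- x) / a) / 2)"
      by (intro continuous_intros continuous_on_compose2[OF u0'(2)] continuous_on_compose2[OF cu1]) (use a in auto)
    show "(u0' (- (x + \<omega>)) - u1 (- (x + \<omega>)) / a) / 2 = (u0' (- x) - u1 (- x) / a) / 2" if "x > 0" for x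
    proof -
      have "u0' (- x - \<omega>) = u0' (- x)" "u1 (- x - \<omega>) = u1 (- x)" using per that by (auto simp: class_P_def)
      then show ?thesis by simp
    qed
  qed (use \<omega> in auto)
  have dgp1: "(g 1 has_real_derivative Gp x) (at x)" if "x > 0" for x 
    by (rule DERIV_cong[OF dg[OF that]]) (use Gp(3)[of x] that in simp)
  obtain \<Gamma> where \<Gamma>: "\<And>x. (\<Gamma> has_real_derivative Gp x) (at x)" "\<And>x. x \<ge> 0 \<Longrightarrow> \<Gamma> x = g 1 x"
    using half_line_antiderivative[OF props(8)[OF s1(1)] Gp(1) dgp1] by blast
  \<comment> \<open>The incoming wave from the left is continued after reflection \<open>x \<mapsto> - x\<close>; \<open>Fm\<close> and \<open>\<Psi>\<close> are the
    reflections of its derivative and of the wave itself.\<close>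
  have cneg: "continuous_on UNIV (\<lambda>x. f (- 1) (- x))"
    by (intro continuous_on_compose2[OF props(7)[OF s1(2)]] continuous_intros) auto
  have df_reflected: "((\<lambda>x. f (- 1) (- x)) has_real_derivative - Fm x) (at x)" if "x > 0" for x
    by (rule DERIV_cong[OF DERIV_chain2[where f = "f (- 1)" and g = uminus, OF df[of "- x"] DERIV_minus[OF DERIV_ident]]])
       (use Fm(3)[of x] that in auto)
  obtain \<Psi> where \<Psi>: "\<And>x. (\<Psi> has_real_derivative - Fm x) (at x)" "\<And>x. x \<ge> 0 \<Longrightarrow> \<Psi> x = f (- 1) (- x)"
    using half_line_antiderivative[OF cneg continuous_on_minus[OF Fm(1)] df_reflected] by blast
  have \<Gamma>per: "\<Gamma> (x + \<omega>) - \<Gamma> x = \<Gamma> (y + \<omega>) - \<Gamma> y" for x y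
    by (rule antiderivative_of_periodic[OF \<Gamma>(1) Gp(2)])
  have \<Psi>per: "\<Psi> (x + \<omega>) - \<Psi> x = \<Psi> (y + \<omega>) - \<Psi> y" for x y
    by (rule antiderivative_of_periodic[OF \<Psi>(1)]) (simp add: Fm(2))
  define c where "c = a / (2 * \<kappa>)"
  have c: "c > 0" using a \<kappa>0 by (simp add: c_def)
  define p where "p t = a * Gp (a * t) - a * Fm (a * t)" for t
  have cp: "continuous_on UNIV p"
    unfolding p_def by (intro continuous_intros continuous_on_compose2[OF Gp(1)] continuous_on_compose2[OF Fm(1)]) auto
  have pper: "p (t + \<omega> / a) = p t" for t
  proof -
    have "a * (t + \<omega> / a) = a * t + \<omega>" using a by (simp add: field_simps)
    then show ?thesis by (simp add: p_def Gp(2) Fm(2))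
  qed
  define y where "y t = u (0, t)" for t
  have cy: "continuous_on UNIV y"
    unfolding y_def by (intro continuous_on_compose2[OF cu] continuous_intros) auto
  have dy: "(y has_real_derivative c * F (y t) + p t) (at t)" if t: "t > 0" for t
  proof -
    have at: "a * t > 0" using a t by simp
    have 1: "((\<lambda>t. g 1 (a * t)) has_real_derivative Gp (a * t) * a) (at t)"
      by (rule DERIV_chain2[where f = "g 1" and g = "\<lambda>t. a * t", OF dgp1[OF at]])
         (auto intro!: derivative_eq_intros)
    have 2: "((\<lambda>t. f (- 1) (- (a * t))) has_real_derivative - Fm (a * t) * a) (at t)"
      by (rule DERIV_chain2[where f = "\<lambda>x. f (- 1) (- x)" and g = "\<lambda>t. a * t", OF df_reflected[OF at]])
         (auto intro!: derivative_eq_intros)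
    have "((\<lambda>t. (u (0, t) - g 1 (a * t) - f (- 1) (- a * t)) + (g 1 (a * t) + f (- 1) (- (a * t))))
        has_real_derivative a / (2 * \<kappa>) * F (u (0, t)) + (Gp (a * t) * a + - Fm (a * t) * a)) (at t)"
      by (intro DERIV_add 1 2 boundary_ode[OF a \<kappa>0 D cu cF jump])
    then show ?thesis by (simp add: y_def[abs_def] c_def p_def algebra_simps)
  qed
  have G1: "filterlim (\<lambda>x. c * F x) at_bot at_top"
    using c assms(5) by (intro filterlim_tendsto_pos_mult_at_bot[OF tendsto_const])
  have G2: "filterlim (\<lambda>x. c * F x) at_top at_bot"
    using c assms(6) by (intro filterlim_tendsto_pos_mult_at_top[OF tendsto_const])
  have dG: "((\<lambda>x. c * F x) has_real_derivative c * F' x) (at x)" for x by (intro DERIV_cmult F')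
  have cG': "continuous_on UNIV (\<lambda>x. c * F' x)" by (intro continuous_intros F')
  have T: "\<omega> / a > 0" using a \<omega> by simp
  obtain z where z: "\<And>t. (z has_real_derivative c * F (z t) + p t) (at t)" "\<And>t. z (t + \<omega> / a) = z t"
    "((\<lambda>t. y t - z t) \<longlongrightarrow> 0) at_top" "((\<lambda>t. c * F (y t) - c * F (z t)) \<longlongrightarrow> 0) at_top"
    by (rule dissipative_ode_periodic_attractor[OF G1 G2 dG cG' cp pper T continuous_on_subset[OF cy] dy]) auto
  have cz: "continuous_on UNIV z" by (rule DERIV_continuous_on[OF z(1)])
  define z' where "z' t = c * F (z t) + p t" for t
  have cz': "continuous_on UNIV z'"
    unfolding z'_def by (intro continuous_intros cp continuous_on_compose2[OF cF cz]) auto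
  \<comment> \<open>The incoming waves are \<open>\<Gamma>\<close> from the right and \<open>\<Psi>\<close>, reflected, from the left. The outgoing
    waves are chosen so that both sides have the boundary value \<open>z\<close>.\<close>
  define fp where "fp s \<xi> = (if s = 1 then z (- 1 / a * \<xi>) - \<Gamma> (- \<xi>) else \<Psi> (- \<xi>))" for s \<xi> :: real
  define gp where "gp s \<eta> = (if s = 1 then \<Gamma> \<eta> else z (1 / a * \<eta>) - \<Psi> \<eta>)" for s \<eta> :: real
  define fp' where "fp' s \<xi> = (if s = 1 then - 1 / a * z' (- 1 / a * \<xi>) + Gp (- \<xi>) else Fm (- \<xi>))" for s \<xi> :: real
  define gp' where "gp' s \<eta> = (if s = 1 then Gp \<eta> else 1 / a * z' (1 / a * \<eta>) + Fm \<eta>)" for s \<eta> :: real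
  have dz: "((\<lambda>\<xi>. z (b * \<xi>)) has_real_derivative b * z' (b * \<xi>)) (at \<xi>)" for b \<xi>
    by (rule DERIV_cong, rule DERIV_chain2[OF z(1)]) (auto intro!: derivative_eq_intros simp: z'_def)
  have mirror: "((\<lambda>\<xi>. A (- \<xi>)) has_real_derivative - B (- \<xi>)) (at \<xi>)"
    if "\<And>x. (A has_real_derivative B x) (at x)" for A B :: "real \<Rightarrow> real" and \<xi>
    using DERIV_chain2[where f = A and g = uminus, OF that DERIV_minus[OF DERIV_ident]] by simp
  have dfp: "(fp s has_real_derivative fp' s x) (at x)" for s x
  proof (cases "s = 1")
    case True
    have "((\<lambda>\<xi>. z (- 1 / a * \<xi>) - \<Gamma> (- \<xi>)) has_real_derivative - 1 / a * z' (- 1 / a * x) - - Gp (- x)) (at x)"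
      by (intro DERIV_diff dz mirror \<Gamma>(1))
    then show ?thesis using True by (simp add: fp_def[abs_def] fp'_def)
  next
    case False
    then show ?thesis using mirror[OF \<Psi>(1), of x] by (simp add: fp_def[abs_def] fp'_def)
  qed
  have dgp: "(gp s has_real_derivative gp' s x) (at x)" for s x
  proof (cases "s = 1")
    case True
    then show ?thesis using \<Gamma>(1)[of x] by (simp add: gp_def[abs_def] gp'_def)
  next
    case False
    have "((\<lambda>\<eta>. z (1 / a * \<eta>) - \<Psi> \<eta>) has_real_derivative 1 / a * z' (1 / a * x) - - Fm x) (at x)"
      by (intro DERIV_diff dz \<Psi>(1))
    then show ?thesis using False by (simp add: gp_def[abs_def] gp'_def)
  qed
  have cfp': "continuous_on UNIV (fp' s)" for s
    using a by (cases "s = 1") (auto simp: fp'_def[abs_def] intro!: continuous_intros continuous_on_compose2[OF cz']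
        continuous_on_compose2[OF Gp(1)] continuous_on_compose2[OF Fm(1)])
  have cgp': "continuous_on UNIV (gp' s)" for s
    using a by (cases "s = 1") (auto simp: gp'_def[abs_def] intro!: continuous_intros continuous_on_compose2[OF cz'] Gp(1) Fm(1))
  have trace: "fp 1 (- a * t) + gp 1 (a * t) = z t" "fp (- 1) (- a * t) + gp (- 1) (a * t) = z t" for t
    using a by (simp_all add: fp_def gp_def)
  define up where "up = (\<lambda>z. fp (side (fst z)) (fst z + - a * snd z) + gp (side (fst z)) (fst z + a * snd z))"
  have up: "up \<in> class_E" "dalembert a up fp gp fp' gp'" "wave_eq_off_0 \<mu> \<kappa> up"
    unfolding up_def
    by (rule glued_waves[where f = fp and g = gp and f' = fp' and g' = gp', OF a \<kappa> dfp dgp cfp' cgp'];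
        simp only: trace)+
  have up0: "up (0, t) = z t" for t using trace(1)[of t] by (simp add: up_def side_def)
  have sol: "string_solution \<mu> \<kappa> F up"
    unfolding string_solution_def Let_def assms(3)[symmetric]
  proof (intro conjI exI)
    show "dalembert a up fp gp fp' gp'" "wave_eq_off_0 \<mu> \<kappa> up" by (fact up)+
    show "AE t in lborel. 0 = F (up (0, t)) +
      \<kappa> * (fp' 1 (- a * t) + gp' 1 (a * t) - (fp' (- 1) (- a * t) + gp' (- 1) (a * t)))"
    proof (rule AE_I2)
      fix t
      have "- 1 / a * (- a * t) = t" "1 / a * (a * t) = t" using a by auto
      then have "fp' 1 (- a * t) + gp' 1 (a * t) - (fp' (- 1) (- a * t) + gp' (- 1) (a * t))
          = 2 * Gp (a * t) - 2 * Fm (a * t) - 2 / a * z' t"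
        by (simp add: fp'_def gp'_def)
      also have "\<dots> = - (2 / a * c) * F (z t)"
        using a by (simp add: z'_def p_def field_simps)
      also have "2 / a * c = 1 / \<kappa>" using a \<kappa>0 by (simp add: c_def field_simps)
      finally show "0 = F (up (0, t)) +
        \<kappa> * (fp' 1 (- a * t) + gp' 1 (a * t) - (fp' (- 1) (- a * t) + gp' (- 1) (a * t)))"
        using assms(2) by (simp add: up0)
    qed
  qed
  have period: "up (x, t + \<omega> / a) = up (x, t)" for x t
  proof -
    have shift: "x + - a * (t + \<omega> / a) = x + - a * t - \<omega>" "x + a * (t + \<omega> / a) = x + a * t + \<omega>"
      using a by (simp_all add: field_simps)
    have args: "- 1 / a * (\<xi> - \<omega>) = - 1 / a * \<xi> + \<omega> / a" "1 / a * (\<eta> + \<omega>) = 1 / a * \<eta> + \<omega> / a" for \<xi> \<eta>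
      by (simp_all add: diff_divide_distrib add_divide_distrib)
    have zs: "z (- 1 / a * (\<xi> - \<omega>)) = z (- 1 / a * \<xi>)" "z (1 / a * (\<eta> + \<omega>)) = z (1 / a * \<eta>)" for \<xi> \<eta>
      by (simp_all only: args z(2))
    have neg: "- (x + - a * t - \<omega>) = - (x + - a * t) + \<omega>" by simp
    \<comment> \<open>The two occurrences of \<open>\<Gamma>\<close> (or of \<open>\<Psi>\<close>) have opposite signs and grow by the same amount.\<close>
    show ?thesis
      using \<Gamma>per[of "- (x + - a * t)" "x + a * t"] \<Psi>per[of "- (x + - a * t)" "x + a * t"]
      by (simp only: up_def fst_conv snd_conv shift fp_def gp_def zs neg) (simp split: if_split)
  qed
  have conv: "((\<lambda>t. (LBINT x:{-R<..<R}.
                  \<bar>u_t (x, t) - up_t (x, t)\<bar>\<^sup>2 + \<bar>u_x (x, t) - up_x (x, t)\<bar>\<^sup>2) +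
               (SUP x\<in>{-R<..<R}. \<bar>u (x, t) - up (x, t)\<bar>)) \<longlongrightarrow> 0) at_top"
    if "time_slice_derivs a u u_t u_x" "time_slice_derivs a up up_t up_x" "R > 0" for u_t u_x up_t up_x R
  proof (rule local_convergence[OF a D up(2) _ _ _ _ _ _ _ _ z(3,4) that])
    show "continuous_on UNIV (\<lambda>t. y t - z t)" by (intro continuous_intros cy cz)
    show "continuous_on UNIV (\<lambda>t. c * F (y t) - c * F (z t))"
      by (intro continuous_intros continuous_on_compose2[OF cF cy] continuous_on_compose2[OF cF cz]) auto
    show "((\<lambda>t. y t - z t) has_real_derivative c * F (y r) - c * F (z r)) (at r)" if "r > 0" for r
      using DERIV_diff[OF dy[OF that] z(1)] by simp
    show "f 1 \<xi> - fp 1 \<xi> = y (- \<xi> / a) - z (- \<xi> / a)" if "\<xi> \<le> 0" for \<xi>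
      using dalembert_boundary_value[OF D cu s1(1), of "- \<xi> / a"] \<Gamma>(2)[of "- \<xi>"] a that
      by (simp add: y_def fp_def)
    show "g 1 \<eta> = gp 1 \<eta>" if "\<eta> \<ge> 0" for \<eta> using \<Gamma>(2) that by (simp add: gp_def)
    show "f (- 1) \<xi> = fp (- 1) \<xi>" if "\<xi> \<le> 0" for \<xi> using \<Psi>(2)[of "- \<xi>"] that by (simp add: fp_def)
    show "g (- 1) \<eta> - gp (- 1) \<eta> = y (\<eta> / a) - z (\<eta> / a)" if "\<eta> \<ge> 0" for \<eta>
      using dalembert_boundary_value[OF D cu s1(2), of "\<eta> / a"] \<Psi>(2)[of \<eta>] a that
      by (simp add: y_def gp_def)
    show "u (0, t) - up (0, t) = y t - z t" for t by (simp add: up0 y_def)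
  qed
  show ?thesis using up(1) sol period conv by blast
qed

end
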